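(* Let $f_{ij}\in L^\infty(\mathbb R^3)\cap C^\alpha_{\mathrm{loc}}(\mathbb R^3)$ for some $\alpha>0$ and all $1\le i,j\le3$, and assume that $p\in BMO(\mathbb R^3)$ solves the Poisson equation $$\Delta p=-\partial_i\partial_jf_{ij}$$ in the sense of distributions (summation over $i,j$ implied). Define $\bar p$ as follows: - if $x\in B_1(0)$, then $\bar p(x)=G_{ij}^{B_2(0)}f_{ij}(x)$; - if $x\in B_n(0)$, then $\bar p(x)=G_{ij}^{B_{n+1}(0)}f_{ij}(x)+\sum_{k=2}^nc_k$, where $$c_k=G_{ij}^{B_k(0)}f_{ij}-G_{ij}^{B_{k+1}(0)}f_{ij}=-\int\big(K_{ij}^{2k}(-y)-K_{ij}^{2(k+1)}(-y)\big)f_{ij}(y)\,dy$$ is a constant. Then $\bar p$ is a well defined distributional solution of $\Delta\bar p=-\partial_i\partial_jf_{ij}$ and, for any ball $B\subset\mathbb R^3$, $$\int_{\mathbb R^3}p\,\psi\,dx=\int_{\mathbb R^3}(G_{ij}^Bf_{ij})\,\psi\,dx=\int_{\mathbb R^3}\bar p\,\psi\,dx$$ for all $\psi$ which are bounded, supported in $B$, and have mean zero. In particular $p=\bar p$ in $BMO$.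
   Context: Repeated indices $i,j\in\{1,2,3\}$ are summed. $B_r(x_0)$ is the open ball in $\mathbb R^3$. $K_{ij}(y)=\partial_i\partial_j\frac1{4\pi|y|}=\frac{-\delta_{ij}|y|^2+3y_iy_j}{4\pi|y|^5}$. Fix $\Theta\in C_c^\infty(\mathbb R^3)$ with $\Theta=1$ on $B_2(0)$ and $\operatorname{supp}\Theta\subset B_4(0)$; for $R>0$ let $\theta_R(x)=\Theta(x/R)$ and $K_{ij}^{2R}(x)=K_{ij}(x)(1-\theta_R(x))$ (so e.g. $K_{ij}^{2k}=K_{ij}(1-\theta_k)$). For a ball $B=B_R(x_0)$, $$G_{ij}^Bf(x)=-\tfrac13\delta_{ij}f(x)+\lim_{\epsilon\to0}\int_{|x-y|>\epsilon}\big(K_{ij}(x-y)-K_{ij}^{2R}(x_0-y)\big)f(y)\,dy.$$ A function $p\in L^1_{\mathrm{loc}}$ solves $\Delta p=-\partial_i\partial_jf_{ij}$ distributionally if $\int p\,\Delta\phi\,dx=-\int f_{ij}\,\partial_i\partial_j\phi\,dx$ for all $\phi\in C_c^\infty(\mathbb R^3)$. Equality in $BMO$ is equality modulo additive constants. *)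

theory Defs
  imports "HOL-Analysis.Analysis"
begin

type_synonym R3 = "real ^ 3"

definition partial_deriv :: "3 \<Rightarrow> (R3 \<Rightarrow> real) \<Rightarrow> R3 \<Rightarrow> real" where
  "partial_deriv i f x = frechet_derivative f (at x) (axis i 1)"

primrec C_k :: "nat \<Rightarrow> (R3 \<Rightarrow> real) \<Rightarrow> bool" where
  "C_k 0 f \<longleftrightarrow> continuous_on UNIV f"
| "C_k (Suc k) f \<longleftrightarrow> (\<forall>x. f differentiable (at x)) \<and> (\<forall>i. C_k k (partial_deriv i f))"

definition supp :: "(R3 \<Rightarrow> real) \<Rightarrow> R3 set" where
  "supp f = closure {x. f x \<noteq> 0}"

definition test_function :: "(R3 \<Rightarrow> real) \<Rightarrow> bool" where
  "test_function f \<longleftrightarrow> (\<forall>k. C_k k f) \<and> compact (supp f)"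

definition laplacian :: "(R3 \<Rightarrow> real) \<Rightarrow> R3 \<Rightarrow> real" where
  "laplacian f x = (\<Sum>i\<in>UNIV. partial_deriv i (partial_deriv i f) x)"

definition L1_loc :: "(R3 \<Rightarrow> real) \<Rightarrow> bool" where
  "L1_loc f \<longleftrightarrow> (\<forall>S. compact S \<longrightarrow> set_integrable lebesgue S f)"

definition L_inf :: "(R3 \<Rightarrow> real) \<Rightarrow> bool" where
  "L_inf f \<longleftrightarrow> f \<in> borel_measurable lebesgue \<and> (\<exists>C. AE x in lebesgue. \<bar>f x\<bar> \<le> C)"

text \<open>Local Hoelder continuity with exponent \<open>\<alpha>\<close>. Functions in a Hoelder class of order above
  one (continuously differentiable functions with Hoelder derivatives) satisfy this condition with
  exponent one.\<close>

definition C_alpha_loc :: "real \<Rightarrow> (R3 \<Rightarrow> real) \<Rightarrow> bool" where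
  "C_alpha_loc \<alpha> f \<longleftrightarrow>
    (\<forall>S. compact S \<longrightarrow> (\<exists>C. \<forall>x\<in>S. \<forall>y\<in>S. \<bar>f x - f y\<bar> \<le> C * norm (x - y) powr \<alpha>))"

definition avg :: "R3 set \<Rightarrow> (R3 \<Rightarrow> real) \<Rightarrow> real" where
  "avg B f = (LINT x:B|lebesgue. f x) / measure lebesgue B"

definition BMO :: "(R3 \<Rightarrow> real) \<Rightarrow> bool" where
  "BMO f \<longleftrightarrow> L1_loc f \<and>
    (\<exists>M. \<forall>x0. \<forall>r>0. avg (ball x0 r) (\<lambda>x. \<bar>f x - avg (ball x0 r) f\<bar>) \<le> M)"

definition BMO_eq :: "(R3 \<Rightarrow> real) \<Rightarrow> (R3 \<Rightarrow> real) \<Rightarrow> bool" where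
  "BMO_eq f g \<longleftrightarrow> BMO f \<and> BMO g \<and> (\<exists>c. AE x in lebesgue. f x = g x + c)"

text \<open>\<open>p\<close> is a distributional solution of \<open>\<Delta> p = - \<partial>\<^sub>i \<partial>\<^sub>j f\<^sub>i\<^sub>j\<close>.\<close>

definition solves_poisson :: "(3 \<Rightarrow> 3 \<Rightarrow> R3 \<Rightarrow> real) \<Rightarrow> (R3 \<Rightarrow> real) \<Rightarrow> bool" where
  "solves_poisson f p \<longleftrightarrow> L1_loc p \<and>
    (\<forall>\<phi>. test_function \<phi> \<longrightarrow>
      (LINT x|lebesgue. p x * laplacian \<phi> x) =
      - (LINT x|lebesgue. (\<Sum>i\<in>UNIV. \<Sum>j\<in>UNIV. f i j x * partial_deriv i (partial_deriv j \<phi>) x)))"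

definition kdelta :: "3 \<Rightarrow> 3 \<Rightarrow> real" where
  "kdelta i j = (if i = j then 1 else 0)"

text \<open>\<open>K\<^sub>i\<^sub>j = \<partial>\<^sub>i \<partial>\<^sub>j (1 / (4 \<pi> |y|))\<close> away from the origin; division by zero gives the value 0 there.\<close>

definition Kker :: "3 \<Rightarrow> 3 \<Rightarrow> R3 \<Rightarrow> real" where
  "Kker i j y = (- kdelta i j * norm y ^ 2 + 3 * (y $ i) * (y $ j)) / (4 * pi * norm y ^ 5)"

text \<open>\<open>Kfar \<Theta> R\<close> is the kernel written \<open>K\<^sup>2\<^sup>R\<close> in the literature: the factor 2 records that it
  vanishes on the ball of radius \<open>2 R\<close>, while the cutoff itself is \<open>\<Theta> (x / R)\<close>.\<close>

definition Kfar :: "(R3 \<Rightarrow> real) \<Rightarrow> real \<Rightarrow> 3 \<Rightarrow> 3 \<Rightarrow> R3 \<Rightarrow> real" where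
  "Kfar \<Theta> R i j x = Kker i j x * (1 - \<Theta> (x /\<^sub>R R))"

definition G_integrand ::
    "(R3 \<Rightarrow> real) \<Rightarrow> R3 \<Rightarrow> real \<Rightarrow> 3 \<Rightarrow> 3 \<Rightarrow> (R3 \<Rightarrow> real) \<Rightarrow> R3 \<Rightarrow> R3 \<Rightarrow> real" where
  "G_integrand \<Theta> x0 R i j f x y = (Kker i j (x - y) - Kfar \<Theta> R i j (x0 - y)) * f y"

definition G_trunc ::
    "(R3 \<Rightarrow> real) \<Rightarrow> R3 \<Rightarrow> real \<Rightarrow> 3 \<Rightarrow> 3 \<Rightarrow> (R3 \<Rightarrow> real) \<Rightarrow> R3 \<Rightarrow> real \<Rightarrow> real" where
  "G_trunc \<Theta> x0 R i j f x \<epsilon> =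
    (LINT y:{y. norm (x - y) > \<epsilon>}|lebesgue. G_integrand \<Theta> x0 R i j f x y)"

text \<open>\<open>G\<^sub>i\<^sub>j\<^sup>B f (x)\<close> for the ball \<open>B\<close> of centre \<open>x0\<close> and radius \<open>R\<close>. Its value is meaningful only where
  \<open>G_well_defined\<close> holds.\<close>

definition G :: "(R3 \<Rightarrow> real) \<Rightarrow> R3 \<Rightarrow> real \<Rightarrow> 3 \<Rightarrow> 3 \<Rightarrow> (R3 \<Rightarrow> real) \<Rightarrow> R3 \<Rightarrow> real" where
  "G \<Theta> x0 R i j f x =
    - (1 / 3) * kdelta i j * f x + Lim (at_right 0) (G_trunc \<Theta> x0 R i j f x)"

definition G_well_defined ::
    "(R3 \<Rightarrow> real) \<Rightarrow> R3 \<Rightarrow> real \<Rightarrow> 3 \<Rightarrow> 3 \<Rightarrow> (R3 \<Rightarrow> real) \<Rightarrow> R3 \<Rightarrow> bool" where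
  "G_well_defined \<Theta> x0 R i j f x \<longleftrightarrow>
    (\<forall>\<epsilon>>0. set_integrable lebesgue {y. norm (x - y) > \<epsilon>} (G_integrand \<Theta> x0 R i j f x)) \<and>
    (\<exists>l. (G_trunc \<Theta> x0 R i j f x \<longlongrightarrow> l) (at_right 0))"

definition G_sum :: "(R3 \<Rightarrow> real) \<Rightarrow> R3 \<Rightarrow> real \<Rightarrow> (3 \<Rightarrow> 3 \<Rightarrow> R3 \<Rightarrow> real) \<Rightarrow> R3 \<Rightarrow> real" where
  "G_sum \<Theta> x0 R f x = (\<Sum>i\<in>UNIV. \<Sum>j\<in>UNIV. G \<Theta> x0 R i j (f i j) x)"

definition c_integrand ::
    "(R3 \<Rightarrow> real) \<Rightarrow> nat \<Rightarrow> 3 \<Rightarrow> 3 \<Rightarrow> (R3 \<Rightarrow> real) \<Rightarrow> R3 \<Rightarrow> real" where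
  "c_integrand \<Theta> k i j f y = (Kfar \<Theta> (real k) i j (- y) - Kfar \<Theta> (real (k + 1)) i j (- y)) * f y"

definition c_const :: "(R3 \<Rightarrow> real) \<Rightarrow> (3 \<Rightarrow> 3 \<Rightarrow> R3 \<Rightarrow> real) \<Rightarrow> nat \<Rightarrow> real" where
  "c_const \<Theta> f k = - (\<Sum>i\<in>UNIV. \<Sum>j\<in>UNIV. (LINT y|lebesgue. c_integrand \<Theta> k i j (f i j) y))"

text \<open>The defining clauses of \<open>p\<close>-bar. The clauses for different \<open>n\<close> overlap, so existence and
  uniqueness of such a function is the claim that \<open>p\<close>-bar is well defined.\<close>

definition pbar_spec :: "(R3 \<Rightarrow> real) \<Rightarrow> (3 \<Rightarrow> 3 \<Rightarrow> R3 \<Rightarrow> real) \<Rightarrow> (R3 \<Rightarrow> real) \<Rightarrow> bool" where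
  "pbar_spec \<Theta> f pbar \<longleftrightarrow>
    (\<forall>x\<in>ball 0 1. pbar x = G_sum \<Theta> 0 2 f x) \<and>
    (\<forall>n\<ge>2. \<forall>x\<in>ball 0 (real n).
      pbar x = G_sum \<Theta> 0 (real (n + 1)) f x + (\<Sum>k=2..n. c_const \<Theta> f k))"

end

theory Submission
  imports Defs
begin

text \<open>
  Let \<open>w\<^sub>e(z) = (|z|\<^sup>2 + e\<^sup>2)\<^sup>-\<^sup>1\<^sup>/\<^sup>2\<close>, a smooth regularisation of \<open>4 \<pi>\<close> times the Newton kernel. The function
  \<open>u(y) = w\<^sub>e(a - y) - w\<^sub>e(b - y)\<close> satisfies \<open>|\<partial>\<^sup>k u| = O(|y|\<^sup>-\<^sup>2\<^sup>-\<^sup>k)\<close>, and a BMO function is integrable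
  against \<open>(1 + |y|)\<^sup>-\<^sup>4\<close>, so cutting off shows that the Poisson equation may be tested with \<open>u\<close>.
  As \<open>e\<close> tends to 0, the left-hand side tends to \<open>4 \<pi> (p(a) - p(b))\<close> at Lebesgue points because
  \<open>- \<Delta> w\<^sub>e = 3 e\<^sup>2 w\<^sub>e\<^sup>5\<close> is an approximate identity of mass \<open>4 \<pi>\<close>; the right-hand side tends to the
  difference of the principal value integrals, the term \<open>- f / 3\<close> coming from the mass that the trace
  of the Hessian of \<open>w\<^sub>e\<close> concentrates at the origin. Hence \<open>p\<close> and \<open>G\<^sub>i\<^sub>j\<^sup>B f\<^sub>i\<^sub>j\<close> differ by a constant almost
  everywhere, for every ball. All claims about \<open>p\<close>-bar follow from this, without any Calderon-Zygmund
  estimate or Liouville theorem.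
\<close>

subsection \<open>Dyadic estimates\<close>

text \<open>Two base points are forced by growth at infinity: the Hessian of one kernel decays only
  like |y|^(-3), which is not integrable there, whereas a difference of two translates gains a power
  by the mean value theorem. The subtraction of \<open>Kfar\<close> inside \<open>G\<close> serves
  the same purpose. That term does not depend on x, so it drops out of the difference of
  \<open>G\<close> at a and b; this is why all balls give the same function up to a constant. Near
  the pole the obstacle is opposite: |z|^(-3) is not integrable, and only the Hoelder continuity of
  \<open>f\<close> supplies a majorant uniform in e. What has to be subtracted for this is evaluated
  exactly by symmetry, with value zero for the truncated kernel and a multiple of \<open>f x\<close>
  for the regularised one. The constants c_k telescope, so p-bar is globally the
  \<open>G_sum\<close> of the ball of radius 2 about the origin; its membership in BMO is inherited
  from p, from which it differs by a constant almost everywhere.\<close>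

lemma borel_ball [measurable]: "ball (a :: 'a::metric_space) r \<in> sets borel"
  by simp

lemma emeasure_ball_R3:
  "r \<ge> 0 \<Longrightarrow> emeasure lborel (ball (c :: R3) r) = ennreal (4 / 3 * pi * r ^ 3)"
  by (simp add: emeasure_ball unit_ball_vol_3)

text \<open>The least k with \<open>t < 2 ^ k * e\<close> works: minimality gives 2^(k-1) e \<le> t,
  and passing from k-1 to k costs the factor 2. For k = 0 the quotient is at most 1 anyway.\<close>

lemma dyadic_scale:
  fixes t e :: real
  assumes "t \<ge> 0" "e > 0"
  obtains k where "t < 2 ^ k * e" "e / (e + t) \<le> 2 / 2 ^ k"
proof -
  define k where "k = (LEAST k. t < 2 ^ k * e)"
  have "\<exists>k. t / e < 2 ^ k"
    using real_arch_pow[of 2 "t / e"] by auto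
  then have ex: "\<exists>k. t < 2 ^ k * e"
    using assms by (auto simp: field_simps)
  then have 1: "t < 2 ^ k * e"
    unfolding k_def by (rule LeastI_ex)
  have "e / (e + t) \<le> 2 / 2 ^ k"
  proof (cases k)
    case 0
    with assms show ?thesis by (simp add: field_simps)
  next
    case (Suc j)
    then have "\<not> t < 2 ^ j * e"
      using not_less_Least[of j "\<lambda>k. t < 2 ^ k * e"] by (simp add: k_def)
    then have "2 ^ j * e \<le> e + t" using assms by simp
    with Suc assms show ?thesis by (simp add: field_simps)
  qed
  with 1 show ?thesis using that by blast
qed

text \<open>Each y lies in some ball of radius 2^k e on which the weight is at most (2 / 2^k)^m, so
  a single term of the series already dominates the integrand at y. Only the mass of
  \<open>q\<close> on dyadic balls enters. The scale e = 1 serves weights at infinity, small e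
  serves the approximate identity.\<close>

lemma nn_integral_dyadic:
  fixes q :: "'a::euclidean_space \<Rightarrow> ennreal" and a :: 'a
  assumes q: "q \<in> borel_measurable borel" and e: "e > 0"
    and B: "\<And>k. (\<integral>\<^sup>+y. q y * indicator (ball a (2 ^ k * e)) y \<partial>lborel) \<le> ennreal (B k)"
    and B0: "\<And>k. B k \<ge> 0"
    and S: "summable (\<lambda>k. B k / 2 ^ (m * k))"
  shows "(\<integral>\<^sup>+y. q y * ennreal ((e / (e + norm (a - y))) ^ m) \<partial>lborel)
    \<le> ennreal (2 ^ m * (\<Sum>k. B k / 2 ^ (m * k)))"
proof -
  let ?c = "\<lambda>k. ennreal (2 ^ m / 2 ^ (m * k))"
  let ?g = "\<lambda>k y. ?c k * (q y * indicator (ball a (2 ^ k * e)) y)"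
  have *: "(\<integral>\<^sup>+y. ?g k y \<partial>lborel) = ?c k * (\<integral>\<^sup>+y. q y * indicator (ball a (2 ^ k * e)) y \<partial>lborel)" for k
    by (rule nn_integral_cmult, rule borel_measurable_times_ennreal) (use q in simp_all)
  have "q y * ennreal ((e / (e + norm (a - y))) ^ m) \<le> (\<Sum>k. ?g k y)" for y
  proof -
    obtain k where k: "norm (a - y) < 2 ^ k * e" "e / (e + norm (a - y)) \<le> 2 / 2 ^ k"
      using dyadic_scale[of "norm (a - y)" e] e by auto
    have "(e / (e + norm (a - y))) ^ m \<le> (2 / 2 ^ k) ^ m"
      using k e by (intro power_mono) auto
    also have "\<dots> = 2 ^ m / 2 ^ (m * k)"
      by (simp add: power_divide mult.commute flip: power_mult)
    finally have "q y * ennreal ((e / (e + norm (a - y))) ^ m) \<le> ?g k y"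
      using k by (simp add: dist_norm mult.commute[of "q y"] ennreal_leI mult_right_mono)
    also have "\<dots> = sum (\<lambda>k. ?g k y) {k}" by simp
    also have "\<dots> \<le> (\<Sum>k. ?g k y)"
      by (rule sum_le_suminf) auto
    finally show ?thesis .
  qed
  then have "(\<integral>\<^sup>+y. q y * ennreal ((e / (e + norm (a - y))) ^ m) \<partial>lborel) \<le> (\<integral>\<^sup>+y. (\<Sum>k. ?g k y) \<partial>lborel)"
    by (intro nn_integral_mono) auto
  also have "\<dots> = (\<Sum>k. \<integral>\<^sup>+y. ?g k y \<partial>lborel)"
    by (rule nn_integral_suminf, (rule borel_measurable_times_ennreal)+) (use q in simp_all)
  also have "\<dots> = (\<Sum>k. ?c k * (\<integral>\<^sup>+y. q y * indicator (ball a (2 ^ k * e)) y \<partial>lborel))"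
    by (simp only: *)
  also have "\<dots> \<le> (\<Sum>k. ?c k * ennreal (B k))"
    by (intro suminf_le mult_left_mono B) auto
  also have "\<dots> = (\<Sum>k. ennreal (2 ^ m * (B k / 2 ^ (m * k))))"
    using B0 by (intro arg_cong[where f=suminf] ext) (simp flip: ennreal_mult)
  also have "\<dots> = ennreal (\<Sum>k. 2 ^ m * (B k / 2 ^ (m * k)))"
    using B0 summable_mult[OF S, of "2 ^ m"] by (intro suminf_ennreal2) auto
  also have "\<dots> = ennreal (2 ^ m * (\<Sum>k. B k / 2 ^ (m * k)))"
    using S by (subst suminf_mult) auto
  finally show ?thesis .
qed

text \<open>For exponent 4 the dyadic volumes 8^k meet the weight 16^(-k), which leaves a geometric
  series of ratio 1/2; larger exponents follow by comparison.\<close>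

lemma integrable_decay:
  "m \<ge> 4 \<Longrightarrow> integrable lborel (\<lambda>y :: R3. 1 / (1 + norm y) ^ m)"
proof -
  assume m: "m \<ge> 4"
  have i4: "integrable lborel (\<lambda>y :: R3. 1 / (1 + norm y) ^ 4)"
  proof (rule integrableI_nonneg)
    have "(\<integral>\<^sup>+y. 1 * ennreal ((1 / (1 + norm (0 - y :: R3))) ^ 4) \<partial>lborel)
      \<le> ennreal (2 ^ 4 * (\<Sum>k. (4 / 3 * pi * (2 ^ k) ^ 3) / 2 ^ (4 * k)))"
    proof (rule nn_integral_dyadic)
      have "(\<lambda>k. (4 / 3 * pi * (2 ^ k) ^ 3) / 2 ^ (4 * k)) = (\<lambda>k. 4 / 3 * pi * (1 / 2) ^ k :: real)"
        by (rule ext) (simp add: field_simps flip: power_mult power_add)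
      then show "summable (\<lambda>k. (4 / 3 * pi * (2 ^ k) ^ 3) / 2 ^ (4 * k) :: real)"
        by (simp add: summable_geometric summable_mult)
    qed (simp_all add: emeasure_ball_R3)
    then show "(\<integral>\<^sup>+y. ennreal (1 / (1 + norm (y :: R3)) ^ 4) \<partial>lborel) < \<infinity>"
      by (simp add: power_divide order_le_less_trans)
  qed auto
  show ?thesis
  proof (rule Bochner_Integration.integrable_bound[OF i4])
    have "1 / (1 + norm y) ^ m \<le> 1 / (1 + norm y) ^ 4" for y :: R3
      using m by (intro divide_left_mono power_increasing mult_pos_pos zero_less_power)
        (auto simp: add_pos_nonneg)
    then show "AE y :: R3 in lborel. norm (1 / (1 + norm y) ^ m) \<le> norm (1 / (1 + norm y) ^ 4)"
      by simp
  qed auto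
qed

text \<open>Dyadic shells shrink to the origin: where 2^(-j-1) \<le> |z| < 2^(-j) the function is at
  most 2^((j+1)(3-b)), the enclosing ball has volume proportional to 8^(-j), and the series has
  ratio 2^(-b).\<close>

lemma integrable_singularity:
  assumes b: "b > 0" "b \<le> 3"
  shows "integrable lborel (\<lambda>z :: R3. norm z powr (b - 3) * indicator (ball 0 1) z)"
proof (rule integrableI_nonneg)
  define c where "c k = (2 ^ Suc k) powr (3 - b)" for k :: nat
  let ?g = "\<lambda>k z::R3. ennreal (c k) * indicator (ball 0 (1 / 2 ^ k)) z"
  have *: "ennreal (norm z powr (b - 3) * indicator (ball 0 1) z) \<le> (\<Sum>k. ?g k z)" for z :: R3
  proof (cases "z \<noteq> 0 \<and> norm z < 1")
    case True
    define t where "t = 1 / norm z"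
    have "t > 1" using True by (simp add: t_def)
    define k where "k = (LEAST k. t \<le> 2 ^ k)"
    have "\<exists>k. t < 2 ^ k" using real_arch_pow[of 2 t] by auto
    then have "\<exists>k. t \<le> 2 ^ k" using less_imp_le by blast
    then have 1: "t \<le> 2 ^ k" unfolding k_def by (rule LeastI_ex)
    with \<open>t > 1\<close> obtain j where j: "k = Suc j" by (cases k) auto
    then have 2: "\<not> t \<le> 2 ^ j"
      using not_less_Least[of j "\<lambda>k. t \<le> 2 ^ k"] by (simp add: k_def)
    have "norm z powr (b - 3) = t powr (3 - b)"
      using True by (simp add: t_def powr_divide powr_minus flip: powr_minus_divide)
    also have "\<dots> \<le> c j" using 1 j b \<open>t > 1\<close> unfolding c_def by (intro powr_mono2) auto
    finally have "ennreal (norm z powr (b - 3) * indicator (ball 0 1) z) \<le> ?g j z"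
      using True 2 by (simp add: t_def field_simps ennreal_leI)
    also have "\<dots> = sum (\<lambda>k. ?g k z) {j}" by (simp only: sum.insert finite.emptyI empty_iff not_False_eq_True sum.empty add_0_right)
    also have "\<dots> \<le> (\<Sum>k. ?g k z)"
      by (rule sum_le_suminf) auto
    finally show ?thesis .
  qed auto
  have "(\<integral>\<^sup>+z. ennreal (norm (z::R3) powr (b - 3) * indicator (ball 0 1) z) \<partial>lborel)
      \<le> (\<integral>\<^sup>+z. (\<Sum>k. ?g k z) \<partial>lborel)"
    by (rule nn_integral_mono) (rule *)
  also have "\<dots> = (\<Sum>k. \<integral>\<^sup>+z. ?g k z \<partial>lborel)"
    by (intro nn_integral_suminf) measurable
  also have "\<dots> = (\<Sum>k. ennreal (2 powr (3 - b) * (4 / 3 * pi) * (2 powr (- b)) ^ k))"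
  proof (intro arg_cong[where f=suminf] ext)
    fix k :: nat
    have "(\<integral>\<^sup>+z. ?g k z \<partial>lborel) = ennreal (c k * (4 / 3 * pi * (1 / 2 ^ k) ^ 3))"
      by (simp add: nn_integral_cmult emeasure_ball_R3 c_def flip: ennreal_mult)
    also have "c k * (4 / 3 * pi * (1 / 2 ^ k) ^ 3)
        = (4 / 3 * pi) * ((2 powr (Suc k * (3 - b))) * 2 powr (- real (3 * k)))"
    proof -
      have "c k = 2 powr (Suc k * (3 - b))"
        unfolding c_def using powr_realpow[of 2 "Suc k"] by (metis powr_powr zero_less_numeral)
      moreover have "(1 / 2 ^ k) ^ 3 = 2 powr (- real (3 * k))"
        using powr_realpow[of 2 "3 * k"]
        by (simp only: powr_minus) (simp add: power_divide mult.commute inverse_eq_divide flip: power_mult)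
      ultimately show ?thesis by simp
    qed
    also have "(2 powr (Suc k * (3 - b))) * 2 powr (- real (3 * k)) = 2 powr (3 - b + real k * (- b))"
      by (simp add: algebra_simps flip: powr_add)
    also have "\<dots> = 2 powr (3 - b) * (2 powr (- b)) ^ k"
      using powr_realpow[of "2 powr (- b)" k] by (simp only: powr_add powr_powr) (simp add: mult.commute)
    finally show "(\<integral>\<^sup>+z. ?g k z \<partial>lborel) = ennreal (2 powr (3 - b) * (4 / 3 * pi) * (2 powr (- b)) ^ k)"
      by (simp add: mult_ac)
  qed
  also have "\<dots> = ennreal (\<Sum>k. 2 powr (3 - b) * (4 / 3 * pi) * (2 powr (- b)) ^ k)"
    using b by (intro suminf_ennreal2 summable_mult summable_geometric)
      (auto intro!: mult_nonneg_nonneg simp: powr_less_one)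
  also have "\<dots> < \<infinity>" by simp
  finally show "(\<integral>\<^sup>+z. ennreal (norm (z::R3) powr (b - 3) * indicator (ball 0 1) z) \<partial>lborel) < \<infinity>" .
qed auto

subsection \<open>The regularised Newton kernel\<close>

definition wt :: "real \<Rightarrow> R3 \<Rightarrow> real" where
  "wt e z = 1 / sqrt (norm z ^ 2 + e ^ 2)"

text \<open>Gradient and, below, Hessian of \<open>wt e\<close> are written as polynomials in the
  coordinates and \<open>wt e\<close>; further derivatives then need only the product rule and the
  derivative of \<open>wt\<close>.\<close>

definition grad :: "real \<Rightarrow> 3 \<Rightarrow> R3 \<Rightarrow> real" where
  "grad e i z = - (z $ i) * wt e z ^ 3"

definition hess :: "real \<Rightarrow> 3 \<Rightarrow> 3 \<Rightarrow> R3 \<Rightarrow> real" where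
  "hess e i j z = - kdelta i j * wt e z ^ 3 + 3 * (z $ i) * (z $ j) * wt e z ^ 5"

lemma kdelta_bounds: "0 \<le> kdelta i j" "kdelta i j \<le> 1" "\<bar>kdelta i j\<bar> \<le> 1"
  by (simp_all add: kdelta_def)

lemma wt_nonneg [simp]: "0 \<le> wt e z"
  by (simp add: wt_def)

lemma wt_minus [simp]: "wt e (- z) = wt e z"
  by (simp add: wt_def)

lemma hess_minus [simp]: "hess e i j (- z) = hess e i j z"
  by (simp add: hess_def)

lemma wt_0: "wt 0 z = 1 / norm z"
  by (simp add: wt_def)

lemma Kker_eq_hess: "Kker i j z = hess 0 i j z / (4 * pi)"
  by (cases "z = 0") (simp_all add: Kker_def hess_def wt_0 field_simps power2_eq_square power3_eq_cube numeral_eq_Suc)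

text \<open>All bounds uniform in e rest on this: each factor z is absorbed by one factor
  \<open>wt\<close>, and the number of factors \<open>wt\<close> left over is the order of
  decay.\<close>

lemma norm_wt_le: "norm z * wt e z \<le> 1"
proof -
  have "norm z \<le> sqrt (norm z ^ 2 + e ^ 2)"
    by (rule real_le_rsqrt) simp
  then show ?thesis
    by (cases "z = 0 \<and> e = 0") (auto simp: wt_def divide_le_eq_1 add_pos_nonneg add_nonneg_pos)
qed

lemma e_wt_le: "\<bar>e\<bar> * wt e z \<le> 1"
proof -
  have "\<bar>e\<bar> \<le> sqrt (norm z ^ 2 + e ^ 2)"
    by (rule real_le_rsqrt) simp
  then show ?thesis
    by (cases "z = 0 \<and> e = 0") (auto simp: wt_def divide_le_eq_1 add_pos_nonneg add_nonneg_pos)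
qed

lemma wt_le: "z \<noteq> 0 \<Longrightarrow> wt e z \<le> 1 / norm z"
  using norm_wt_le[of z e] by (simp add: field_simps)

lemma wt_le': "e > 0 \<Longrightarrow> wt e z \<le> 1 / e"
  using e_wt_le[of e z] by (simp add: field_simps)

lemma wt_power_le: "z \<noteq> 0 \<Longrightarrow> wt e z ^ m \<le> 1 / norm z ^ m"
  using power_mono[OF wt_le, of z e m] by (simp add: power_divide)

lemma wt_square: "z \<noteq> 0 \<or> e \<noteq> 0 \<Longrightarrow> (norm z ^ 2 + e ^ 2) * wt e z ^ 2 = 1"
  by (auto simp: wt_def power_divide add_nonneg_eq_0_iff)

lemma abs_comp_wt_le: "\<bar>z $ i\<bar> * wt e z \<le> 1"
  by (rule order_trans[OF mult_right_mono[OF component_le_norm_cart] norm_wt_le]) simp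

lemma abs_inner_wt_le: "\<bar>z \<bullet> h\<bar> * wt e z \<le> norm h"
proof -
  have "\<bar>z \<bullet> h\<bar> * wt e z \<le> norm z * norm h * wt e z"
    by (intro mult_right_mono Cauchy_Schwarz_ineq2) simp
  also have "\<dots> = norm h * (norm z * wt e z)" by simp
  also have "\<dots> \<le> norm h * 1" by (intro mult_left_mono norm_wt_le) simp
  finally show ?thesis by simp
qed

lemma abs_grad_le: "\<bar>grad e i z\<bar> \<le> wt e z ^ 2"
proof -
  have "\<bar>grad e i z\<bar> = (\<bar>z $ i\<bar> * wt e z) * wt e z ^ 2"
    by (simp add: grad_def abs_mult power3_eq_cube power2_eq_square)
  also have "\<dots> \<le> 1 * wt e z ^ 2"
    by (intro mult_right_mono abs_comp_wt_le) simp
  finally show ?thesis by simp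
qed

lemma abs_hess_le: "\<bar>hess e i j z\<bar> \<le> 4 * wt e z ^ 3"
proof -
  have 1: "\<bar>- kdelta i j * wt e z ^ 3\<bar> \<le> 1 * wt e z ^ 3"
    unfolding abs_mult abs_minus by (intro mult_mono) (auto simp: kdelta_bounds)
  have "\<bar>3 * (z $ i) * (z $ j) * wt e z ^ 5\<bar> = 3 * ((\<bar>z $ i\<bar> * wt e z) * (\<bar>z $ j\<bar> * wt e z)) * wt e z ^ 3"
    by (simp add: abs_mult numeral_eq_Suc)
  also have "\<dots> \<le> 3 * (1 * 1) * wt e z ^ 3"
    by (intro mult_right_mono mult_left_mono mult_mono abs_comp_wt_le) auto
  finally show ?thesis using 1 unfolding hess_def by linarith
qed

section \<open>Derivatives of the kernel with bounds uniform in e\<close>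

lemma has_derivative_wt:
  assumes "z \<noteq> 0 \<or> e \<noteq> 0"
  shows "(wt e has_derivative (\<lambda>h. - (z \<bullet> h) * wt e z ^ 3)) (at z)"
proof -
  let ?s = "z \<bullet> z + e ^ 2"
  have pos: "?s > 0" using assms by (auto simp: add_pos_nonneg add_nonneg_pos)
  \<comment> \<open>The chain rule passes through s = |z|^2 + e^2, with |z|^2 as an inner product;
    differentiating the norm itself would exclude z = 0, which has to be covered when e is
    nonzero.\<close>
  have 1: "((\<lambda>s. inverse (sqrt s)) has_field_derivative - (1 / 2) * (inverse (sqrt ?s)) ^ 3) (at ?s)"
    using pos by (auto intro!: derivative_eq_intros simp: power3_eq_cube divide_simps)
  have 2: "((\<lambda>z. z \<bullet> z + e ^ 2) has_derivative (\<lambda>h. 2 * (z \<bullet> h))) (at z)"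
    by (auto intro!: derivative_eq_intros simp: inner_commute)
  have "((\<lambda>z. inverse (sqrt (z \<bullet> z + e ^ 2))) has_derivative
      (\<lambda>h. 2 * (z \<bullet> h) * (- (1 / 2) * (inverse (sqrt ?s)) ^ 3))) (at z)"
    by (rule has_derivative_eq_rhs[OF DERIV_compose_FDERIV[OF 1 2]]) simp
  moreover have "wt e = (\<lambda>z. inverse (sqrt (z \<bullet> z + e ^ 2)))"
    by (rule ext) (simp add: wt_def dot_square_norm inverse_eq_divide)
  ultimately show ?thesis
    by (simp add: mult.assoc)
qed

lemma has_derivative_vec_nth [derivative_intros]:
  "(f has_derivative f') F \<Longrightarrow> ((\<lambda>x. f x $ i) has_derivative (\<lambda>h. f' h $ i)) F"
  by (rule bounded_linear.has_derivative[OF bounded_linear_vec_nth])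

lemma has_derivative_grad:
  assumes "z \<noteq> 0 \<or> e \<noteq> 0"
  shows "(grad e i has_derivative (\<lambda>h. - (h $ i) * wt e z ^ 3 + 3 * (z $ i) * (z \<bullet> h) * wt e z ^ 5)) (at z)"
  unfolding grad_def[abs_def]
  by (auto intro!: derivative_eq_intros has_derivative_wt[OF assms] simp: algebra_simps numeral_eq_Suc)

lemma has_derivative_hess:
  assumes "z \<noteq> 0 \<or> e \<noteq> 0"
  shows "(hess e i j has_derivative (\<lambda>h. 3 * kdelta i j * (z \<bullet> h) * wt e z ^ 5
    + 3 * ((h $ i) * (z $ j) + (z $ i) * (h $ j)) * wt e z ^ 5
    - 15 * (z $ i) * (z $ j) * (z \<bullet> h) * wt e z ^ 7)) (at z)"
  unfolding hess_def[abs_def]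
  by (auto intro!: derivative_eq_intros has_derivative_wt[OF assms] simp: algebra_simps numeral_eq_Suc)

text \<open>Pairing each factor z with one \<open>wt\<close> leaves weight of order 4; the constant
  is 3 + 3 + 3 + 15, one summand for each term after expanding the middle one.\<close>

lemma hess_derivative_bound:
  "\<bar>3 * kdelta i j * (z \<bullet> h) * wt e z ^ 5
    + 3 * ((h $ i) * (z $ j) + (z $ i) * (h $ j)) * wt e z ^ 5
    - 15 * (z $ i) * (z $ j) * (z \<bullet> h) * wt e z ^ 7\<bar> \<le> 24 * norm h * wt e z ^ 4"
proof -
  let ?w = "wt e z"
  let ?p = "\<bar>z \<bullet> h\<bar> * ?w" and ?a = "\<bar>z $ i\<bar> * ?w" and ?b = "\<bar>z $ j\<bar> * ?w"
  have le: "?p \<le> norm h" "?a \<le> 1" "?b \<le> 1" "\<bar>h $ i\<bar> \<le> norm h" "\<bar>h $ j\<bar> \<le> norm h"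
    by (auto intro: abs_inner_wt_le abs_comp_wt_le component_le_norm_cart)
  have nn: "0 \<le> ?p" "0 \<le> ?a" "0 \<le> ?b" by auto
  have "\<bar>3 * kdelta i j * (z \<bullet> h) * ?w ^ 5\<bar> = 3 * (kdelta i j * ?p) * ?w ^ 4"
    by (simp add: abs_mult numeral_eq_Suc kdelta_def)
  also have "\<dots> \<le> 3 * (1 * norm h) * ?w ^ 4"
    using le by (intro mult_right_mono mult_left_mono mult_mono) (auto simp: kdelta_bounds)
  finally have 1: "\<bar>3 * kdelta i j * (z \<bullet> h) * ?w ^ 5\<bar> \<le> 3 * (norm h * ?w ^ 4)" by simp
  have "\<bar>3 * ((h $ i) * (z $ j)) * ?w ^ 5\<bar> = 3 * (\<bar>h $ i\<bar> * ?b) * ?w ^ 4"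
    by (simp add: abs_mult numeral_eq_Suc)
  also have "\<dots> \<le> 3 * (norm h * 1) * ?w ^ 4"
    using le by (intro mult_right_mono mult_left_mono mult_mono) auto
  finally have 2: "\<bar>3 * ((h $ i) * (z $ j)) * ?w ^ 5\<bar> \<le> 3 * (norm h * ?w ^ 4)" by simp
  have "\<bar>3 * ((z $ i) * (h $ j)) * ?w ^ 5\<bar> = 3 * (?a * \<bar>h $ j\<bar>) * ?w ^ 4"
    by (simp add: abs_mult numeral_eq_Suc)
  also have "\<dots> \<le> 3 * (1 * norm h) * ?w ^ 4"
    using le by (intro mult_right_mono mult_left_mono mult_mono) auto
  finally have 3: "\<bar>3 * ((z $ i) * (h $ j)) * ?w ^ 5\<bar> \<le> 3 * (norm h * ?w ^ 4)" by simp
  have "\<bar>15 * (z $ i) * (z $ j) * (z \<bullet> h) * ?w ^ 7\<bar> = 15 * (?a * ?b * ?p) * ?w ^ 4"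
    by (simp add: abs_mult numeral_eq_Suc)
  also have "\<dots> \<le> 15 * (1 * 1 * norm h) * ?w ^ 4"
    using le by (intro mult_right_mono mult_left_mono mult_mono) auto
  finally have 4: "\<bar>15 * (z $ i) * (z $ j) * (z \<bullet> h) * ?w ^ 7\<bar> \<le> 15 * (norm h * ?w ^ 4)" by simp
  have "3 * ((h $ i) * (z $ j) + (z $ i) * (h $ j)) * ?w ^ 5
      = 3 * ((h $ i) * (z $ j)) * ?w ^ 5 + 3 * ((z $ i) * (h $ j)) * ?w ^ 5"
    by (simp add: algebra_simps)
  then show ?thesis using 1 2 3 4 by linarith
qed

lemma hess_derivative:
  assumes "z \<noteq> 0"
  shows "(hess e i j has_derivative (\<lambda>h. 3 * kdelta i j * (z \<bullet> h) * wt e z ^ 5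
      + 3 * ((h $ i) * (z $ j) + (z $ i) * (h $ j)) * wt e z ^ 5
      - 15 * (z $ i) * (z $ j) * (z \<bullet> h) * wt e z ^ 7)) (at z)"
    and "\<bar>3 * kdelta i j * (z \<bullet> h) * wt e z ^ 5
      + 3 * ((h $ i) * (z $ j) + (z $ i) * (h $ j)) * wt e z ^ 5
      - 15 * (z $ i) * (z $ j) * (z \<bullet> h) * wt e z ^ 7\<bar> \<le> 24 * norm h / norm z ^ 4"
proof -
  show "\<bar>3 * kdelta i j * (z \<bullet> h) * wt e z ^ 5
      + 3 * ((h $ i) * (z $ j) + (z $ i) * (h $ j)) * wt e z ^ 5
      - 15 * (z $ i) * (z $ j) * (z \<bullet> h) * wt e z ^ 7\<bar> \<le> 24 * norm h / norm z ^ 4"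
    using mult_left_mono[OF wt_power_le[OF assms, of e 4], of "24 * norm h"] hess_derivative_bound[of i j z h e] by simp
qed (use assms in \<open>intro has_derivative_hess, simp\<close>)

lemma wt_derivative_bound: "\<bar>- (z \<bullet> h) * wt e z ^ 3\<bar> \<le> norm h * wt e z ^ 2"
proof -
  have "\<bar>- (z \<bullet> h) * wt e z ^ 3\<bar> = \<bar>z \<bullet> h\<bar> * wt e z * wt e z ^ 2"
    by (simp add: abs_mult numeral_eq_Suc)
  also have "\<dots> \<le> norm h * wt e z ^ 2"
    by (intro mult_right_mono abs_inner_wt_le) simp
  finally show ?thesis .
qed

lemma grad_derivative_bound:
  "\<bar>- (h $ i) * wt e z ^ 3 + 3 * (z $ i) * (z \<bullet> h) * wt e z ^ 5\<bar> \<le> 4 * norm h * wt e z ^ 3"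
proof -
  have "\<bar>- (h $ i) * wt e z ^ 3\<bar> = \<bar>h $ i\<bar> * wt e z ^ 3" by (simp add: abs_mult)
  also have "\<dots> \<le> norm h * wt e z ^ 3"
    by (intro mult_right_mono component_le_norm_cart) simp
  finally have 1: "\<bar>- (h $ i) * wt e z ^ 3\<bar> \<le> norm h * wt e z ^ 3" .
  have "\<bar>3 * (z $ i) * (z \<bullet> h) * wt e z ^ 5\<bar>
      = 3 * ((\<bar>z $ i\<bar> * wt e z) * (\<bar>z \<bullet> h\<bar> * wt e z)) * wt e z ^ 3"
    by (simp add: abs_mult numeral_eq_Suc)
  also have "\<dots> \<le> 3 * (1 * norm h) * wt e z ^ 3"
    by (intro mult_right_mono mult_left_mono mult_mono abs_comp_wt_le abs_inner_wt_le) auto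
  finally show ?thesis using 1 by linarith
qed

text \<open>Mean value inequality on the ball about -y of radius |y|/2, which contains both a - y
  and b - y. There |z| \<ge> |y|/2 \<ge> (1 + |y|)/4, the last step because |y| \<ge> 1; this is the
  origin of 4^m. The difference thus decays at the rate of the derivative, one order better than the
  homogeneous kernels themselves.\<close>

lemma difference_decay_far:
  fixes F :: "R3 \<Rightarrow> real" and a b :: R3
  assumes F: "\<And>z. z \<noteq> 0 \<Longrightarrow> (F has_derivative D z) (at z)"
    and D: "\<And>z h. z \<noteq> 0 \<Longrightarrow> \<bar>D z h\<bar> \<le> C * norm h / norm z ^ m" and "C \<ge> 0"
    and y: "norm y \<ge> 2 * (norm a + norm b) + 1"
  shows "\<bar>F (a - y) - F (b - y)\<bar> \<le> C * norm (a - b) * 4 ^ m / (1 + norm y) ^ m"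
proof -
  let ?S = "cball (- y) (norm y / 2)" and ?B = "C * 4 ^ m / (1 + norm y) ^ m"
  have "0 \<le> norm a" "0 \<le> norm b" by auto
  with y have y1: "norm y \<ge> 1" and ab: "norm a \<le> norm y / 2" "norm b \<le> norm y / 2"
    by argo+
  have z: "norm z \<ge> (1 + norm y) / 4" if "z \<in> ?S" for z
  proof -
    have "norm y \<le> norm z + norm (- y - z)" 
      using norm_triangle_ineq[of z "- y - z"] by simp
    with that y1 show ?thesis by (simp add: dist_norm)
  qed
  have z0: "z \<noteq> 0" if "z \<in> ?S" for z
    using z[OF that] y1 by auto
  have "norm (F (a - y) - F (b - y)) \<le> ?B * norm (a - y - (b - y))"
  proof (rule differentiable_bound[of ?S])
    fix z assume zS: "z \<in> ?S"
    then show "(F has_derivative D z) (at z within ?S)"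
      using F[OF z0] has_derivative_at_withinI by blast
    have "\<bar>D z h\<bar> \<le> ?B * norm h" for h
    proof -
      have "\<bar>D z h\<bar> \<le> C * norm h / norm z ^ m" by (rule D[OF z0[OF zS]])
      also have "\<dots> \<le> C * norm h / ((1 + norm y) / 4) ^ m"
        using z[OF zS] y1 \<open>C \<ge> 0\<close> by (intro divide_left_mono power_mono) (auto intro!: mult_pos_pos zero_less_power)
      also have "\<dots> = ?B * norm h" by (simp add: power_divide field_simps)
      finally show ?thesis .
    qed
    then show "onorm (D z) \<le> ?B"
      by (intro onorm_bound) (use \<open>C \<ge> 0\<close> in auto)
  next
    show "a - y \<in> ?S" "b - y \<in> ?S"
      using ab by (auto simp: dist_norm norm_minus_commute)
  qed auto
  then show ?thesis by (simp add: mult_ac)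
qed

text \<open>Far out the mean value estimate applies; on the remaining bounded set of y the sup bound
  of \<open>F\<close> suffices, at the price of the factor (1 + Y)^m, with Y the radius of that
  set.\<close>

lemma difference_decay:
  fixes F :: "R3 \<Rightarrow> real" and a b :: R3
  assumes F: "\<And>z. z \<noteq> 0 \<Longrightarrow> (F has_derivative D z) (at z)"
    and D: "\<And>z h. z \<noteq> 0 \<Longrightarrow> \<bar>D z h\<bar> \<le> C * norm h / norm z ^ m" and "C \<ge> 0"
    and B: "\<And>z. \<bar>F z\<bar> \<le> B"
  shows "\<exists>C'. \<forall>y. \<bar>F (a - y) - F (b - y)\<bar> \<le> C' / (1 + norm y) ^ m"
proof (intro exI allI)
  let ?Y = "2 * (norm a + norm b) + 1"
  let ?C = "C * norm (a - b) * 4 ^ m + 2 * B * (1 + ?Y) ^ m"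
  fix y
  have B0: "B \<ge> 0" using B[of 0] by linarith
  show "\<bar>F (a - y) - F (b - y)\<bar> \<le> ?C / (1 + norm y) ^ m"
  proof (cases "norm y \<ge> ?Y")
    case True
    have "\<bar>F (a - y) - F (b - y)\<bar> \<le> C * norm (a - b) * 4 ^ m / (1 + norm y) ^ m"
      by (rule difference_decay_far[OF F D \<open>C \<ge> 0\<close> True])
    also have "\<dots> \<le> ?C / (1 + norm y) ^ m"
      using B0 by (intro divide_right_mono) auto
    finally show ?thesis .
  next
    case False
    have "\<bar>F (a - y) - F (b - y)\<bar> \<le> 2 * B"
      using B[of "a - y"] B[of "b - y"] by linarith
    also have "\<dots> \<le> 2 * B * ((1 + ?Y) ^ m / (1 + norm y) ^ m)"
    proof -
      have "1 \<le> (1 + ?Y) ^ m / (1 + norm y) ^ m"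
        using False by (simp add: field_simps add_pos_nonneg) (intro power_mono; simp)
      from mult_left_mono[OF this, of "2 * B"] show ?thesis using B0 by simp
    qed
    also have "\<dots> \<le> ?C / (1 + norm y) ^ m"
      unfolding times_divide_eq_right using \<open>C \<ge> 0\<close> by (intro divide_right_mono) auto
    finally show ?thesis .
  qed
qed

subsection \<open>Smooth functions\<close>

definition smooth :: "(R3 \<Rightarrow> real) \<Rightarrow> bool" where
  "smooth f \<longleftrightarrow> (\<forall>k. C_k k f)"

lemma partial_deriv_eq: "(f has_derivative D) (at x) \<Longrightarrow> partial_deriv i f x = D (axis i 1)"
  unfolding partial_deriv_def by (simp add: frechet_derivative_at[symmetric])

text \<open>For a class of differentiable functions closed under partial derivatives, induction on k
  proves \<open>C_k\<close> for all members at once, so the order of differentiability never has to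
  be tracked.\<close>

lemma smooth_coinduct:
  assumes "X f"
    and step: "\<And>f. X f \<Longrightarrow> (\<forall>x. f differentiable (at x)) \<and> (\<forall>i. X (partial_deriv i f))"
  shows "smooth f"
proof -
  have "X f \<Longrightarrow> C_k k f" for k f
  proof (induction k arbitrary: f)
    case 0
    then show ?case
      using step by (auto intro!: continuous_at_imp_continuous_on differentiable_imp_continuous_within)
  next
    case (Suc k)
    then show ?case using step by auto
  qed
  with \<open>X f\<close> show ?thesis by (simp add: smooth_def)
qed

lemma smooth_differentiable: "smooth f \<Longrightarrow> f differentiable (at x)"
  unfolding smooth_def by (drule spec[of _ 1]) simp

lemma smooth_partial_deriv: "smooth f \<Longrightarrow> smooth (partial_deriv i f)"
  unfolding smooth_def using C_k.simps(2) by blast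

lemma smooth_continuous_on: "smooth f \<Longrightarrow> continuous_on S f"
  unfolding smooth_def by (drule spec[of _ 0]) (auto intro: continuous_on_subset)

lemma smooth_measurable: "smooth f \<Longrightarrow> f \<in> borel_measurable borel"
  by (intro borel_measurable_continuous_onI smooth_continuous_on)

lemma smooth_const: "smooth (\<lambda>y. c)"
proof (rule smooth_coinduct[where X="\<lambda>f. \<exists>c. f = (\<lambda>y. c)"])
  fix f :: "R3 \<Rightarrow> real" assume "\<exists>c. f = (\<lambda>y. c)"
  then obtain c where f: "f = (\<lambda>y. c)" by blast
  have "partial_deriv i f = (\<lambda>y. 0)" for i
    unfolding f by (rule ext, rule partial_deriv_eq[where D="\<lambda>_. 0"]) simp
  then show "(\<forall>x. f differentiable at x) \<and> (\<forall>i. \<exists>c. partial_deriv i f = (\<lambda>y. c))"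
    by (auto simp: f)
qed auto

lemma smooth_diff_component: "smooth (\<lambda>y. c - y $ i)"
proof (rule smooth_coinduct[where X="\<lambda>f. smooth f \<or> f = (\<lambda>y. c - y $ i)"])
  fix f :: "R3 \<Rightarrow> real" assume f: "smooth f \<or> f = (\<lambda>y. c - y $ i)"
  show "(\<forall>x. f differentiable at x) \<and> (\<forall>j. smooth (partial_deriv j f) \<or> partial_deriv j f = (\<lambda>y. c - y $ i))"
    using f
  proof
    assume f: "f = (\<lambda>y. c - y $ i)"
    have D: "(f has_derivative (\<lambda>h. - (h $ i))) (at x)" for x
      unfolding f by (auto intro!: derivative_eq_intros)
    have "partial_deriv j f = (\<lambda>y. - (axis j 1 $ i))" for j
      by (rule ext, rule partial_deriv_eq[OF D])
    then show ?thesis using D by (auto simp: differentiable_def smooth_const)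
  qed (auto intro: smooth_differentiable smooth_partial_deriv)
qed auto

lemma partial_deriv_add:
  assumes "f differentiable (at x)" "g differentiable (at x)"
  shows "partial_deriv i (\<lambda>x. f x + g x) x = partial_deriv i f x + partial_deriv i g x"
  using partial_deriv_eq[OF has_derivative_add] assms
  unfolding frechet_derivative_works partial_deriv_def by blast

lemma partial_deriv_mult:
  fixes f g :: "R3 \<Rightarrow> real"
  assumes "f differentiable (at x)" "g differentiable (at x)"
  shows "partial_deriv i (\<lambda>x. f x * g x) x = f x * partial_deriv i g x + partial_deriv i f x * g x"
  using partial_deriv_eq[OF has_derivative_mult] assms
  unfolding frechet_derivative_works partial_deriv_def by blast

lemma has_derivative_wt_shift:
  assumes "e > 0"
  shows "((\<lambda>y. wt e (a - y)) has_derivative (\<lambda>h. ((a - y) \<bullet> h) * wt e (a - y) ^ 3)) (at y)"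
proof -
  have "((\<lambda>y. a - y) has_derivative uminus) (at y)"
    by (auto intro!: derivative_eq_intros)
  from has_derivative_compose[OF this has_derivative_wt[of "a - y" e]] assms
  show ?thesis by simp
qed

text \<open>The cube is spelled out as an iterated product so that the result visibly lies in the
  algebra generated by affine coordinates and shifted kernels.\<close>

lemma partial_deriv_wt_shift:
  assumes "e > 0"
  shows "partial_deriv i (\<lambda>y. wt e (a - y)) = (\<lambda>y. (a $ i - y $ i) * (wt e (a - y) * (wt e (a - y) * wt e (a - y))))"
  by (rule ext, subst partial_deriv_eq[OF has_derivative_wt_shift[OF assms]])
    (simp add: inner_axis power3_eq_cube)

text \<open>This algebra contains the smooth functions and the regularised kernels and is closed under
  partial derivatives, hence consists of smooth functions.\<close>

inductive kernel_algebra :: "(R3 \<Rightarrow> real) \<Rightarrow> bool" where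
  base: "smooth f \<Longrightarrow> kernel_algebra f"
| kernel: "e > 0 \<Longrightarrow> kernel_algebra (\<lambda>y. wt e (a - y))"
| add: "kernel_algebra f \<Longrightarrow> kernel_algebra g \<Longrightarrow> kernel_algebra (\<lambda>y. f y + g y)"
| mult: "kernel_algebra f \<Longrightarrow> kernel_algebra g \<Longrightarrow> kernel_algebra (\<lambda>y. f y * g y)"

lemma kernel_algebra_smooth:
  assumes "kernel_algebra f"
  shows "smooth f"
proof (rule smooth_coinduct[where X=kernel_algebra, OF assms])
  fix f assume "kernel_algebra f"
  then show "(\<forall>x. f differentiable at x) \<and> (\<forall>i. kernel_algebra (partial_deriv i f))"
  proof induction
    case (base f)
    then show ?case by (auto intro: smooth_differentiable smooth_partial_deriv kernel_algebra.base)
  next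
    case (kernel e a)
    have "kernel_algebra (\<lambda>y. (a $ i - y $ i) * (wt e (a - y) * (wt e (a - y) * wt e (a - y))))" for i
      by (intro kernel_algebra.mult kernel_algebra.kernel kernel_algebra.base smooth_diff_component kernel)
    then show ?case
      using has_derivative_wt_shift[OF kernel] by (auto simp: differentiable_def partial_deriv_wt_shift[OF kernel])
  next
    case (add f g)
    then have "partial_deriv i (\<lambda>y. f y + g y) = (\<lambda>y. partial_deriv i f y + partial_deriv i g y)" for i
      by (intro ext partial_deriv_add) auto
    with add show ?case by (auto intro!: kernel_algebra.add)
  next
    case (mult f g)
    then have "partial_deriv i (\<lambda>y. f y * g y) = (\<lambda>y. f y * partial_deriv i g y + partial_deriv i f y * g y)" for i
      by (intro ext partial_deriv_mult) auto
    with mult show ?case by (auto intro!: kernel_algebra.add kernel_algebra.mult)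
  qed
qed

lemma smooth_mult: "smooth f \<Longrightarrow> smooth g \<Longrightarrow> smooth (\<lambda>y. f y * g y)"
  by (rule kernel_algebra_smooth, rule kernel_algebra.mult) (erule kernel_algebra.base)+

text \<open>Each derivative of a dilated function produces a factor c; carrying a prefactor d makes
  the family closed under differentiation, as the coinductive proof of smoothness demands.\<close>

lemma partial_deriv_scale:
  assumes "smooth f"
  shows "partial_deriv i (\<lambda>y. d * f (c *\<^sub>R y)) = (\<lambda>y. (d * c) * partial_deriv i f (c *\<^sub>R y))"
    and "(\<lambda>y. d * f (c *\<^sub>R y)) differentiable (at x)"
proof -
  let ?D = "\<lambda>x. frechet_derivative f (at x)"
  have f: "(f has_derivative ?D x) (at x)" for x
    using smooth_differentiable[OF assms] by (simp add: frechet_derivative_works)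
  have "((\<lambda>y. c *\<^sub>R y) has_derivative (\<lambda>h. c *\<^sub>R h)) (at x)" for x :: R3
    by (auto intro!: derivative_eq_intros)
  from has_derivative_mult_right[OF has_derivative_compose[OF this f]]
  have D: "((\<lambda>y. d * f (c *\<^sub>R y)) has_derivative (\<lambda>h. d * ?D (c *\<^sub>R x) (c *\<^sub>R h))) (at x)" for x by blast
  have "?D x (c *\<^sub>R h) = c * ?D x h" for x h
    using f[of x] by (simp add: linear_cmul has_derivative_linear)
  then show "partial_deriv i (\<lambda>y. d * f (c *\<^sub>R y)) = (\<lambda>y. (d * c) * partial_deriv i f (c *\<^sub>R y))"
    by (intro ext) (simp add: partial_deriv_eq[OF D] partial_deriv_def)
  show "(\<lambda>y. d * f (c *\<^sub>R y)) differentiable (at x)"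
    using D by (auto simp: differentiable_def)
qed

lemma smooth_scale:
  assumes "smooth f"
  shows "smooth (\<lambda>y. d * f (c *\<^sub>R y))"
proof (rule smooth_coinduct[where X="\<lambda>g. \<exists>d f. smooth f \<and> g = (\<lambda>y. d * f (c *\<^sub>R y))"])
  fix g assume "\<exists>d f. smooth f \<and> g = (\<lambda>y. d * f (c *\<^sub>R y))"
  then obtain d f where f: "smooth f" and g: "g = (\<lambda>y. d * f (c *\<^sub>R y))" by blast
  show "(\<forall>x. g differentiable at x) \<and> (\<forall>i. \<exists>d f. smooth f \<and> partial_deriv i g = (\<lambda>y. d * f (c *\<^sub>R y)))"
    unfolding g using partial_deriv_scale[OF f] smooth_partial_deriv[OF f] by blast
qed (use assms in blast)

lemma partial_deriv_locally_const:
  assumes "open U" "x \<in> U" and c: "\<And>y. y \<in> U \<Longrightarrow> f y = c"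
  shows "partial_deriv i f x = 0"
proof -
  have "(f has_derivative (\<lambda>_. 0)) (at x)"
    by (rule has_derivative_transform_within_open[OF has_derivative_const[of c] assms(1,2)])
      (simp add: c)
  then show ?thesis by (simp add: partial_deriv_eq)
qed

section \<open>Supports, test functions and the Leibniz rule\<close>

lemma zero_outside_supp: "x \<notin> supp f \<Longrightarrow> f x = 0"
  using closure_subset[of "{x. f x \<noteq> 0}"] by (auto simp: supp_def)

lemma compact_supp_subset:
  assumes "supp g \<subseteq> supp f" "compact (supp f)"
  shows "compact (supp g)"
proof -
  have "closed (supp g)" by (simp add: supp_def)
  then have "compact (supp f \<inter> supp g)" using assms by (simp add: compact_Int_closed)
  then show ?thesis using assms by (simp add: inf.absorb2)
qed

lemma partial_deriv_outside_supp: "x \<notin> supp f \<Longrightarrow> partial_deriv i f x = 0"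
  by (rule partial_deriv_locally_const[where U="- supp f" and c=0])
    (auto simp: zero_outside_supp, auto simp: supp_def)

lemma supp_partial_deriv: "supp (partial_deriv i f) \<subseteq> supp f"
proof -
  have "{x. partial_deriv i f x \<noteq> 0} \<subseteq> supp f"
    using partial_deriv_outside_supp by blast
  then show ?thesis
    unfolding supp_def[of "partial_deriv i f"] by (rule closure_minimal) (simp add: supp_def)
qed

lemma test_function_iff: "test_function f \<longleftrightarrow> smooth f \<and> compact (supp f)"
  by (simp add: test_function_def smooth_def)

lemma test_function_mult:
  assumes "test_function g" "smooth u"
  shows "test_function (\<lambda>y. g y * u y)"
proof -
  have "supp (\<lambda>y. g y * u y) \<subseteq> supp g"
    unfolding supp_def by (intro closure_mono) auto
  then have "compact (supp (\<lambda>y. g y * u y))"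
    using assms compact_supp_subset by (auto simp: test_function_iff)
  then show ?thesis using assms by (auto simp: test_function_iff intro: smooth_mult)
qed

lemma test_function_partial_deriv:
  assumes "test_function g"
  shows "test_function (partial_deriv i g)"
  using assms compact_supp_subset[OF supp_partial_deriv]
  by (auto simp: test_function_iff smooth_partial_deriv)

lemma test_function_bounded:
  assumes "test_function g"
  shows "\<exists>M. \<forall>x. \<bar>g x\<bar> \<le> M"
proof -
  have "compact (g ` supp g)"
    using assms by (intro compact_continuous_image smooth_continuous_on) (auto simp: test_function_iff)
  then obtain M where "\<forall>x\<in>g ` supp g. norm x \<le> M"
    using compact_imp_bounded bounded_iff by blast
  then have "\<bar>g x\<bar> \<le> max M 0" for x
    by (cases "x \<in> supp g") (auto simp: zero_outside_supp le_max_iff_disj)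
  then show ?thesis by blast
qed

lemma uniform_bound_finite:
  fixes F :: "'i::finite \<Rightarrow> 'a \<Rightarrow> real"
  assumes "\<And>i. \<exists>C. \<forall>y. \<bar>F i y\<bar> \<le> C * g y" and g: "\<And>y. g y \<ge> 0"
  shows "\<exists>C. \<forall>i y. \<bar>F i y\<bar> \<le> C * g y"
proof -
  obtain C where C: "\<And>i y. \<bar>F i y\<bar> \<le> C i * g y" using assms(1) by metis
  have "\<bar>F i y\<bar> \<le> (\<Sum>i\<in>UNIV. \<bar>C i\<bar>) * g y" for i y
  proof -
    have "C i \<le> \<bar>C i\<bar>" by simp
    also have "\<dots> \<le> (\<Sum>i\<in>UNIV. \<bar>C i\<bar>)" by (rule member_le_sum) auto
    finally have "C i * g y \<le> (\<Sum>i\<in>UNIV. \<bar>C i\<bar>) * g y" by (rule mult_right_mono[OF _ g])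
    with C[of i y] show ?thesis by linarith
  qed
  then show ?thesis by blast
qed

lemma partial_deriv2_mult:
  assumes "smooth g" "smooth u"
  shows "partial_deriv i (partial_deriv j (\<lambda>y. g y * u y)) y =
    g y * partial_deriv i (partial_deriv j u) y + partial_deriv i g y * partial_deriv j u y
    + (partial_deriv j g y * partial_deriv i u y + partial_deriv i (partial_deriv j g) y * u y)"
proof -
  note d = smooth_differentiable
  note s = smooth_partial_deriv smooth_mult assms
  have "partial_deriv j (\<lambda>y. g y * u y) = (\<lambda>y. g y * partial_deriv j u y + partial_deriv j g y * u y)"
    by (intro ext partial_deriv_mult d assms)
  then show ?thesis
    by (simp add: partial_deriv_add[OF d d] partial_deriv_mult[OF d d] s)
qed

subsection \<open>Testing the equation against regularised kernels\<close>

text \<open>A derivative falling on the dilated cutoff costs 1/n but lives only where |y| is at most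
  of order n, hence gains a factor 1/(1 + |y|). Every term of the product rule is therefore bounded
  by a multiple of (1 + |y|)^(-4) uniformly in n, and the weighted integrability of p and f allows
  dominated convergence.\<close>

lemma poisson_cutoff:
  fixes p u :: "R3 \<Rightarrow> real" and f :: "3 \<Rightarrow> 3 \<Rightarrow> R3 \<Rightarrow> real"
  assumes \<Theta>: "test_function \<Theta>" "\<forall>x\<in>ball 0 2. \<Theta> x = 1" "supp \<Theta> \<subseteq> ball 0 4"
    and sol: "solves_poisson f p" and u: "smooth u"
    and C: "\<And>y. \<bar>u y\<bar> \<le> C / (1 + norm y) ^ 2"
      "\<And>i y. \<bar>partial_deriv i u y\<bar> \<le> C / (1 + norm y) ^ 3"
      "\<And>i j y. \<bar>partial_deriv i (partial_deriv j u) y\<bar> \<le> C / (1 + norm y) ^ 4"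
    and p: "integrable lebesgue (\<lambda>y. p y / (1 + norm y) ^ 4)"
      and pm: "p \<in> borel_measurable lebesgue"
    and f: "\<And>i j. integrable lebesgue (\<lambda>y. f i j y / (1 + norm y) ^ 4)"
      and fm: "\<And>i j. f i j \<in> borel_measurable lebesgue"
  shows "(LINT y|lebesgue. p y * laplacian u y) =
    - (LINT y|lebesgue. (\<Sum>i\<in>UNIV. \<Sum>j\<in>UNIV. f i j y * partial_deriv i (partial_deriv j u) y))"
proof -
  note sp = smooth_partial_deriv
  have \<Theta>s: "smooth \<Theta>" using \<Theta> by (simp add: test_function_iff)
  define c where "c n = 1 / real (Suc n)" for n
  define \<eta> where "\<eta> n y = 1 * \<Theta> (c n *\<^sub>R y)" for n y
  have \<eta>1: "partial_deriv i (\<eta> n) = (\<lambda>y. c n * partial_deriv i \<Theta> (c n *\<^sub>R y))" for i n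
    unfolding \<eta>_def by (subst partial_deriv_scale[OF \<Theta>s]) simp
  have \<eta>2: "partial_deriv i (partial_deriv j (\<eta> n)) = (\<lambda>y. c n * c n * partial_deriv i (partial_deriv j \<Theta>) (c n *\<^sub>R y))" for i j n
    unfolding \<eta>1 by (subst partial_deriv_scale[OF sp[OF \<Theta>s]]) simp
  have \<eta>s: "smooth (\<eta> n)" for n
    unfolding \<eta>_def by (rule smooth_scale[OF \<Theta>s])
  have cpos: "c n > 0" for n by (simp add: c_def)
  have \<eta>t: "test_function (\<eta> n)" for n
  proof -
    have "{y. \<eta> n y \<noteq> 0} \<subseteq> cball 0 (4 / c n)"
    proof
      fix y assume "y \<in> {y. \<eta> n y \<noteq> 0}"
      then have "c n *\<^sub>R y \<in> supp \<Theta>"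
        using zero_outside_supp[of "c n *\<^sub>R y" \<Theta>] by (auto simp: \<eta>_def)
      then have "c n *\<^sub>R y \<in> ball 0 4" using \<Theta>(3) by blast
      then show "y \<in> cball 0 (4 / c n)"
        using cpos[of n] by (simp add: field_simps)
    qed
    then have "supp (\<eta> n) \<subseteq> cball 0 (4 / c n)"
      unfolding supp_def by (rule closure_minimal) simp
    then have "compact (supp (\<eta> n))"
      by (metis supp_def closed_closure compact_cball compact_Int_closed inf.absorb2)
    then show ?thesis by (simp add: test_function_iff \<eta>s)
  qed
  obtain M0 where M0: "\<And>y. \<bar>\<Theta> y\<bar> \<le> M0"
    using test_function_bounded[OF \<Theta>(1)] by blast
  obtain M1 where M1: "\<And>i y. \<bar>partial_deriv i \<Theta> y\<bar> \<le> M1"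
    using uniform_bound_finite[of "\<lambda>i. partial_deriv i \<Theta>" "\<lambda>_. 1"]
      test_function_bounded[OF test_function_partial_deriv[OF \<Theta>(1)]] by auto
  obtain M2 where M2: "\<And>i j y. \<bar>partial_deriv i (partial_deriv j \<Theta>) y\<bar> \<le> M2"
    using uniform_bound_finite[of "\<lambda>(i, j). partial_deriv i (partial_deriv j \<Theta>)" "\<lambda>_. 1"]
      test_function_bounded[OF test_function_partial_deriv[OF test_function_partial_deriv[OF \<Theta>(1)]]]
    by auto
  define M where "M = max M0 (max M1 M2)"
  have M: "\<bar>\<Theta> y\<bar> \<le> M" "\<bar>partial_deriv i \<Theta> y\<bar> \<le> M" "\<bar>partial_deriv i (partial_deriv j \<Theta>) y\<bar> \<le> M" for i j y
    using M0[of y] M1[of i y] M2[of i j y] by (auto simp: M_def)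
  have "M \<ge> 0" using M(1)[of 0] by linarith
  have C0: "C \<ge> 0" using C(1)[of 0] by simp
  \<comment> \<open>The number 5 is 4 + 1: since c_n \<le> 1, c_n (1 + |y|) > 5 forces |c_n y| > 4,
    outside the support of \<Theta>.\<close>
  have outside: "partial_deriv i \<Theta> (c n *\<^sub>R y) = 0" "partial_deriv i (partial_deriv j \<Theta>) (c n *\<^sub>R y) = 0"
    if "c n * (1 + norm y) > 5" for i j n y
  proof -
    have "c n \<le> 1" by (simp add: c_def)
    with that have "c n * norm y > 4" by (simp add: algebra_simps)
    then have "c n *\<^sub>R y \<notin> supp \<Theta>"
      using \<Theta>(3) cpos[of n] by auto
    moreover from this have "c n *\<^sub>R y \<notin> supp (partial_deriv j \<Theta>)"
      using supp_partial_deriv by blast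
    ultimately show "partial_deriv i \<Theta> (c n *\<^sub>R y) = 0" "partial_deriv i (partial_deriv j \<Theta>) (c n *\<^sub>R y) = 0"
      by (auto intro: partial_deriv_outside_supp)
  qed
  have b1: "\<bar>partial_deriv i (\<eta> n) y\<bar> \<le> 5 * M / (1 + norm y)" for i n y
  proof (cases "c n * (1 + norm y) > 5")
    case False
    then have "c n \<le> 5 / (1 + norm y)" by (simp add: field_simps add_pos_nonneg)
    then have "c n * \<bar>partial_deriv i \<Theta> (c n *\<^sub>R y)\<bar> \<le> 5 / (1 + norm y) * M"
      using M cpos[of n] by (intro mult_mono) (auto intro: less_imp_le)
    then show ?thesis using cpos[of n] by (simp add: \<eta>1 abs_mult)
  qed (use \<open>M \<ge> 0\<close> in \<open>simp add: \<eta>1 outside\<close>)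
  have b2: "\<bar>partial_deriv i (partial_deriv j (\<eta> n)) y\<bar> \<le> 25 * M / (1 + norm y) ^ 2" for i j n y
  proof (cases "c n * (1 + norm y) > 5")
    case False
    then have "c n \<le> 5 / (1 + norm y)" by (simp add: field_simps add_pos_nonneg)
    then have "c n * c n * \<bar>partial_deriv i (partial_deriv j \<Theta>) (c n *\<^sub>R y)\<bar> \<le> 5 / (1 + norm y) * (5 / (1 + norm y)) * M"
      using M cpos[of n] by (intro mult_mono) (auto intro: less_imp_le)
    then show ?thesis using cpos[of n] by (simp add: \<eta>2 abs_mult power2_eq_square)
  qed (use \<open>M \<ge> 0\<close> in \<open>simp add: \<eta>2 outside\<close>)
  define w where "w n y = \<eta> n y * u y" for n y
  have wt: "test_function (w n)" for n
    unfolding w_def by (rule test_function_mult[OF \<eta>t u])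
  have ws: "smooth (w n)" for n using wt by (simp add: test_function_iff)
  have w2: "partial_deriv i (partial_deriv j (w n)) y =
      \<eta> n y * partial_deriv i (partial_deriv j u) y + partial_deriv i (\<eta> n) y * partial_deriv j u y
      + (partial_deriv j (\<eta> n) y * partial_deriv i u y + partial_deriv i (partial_deriv j (\<eta> n)) y * u y)" for i j n y
    unfolding w_def by (rule partial_deriv2_mult[OF \<eta>s u])
  \<comment> \<open>36 = 1 + 5 + 5 + 25, from no derivative, one derivative (twice) and two
    derivatives on the cutoff.\<close>
  have wb: "\<bar>partial_deriv i (partial_deriv j (w n)) y\<bar> \<le> 36 * M * C / (1 + norm y) ^ 4" for i j n y
  proof -
    let ?t = "1 + norm y"
    have t: "?t > 0" by (simp add: add_pos_nonneg)
    have "\<bar>\<eta> n y * partial_deriv i (partial_deriv j u) y\<bar> \<le> M * (C / ?t ^ 4)"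
      unfolding abs_mult using \<open>M \<ge> 0\<close> by (intro mult_mono C) (auto simp: \<eta>_def M)
    moreover have "\<bar>partial_deriv i (\<eta> n) y * partial_deriv j u y\<bar> \<le> (5 * M / ?t) * (C / ?t ^ 3)"
      unfolding abs_mult using \<open>M \<ge> 0\<close> t by (intro mult_mono C b1) auto
    moreover have "\<bar>partial_deriv j (\<eta> n) y * partial_deriv i u y\<bar> \<le> (5 * M / ?t) * (C / ?t ^ 3)"
      unfolding abs_mult using \<open>M \<ge> 0\<close> t by (intro mult_mono C b1) auto
    moreover have "\<bar>partial_deriv i (partial_deriv j (\<eta> n)) y * u y\<bar> \<le> (25 * M / ?t ^ 2) * (C / ?t ^ 2)"
      unfolding abs_mult using \<open>M \<ge> 0\<close> t by (intro mult_mono C b2) auto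
    ultimately have "\<bar>partial_deriv i (partial_deriv j (w n)) y\<bar> \<le>
      M * (C / ?t ^ 4) + (5 * M / ?t) * (C / ?t ^ 3) + ((5 * M / ?t) * (C / ?t ^ 3) + (25 * M / ?t ^ 2) * (C / ?t ^ 2))"
      unfolding w2 by linarith
    also have "\<dots> = 36 * M * C / ?t ^ 4"
      using t by (simp add: field_simps flip: power_Suc power_add)
    finally show ?thesis .
  qed
  \<comment> \<open>For fixed y the sequence is eventually constant: once c_n y lies in the ball
    where \<Theta> is 1, all derivatives of the cutoff vanish at y.\<close>
  have wlim: "(\<lambda>n. partial_deriv i (partial_deriv j (w n)) y) \<longlonglongrightarrow> partial_deriv i (partial_deriv j u) y" for i j y
  proof (rule tendsto_eventually)
    obtain N :: nat where N: "norm y < real N" using reals_Archimedean2 by blast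
    show "\<forall>\<^sub>F n in sequentially. partial_deriv i (partial_deriv j (w n)) y = partial_deriv i (partial_deriv j u) y"
      using eventually_ge_at_top[of N]
    proof eventually_elim
      case (elim n)
      define z where "z = c n *\<^sub>R y"
      have "norm y < real (Suc n)" using N elim by simp
      then have "norm z < 1" by (simp add: z_def c_def)
      then have z: "z \<in> ball 0 2" by simp
      have one: "partial_deriv k \<Theta> x = 0" if "x \<in> ball 0 2" for k x
        by (rule partial_deriv_locally_const[OF open_ball that, of _ 1]) (use \<Theta>(2) in blast)
      then have "partial_deriv i (partial_deriv j \<Theta>) z = 0"
        by (intro partial_deriv_locally_const[OF open_ball z, of _ 0])
      with one z \<Theta>(2) show ?case
        unfolding w2 unfolding \<eta>2 unfolding \<eta>1 \<eta>_def z_def[symmetric] by simp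
    qed
  qed
  have pd_meas: "partial_deriv i (partial_deriv j g) \<in> borel_measurable lebesgue" if "smooth g" for i j g
    using smooth_measurable[OF sp[OF sp[OF that]]] by (simp add: measurable_completion)
  define B where "B = 36 * M * C"
  have "B \<ge> 0" using C0 \<open>M \<ge> 0\<close> by (simp add: B_def)
  have bound: "\<bar>g y * s\<bar> \<le> K * \<bar>g y / (1 + norm y) ^ 4\<bar>" if "\<bar>s\<bar> \<le> K / (1 + norm y) ^ 4" for g :: "R3 \<Rightarrow> real" and s y K
    using mult_left_mono[OF that, of "\<bar>g y\<bar>"] by (simp add: abs_mult mult_ac abs_of_nonneg)
  have "(\<lambda>n. LINT y|lebesgue. p y * laplacian (w n) y) \<longlonglongrightarrow> (LINT y|lebesgue. p y * laplacian u y)"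
  proof (rule integral_dominated_convergence)
    show "integrable lebesgue (\<lambda>y. (3 * B) * \<bar>p y / (1 + norm y) ^ 4\<bar>)"
      using p by (intro integrable_mult_right integrable_abs)
    show "AE y in lebesgue. norm (p y * laplacian (w n) y) \<le> (3 * B) * \<bar>p y / (1 + norm y) ^ 4\<bar>" for n
    proof (rule AE_I2)
      fix y
      have "\<bar>laplacian (w n) y\<bar> \<le> (\<Sum>i\<in>(UNIV :: 3 set). B / (1 + norm y) ^ 4)"
        unfolding laplacian_def B_def by (rule order_trans[OF sum_abs sum_mono[OF wb]])
      then show "norm (p y * laplacian (w n) y) \<le> (3 * B) * \<bar>p y / (1 + norm y) ^ 4\<bar>"
        unfolding real_norm_def by (intro bound) simp
    qed
    show "AE y in lebesgue. (\<lambda>n. p y * laplacian (w n) y) \<longlonglongrightarrow> p y * laplacian u y"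
      unfolding laplacian_def by (intro AE_I2 tendsto_intros wlim)
  qed (use pm in \<open>auto simp: laplacian_def[abs_def] intro!: borel_measurable_times borel_measurable_sum pd_meas u ws\<close>)
  moreover have "(\<lambda>n. LINT y|lebesgue. (\<Sum>i\<in>UNIV. \<Sum>j\<in>UNIV. f i j y * partial_deriv i (partial_deriv j (w n)) y))
     \<longlonglongrightarrow> (LINT y|lebesgue. (\<Sum>i\<in>UNIV. \<Sum>j\<in>UNIV. f i j y * partial_deriv i (partial_deriv j u) y))"
  proof (rule integral_dominated_convergence)
    show "integrable lebesgue (\<lambda>y. \<Sum>i\<in>UNIV. \<Sum>j\<in>UNIV. B * \<bar>f i j y / (1 + norm y) ^ 4\<bar>)"
      using f by (intro integrable_mult_right integrable_abs Bochner_Integration.integrable_sum)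
    show "AE y in lebesgue. norm (\<Sum>i\<in>UNIV. \<Sum>j\<in>UNIV. f i j y * partial_deriv i (partial_deriv j (w n)) y)
        \<le> (\<Sum>i\<in>UNIV. \<Sum>j\<in>UNIV. B * \<bar>f i j y / (1 + norm y) ^ 4\<bar>)" for n
      unfolding real_norm_def B_def
      by (intro AE_I2 order_trans[OF sum_abs] sum_mono bound wb)
    show "AE y in lebesgue. (\<lambda>n. \<Sum>i\<in>UNIV. \<Sum>j\<in>UNIV. f i j y * partial_deriv i (partial_deriv j (w n)) y)
      \<longlonglongrightarrow> (\<Sum>i\<in>UNIV. \<Sum>j\<in>UNIV. f i j y * partial_deriv i (partial_deriv j u) y)"
      by (intro AE_I2 tendsto_intros wlim)
  qed (use fm in \<open>auto intro!: borel_measurable_times borel_measurable_sum pd_meas u ws\<close>)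
  moreover have "(LINT y|lebesgue. p y * laplacian (w n) y) =
    - (LINT y|lebesgue. (\<Sum>i\<in>UNIV. \<Sum>j\<in>UNIV. f i j y * partial_deriv i (partial_deriv j (w n)) y))" for n
    using sol wt by (simp add: solves_poisson_def)
  ultimately show ?thesis
    using LIMSEQ_unique tendsto_minus by (metis (no_types, lifting) ext)
qed

text \<open>The trace of \<open>kdelta\<close> is 3, the coefficient of the quadratic term. Trading
  w^3 for (|z|^2 + e^2) w^5 therefore cancels everything but the term with e^2.\<close>

lemma sum_hess_diag:
  assumes "e > 0"
  shows "(\<Sum>i\<in>UNIV. hess e i i z) = - 3 * e ^ 2 * wt e z ^ 5"
proof -
  have "(\<Sum>i\<in>UNIV. hess e i i z) = - 3 * wt e z ^ 3 + 3 * norm z ^ 2 * wt e z ^ 5"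
    unfolding hess_def norm_vec_def L2_set_def
    by (simp add: sum.distrib sum_subtractf kdelta_def sum_distrib_left sum_distrib_right sum_nonneg power2_eq_square mult_ac)
  also have "\<dots> = - 3 * wt e z ^ 3 * ((norm z ^ 2 + e ^ 2) * wt e z ^ 2) + 3 * norm z ^ 2 * wt e z ^ 5"
    using assms by (simp add: wt_square)
  also have "\<dots> = - 3 * e ^ 2 * wt e z ^ 5"
    by (simp add: algebra_simps numeral_eq_Suc)
  finally show ?thesis .
qed

lemma axis_nth: "axis i 1 $ j = kdelta i j"
  by (simp add: axis_def kdelta_def)

text \<open>The decay orders 2, 3, 4 come from the mean value estimate applied to \<open>wt\<close>,
  \<open>grad\<close> and \<open>hess\<close>. The constants may depend on e through the sup bounds,
  as e is fixed here. The reflection y to a - y changes the sign of first derivatives and restores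
  it for second ones.\<close>

lemma poisson_kernel:
  fixes p :: "R3 \<Rightarrow> real" and f :: "3 \<Rightarrow> 3 \<Rightarrow> R3 \<Rightarrow> real"
  assumes \<Theta>: "test_function \<Theta>" "\<forall>x\<in>ball 0 2. \<Theta> x = 1" "supp \<Theta> \<subseteq> ball 0 4"
    and sol: "solves_poisson f p" and e: "e > 0"
    and p: "integrable lebesgue (\<lambda>y. p y / (1 + norm y) ^ 4)"
      and pm: "p \<in> borel_measurable lebesgue"
    and f: "\<And>i j. integrable lebesgue (\<lambda>y. f i j y / (1 + norm y) ^ 4)"
      and fm: "\<And>i j. f i j \<in> borel_measurable lebesgue"
  shows "(LINT y|lebesgue. p y * (3 * e ^ 2 * wt e (a - y) ^ 5 - 3 * e ^ 2 * wt e (b - y) ^ 5)) =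
    (LINT y|lebesgue. (\<Sum>i\<in>UNIV. \<Sum>j\<in>UNIV. f i j y * (hess e i j (a - y) - hess e i j (b - y))))"
proof -
  define u where "u y = wt e (a - y) - wt e (b - y)" for y
  have d1: "((\<lambda>y. wt e (c - y)) has_derivative (\<lambda>h. ((c - y) \<bullet> h) * wt e (c - y) ^ 3)) (at y)" for c y
    by (rule has_derivative_wt_shift[OF e])
  have u_smooth: "smooth u"
  proof -
    have "kernel_algebra (\<lambda>y. wt e (a - y) + (- 1) * wt e (b - y))"
      by (rule kernel_algebra.add kernel_algebra.mult kernel_algebra.kernel e kernel_algebra.base smooth_const)+
    then show ?thesis
      using kernel_algebra_smooth by (simp add: u_def[abs_def])
  qed
  have u1: "partial_deriv i u = (\<lambda>y. - (grad e i (a - y) - grad e i (b - y)))" for i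
    unfolding u_def
    by (rule ext, subst partial_deriv_eq[OF has_derivative_diff[OF d1 d1]])
      (simp add: inner_axis grad_def algebra_simps)
  have d2: "((\<lambda>y. grad e j (c - y)) has_derivative
      (\<lambda>h. (h $ j) * wt e (c - y) ^ 3 - 3 * ((c - y) $ j) * ((c - y) \<bullet> h) * wt e (c - y) ^ 5)) (at y)" for c y j
  proof -
    have "((\<lambda>y. c - y) has_derivative uminus) (at y)"
      by (auto intro!: derivative_eq_intros)
    from has_derivative_compose[OF this has_derivative_grad[of "c - y" e j]] e
    show ?thesis by simp
  qed
  have u2: "partial_deriv i (partial_deriv j u) = (\<lambda>y. hess e i j (a - y) - hess e i j (b - y))" for i j
    unfolding u1
    by (rule ext, subst partial_deriv_eq[OF has_derivative_minus[OF has_derivative_diff[OF d2 d2]]])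
      (simp add: inner_axis hess_def axis_nth algebra_simps)
  have wt_le_e: "wt e z ^ m \<le> 1 / e ^ m" for z m
    using power_mono[OF wt_le'[OF e, of z], of m] by (simp add: power_divide)
  have "\<exists>C. \<forall>y. \<bar>wt e (a - y) - wt e (b - y)\<bar> \<le> C / (1 + norm y) ^ 2"
  proof (rule difference_decay)
    show "(wt e has_derivative (\<lambda>h. - (z \<bullet> h) * wt e z ^ 3)) (at z)" if "z \<noteq> 0" for z
      using that by (intro has_derivative_wt) simp
    show "\<bar>- (z \<bullet> h) * wt e z ^ 3\<bar> \<le> 1 * norm h / norm z ^ 2" if "z \<noteq> 0" for z h
      using mult_left_mono[OF wt_power_le[OF that, of e 2], of "norm h"] wt_derivative_bound[of z h e] by simp
    show "\<bar>wt e z\<bar> \<le> 1 / e" for z using wt_le'[OF e] by simp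
  qed simp
  then obtain C0 where C0: "\<And>y. \<bar>u y\<bar> \<le> C0 * (1 / (1 + norm y) ^ 2)"
    by (auto simp: u_def)
  have "\<exists>C. \<forall>y. \<bar>grad e i (a - y) - grad e i (b - y)\<bar> \<le> C / (1 + norm y) ^ 3" for i
  proof (rule difference_decay)
    show "(grad e i has_derivative (\<lambda>h. - (h $ i) * wt e z ^ 3 + 3 * (z $ i) * (z \<bullet> h) * wt e z ^ 5)) (at z)" if "z \<noteq> 0" for z
      using that by (intro has_derivative_grad) simp
    show "\<bar>- (h $ i) * wt e z ^ 3 + 3 * (z $ i) * (z \<bullet> h) * wt e z ^ 5\<bar> \<le> 4 * norm h / norm z ^ 3" if "z \<noteq> 0" for z h
      using mult_left_mono[OF wt_power_le[OF that, of e 3], of "4 * norm h"] grad_derivative_bound[of h i e z] by simp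
    show "\<bar>grad e i z\<bar> \<le> 1 / e ^ 2" for z
      using wt_le_e[of z 2] abs_grad_le[of e i z] by simp
  qed simp
  then obtain C1 where C1: "\<And>i y. \<bar>partial_deriv i u y\<bar> \<le> C1 * (1 / (1 + norm y) ^ 3)"
    using uniform_bound_finite[of "\<lambda>i. partial_deriv i u" "\<lambda>y. 1 / (1 + norm y) ^ 3"]
    by (auto simp: u1 abs_minus_commute)
  have "\<exists>C. \<forall>y. \<bar>hess e i j (a - y) - hess e i j (b - y)\<bar> \<le> C / (1 + norm y) ^ 4" for i j
  proof (rule difference_decay[OF hess_derivative(1) hess_derivative(2) zero_le_numeral])
    show "\<bar>hess e i j z\<bar> \<le> 4 / e ^ 3" for z
      using wt_le_e[of z 3] abs_hess_le[of e i j z] by simp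
  qed
  then obtain C2 where C2: "\<And>i j y. \<bar>partial_deriv i (partial_deriv j u) y\<bar> \<le> C2 * (1 / (1 + norm y) ^ 4)"
    using uniform_bound_finite[of "\<lambda>(i, j). partial_deriv i (partial_deriv j u)" "\<lambda>y. 1 / (1 + norm y) ^ 4"]
    by (auto simp: u2)
  define C where "C = max C0 (max C1 C2)"
  have le: "C0 \<le> C" "C1 \<le> C" "C2 \<le> C" by (auto simp: C_def)
  have up: "K * (1 / (1 + norm y) ^ m) \<le> C / (1 + norm y) ^ m" if "K \<le> C" for K m and y :: R3
    using divide_right_mono[OF that, of "(1 + norm y) ^ m"] by simp
  have "(LINT y|lebesgue. p y * laplacian u y) =
    - (LINT y|lebesgue. (\<Sum>i\<in>UNIV. \<Sum>j\<in>UNIV. f i j y * partial_deriv i (partial_deriv j u) y))"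
    by (rule poisson_cutoff[OF \<Theta> sol u_smooth order_trans[OF C0 up[OF le(1)]]
        order_trans[OF C1 up[OF le(2)]] order_trans[OF C2 up[OF le(3)]] p pm f fm])
  moreover have "p y * (3 * e ^ 2 * wt e (a - y) ^ 5 - 3 * e ^ 2 * wt e (b - y) ^ 5) = - (p y * laplacian u y)" for y
    unfolding laplacian_def u2 sum_subtractf sum_hess_diag[OF e] by (simp add: algebra_simps)
  ultimately show ?thesis by (simp add: u2)
qed

subsection \<open>Radial integrals\<close>

text \<open>Lebesgue measure is determined by boxes, and the preimage of a box is its image under
  the inverse isometry, which preserves volume.\<close>

lemma lborel_distr_orthogonal:
  fixes T :: "R3 \<Rightarrow> R3"
  assumes T: "orthogonal_transformation T"
  shows "distr lborel borel T = lborel"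
proof (rule lborel_eqI[symmetric])
  fix l u :: R3
  assume le: "\<And>b. b \<in> Basis \<Longrightarrow> l \<bullet> b \<le> u \<bullet> b"
  let ?S = "inv T ` box l u"
  have inv: "orthogonal_transformation (inv T)" by (rule orthogonal_transformation_inv[OF T])
  have vim: "T -` box l u = ?S"
    by (rule bij_vimage_eq_inv_image[OF orthogonal_transformation_bij[OF T]])
  have cont: "continuous_on UNIV T"
    using T by (simp add: orthogonal_transformation_def linear_continuous_on linear_conv_bounded_linear)
  have [measurable]: "T \<in> borel_measurable borel"
    by (rule borel_measurable_continuous_onI[OF cont])
  have sets: "?S \<in> sets borel"
    unfolding vim[symmetric] by (rule borel_open[OF open_vimage[OF open_box cont]])
  have lm: "?S \<in> lmeasurable" and meas: "measure lebesgue ?S = measure lebesgue (box l u)"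
    using measurable_orthogonal_image[OF inv] measure_orthogonal_image[OF inv] by auto
  have "emeasure (distr lborel borel T) (box l u) = emeasure lborel ?S"
    by (simp add: emeasure_distr vim)
  also have "\<dots> = emeasure lebesgue ?S" using sets by simp
  also have "\<dots> = emeasure lebesgue (box l u)"
    using lm meas by (simp add: emeasure_eq_measure2)
  also have "\<dots> = (\<Prod>b\<in>Basis. (u - l) \<bullet> b)"
    using le by (simp add: emeasure_lborel_box)
  finally show "emeasure (distr lborel borel T) (box l u) = (\<Prod>b\<in>Basis. (u - l) \<bullet> b)" .
qed simp

lemma integral_orthogonal:
  fixes T :: "R3 \<Rightarrow> R3" and g :: "R3 \<Rightarrow> real"
  assumes T: "orthogonal_transformation T" and g: "g \<in> borel_measurable borel"
  shows "(\<integral>z. g (T z) \<partial>lborel) = (\<integral>z. g z \<partial>lborel)"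
proof -
  have "T \<in> borel_measurable borel"
    using T by (intro borel_measurable_continuous_onI)
      (simp add: orthogonal_transformation_def linear_continuous_on linear_conv_bounded_linear)
  then have "(\<integral>z. g (T z) \<partial>lborel) = (\<integral>z. g z \<partial>distr lborel borel T)"
    using g by (subst integral_distr) auto
  then show ?thesis by (simp add: lborel_distr_orthogonal[OF T])
qed

text \<open>Reflection in the hyperplane orthogonal to \<open>a\<close>; for \<open>a = 0\<close>
  division by zero turns it into the identity, which is orthogonal as well.\<close>

definition mirror :: "R3 \<Rightarrow> R3 \<Rightarrow> R3" where
  "mirror a x = x - (2 * (x \<bullet> a) / (a \<bullet> a)) *\<^sub>R a"

lemma orthogonal_mirror: "orthogonal_transformation (mirror a)"
  unfolding orthogonal_transformation_def
proof
  show "linear (mirror a)"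
    by (rule linearI) (simp_all add: mirror_def inner_simps algebra_simps add_divide_distrib)
  show "\<forall>v w. mirror a v \<bullet> mirror a w = v \<bullet> w"
    by (cases "a = 0") (auto simp: mirror_def inner_simps inner_commute)
qed

text \<open>Off the diagonal, reflecting coordinate i flips the sign of the integrand. On the
  diagonal, the reflection along e_i - e_k swaps two coordinates, so the three integrals agree; as
  their integrands add up to |z|^2 m(|z|), each is a third of the radial integral.\<close>

lemma integral_radial_quadratic:
  fixes m :: "real \<Rightarrow> real"
  assumes m [measurable]: "m \<in> borel_measurable borel"
    and int: "integrable lborel (\<lambda>z :: R3. norm z ^ 2 * m (norm z))"
  shows "integrable lborel (\<lambda>z :: R3. z $ i * z $ j * m (norm z))"
    and "(\<integral>z. z $ i * z $ j * m (norm (z :: R3)) \<partial>lborel)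
      = kdelta i j / 3 * (\<integral>z. norm (z :: R3) ^ 2 * m (norm z) \<partial>lborel)"
proof -
  have [measurable]: "(\<lambda>z :: R3. z $ k) \<in> borel_measurable borel" for k
    by (intro borel_measurable_continuous_onI continuous_intros)
  let ?g = "\<lambda>i j z :: R3. z $ i * z $ j * m (norm z)"
  show I: "integrable lborel (?g i j)" for i j
  proof (rule Bochner_Integration.integrable_bound[OF int])
    have "norm (?g i j z) \<le> norm (norm z ^ 2 * m (norm z))" for z
    proof -
      have "\<bar>z $ i\<bar> * \<bar>z $ j\<bar> \<le> norm z * norm z"
        by (intro mult_mono component_le_norm_cart) auto
      from mult_right_mono[OF this, of "\<bar>m (norm z)\<bar>"] show ?thesis
        by (simp add: abs_mult power2_eq_square)
    qed
    then show "AE z in lborel. norm (?g i j z) \<le> norm (norm z ^ 2 * m (norm z))" by simp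
  qed measurable
  have eq: "(\<integral>z. ?g i j z \<partial>lborel) = (\<integral>z. ?g i j (mirror a z) \<partial>lborel)" for i j a
    by (subst integral_orthogonal[OF orthogonal_mirror]) measurable
  have [simp]: "norm (mirror a z) = norm z" for a z
    by (rule orthogonal_transformation_norm[OF orthogonal_mirror])
  show "(\<integral>z. ?g i j z \<partial>lborel) = kdelta i j / 3 * (\<integral>z. norm (z :: R3) ^ 2 * m (norm z) \<partial>lborel)"
  proof (cases "i = j")
    case False
    have "mirror (axis i 1) z $ i = - z $ i" "mirror (axis i 1) z $ j = z $ j" for z
      using False by (simp_all add: mirror_def inner_axis axis_nth kdelta_def)
    then have "(\<integral>z. ?g i j z \<partial>lborel) = (\<integral>z. - ?g i j z \<partial>lborel)"
      by (subst eq[of i j "axis i 1"]) simp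
    with False show ?thesis by (simp add: kdelta_def)
  next
    case True
    have same: "(\<integral>z. ?g k k z \<partial>lborel) = (\<integral>z. ?g i i z \<partial>lborel)" for k
    proof (cases "k = i")
      case False
      then have "mirror (axis i 1 - axis k 1) z $ k = z $ i" for z
        by (simp add: mirror_def inner_simps inner_axis inner_axis' axis_nth kdelta_def field_simps)
      then show ?thesis
        by (subst eq[of k k "axis i 1 - axis k 1"]) simp
    qed simp
    have "(\<integral>z. norm (z :: R3) ^ 2 * m (norm z) \<partial>lborel) = (\<integral>z. (\<Sum>k\<in>UNIV. ?g k k z) \<partial>lborel)"
      unfolding norm_vec_def L2_set_def
      by (simp add: sum_nonneg sum_distrib_right power2_eq_square flip: norm_vec_def L2_set_def)
    also have "\<dots> = (\<Sum>k\<in>UNIV. \<integral>z. ?g k k z \<partial>lborel)"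
      by (intro Bochner_Integration.integral_sum I)
    also have "\<dots> = (\<Sum>k\<in>(UNIV :: 3 set). \<integral>z. ?g i i z \<partial>lborel)"
      by (intro sum.cong same refl)
    finally show ?thesis using True by (simp add: kdelta_def)
  qed
qed

lemma wt_measurable [measurable]: "wt e \<in> borel_measurable borel"
  unfolding wt_def[abs_def] by measurable

lemma hess_measurable [measurable]: "hess e i j \<in> borel_measurable borel"
proof -
  have [measurable]: "(\<lambda>z :: R3. z $ k) \<in> borel_measurable borel" for k
    by (intro borel_measurable_continuous_onI continuous_intros)
  show ?thesis unfolding hess_def[abs_def] by measurable
qed

text \<open>By symmetry z_i z_j may be replaced by \<delta>_ij |z|^2 / 3, which turns the integrand
  into \<delta>_ij (|z|^2 w^5 - w^3) = - \<delta>_ij e^2 w^5. At e = 0 this is the cancellation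
  behind the principal value; for e > 0 it is the mass that produces the term - f / 3.\<close>

lemma integral_hess_radial:
  assumes A [measurable]: "A \<in> sets borel" and e: "e \<noteq> 0 \<or> 0 \<notin> A"
    and int: "integrable lborel (\<lambda>z. indicator A (norm z) * wt e z ^ 3)"
  shows "(\<integral>z. indicator A (norm z) * hess e i j z \<partial>lborel)
      = - kdelta i j * (\<integral>z. indicator A (norm z) * (e ^ 2 * wt e z ^ 5) \<partial>lborel)"
proof -
  define m where "m r = indicator A r * (1 / sqrt (r ^ 2 + e ^ 2)) ^ 5" for r
  have m [measurable]: "m \<in> borel_measurable borel"
    unfolding m_def by measurable
  have mz: "m (norm z) = indicator A (norm z) * wt e z ^ 5" for z :: R3
    by (simp add: m_def wt_def)
  have split: "norm z ^ 2 * m (norm z) = indicator A (norm z) * wt e z ^ 3 - indicator A (norm z) * (e ^ 2 * wt e z ^ 5)" for z :: R3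
  proof (cases "norm z \<in> A")
    case True
    then have "wt e z ^ 3 = ((norm z ^ 2 + e ^ 2) * wt e z ^ 2) * wt e z ^ 3"
      using e by (subst wt_square) auto
    also have "\<dots> = norm z ^ 2 * wt e z ^ 5 + e ^ 2 * wt e z ^ 5"
      by (simp add: algebra_simps numeral_eq_Suc)
    finally show ?thesis using True by (simp add: mz)
  qed (simp add: mz)
  have int5: "integrable lborel (\<lambda>z. indicator A (norm z) * (e ^ 2 * wt e z ^ 5))"
  proof (rule Bochner_Integration.integrable_bound[OF int])
    have "norm (indicator A (norm z) * (e ^ 2 * wt e z ^ 5)) \<le> norm (indicator A (norm z) * wt e z ^ 3)" for z :: R3
    proof -
      have "(\<bar>e\<bar> * wt e z) ^ 2 * wt e z ^ 3 \<le> 1 * wt e z ^ 3"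
        using e_wt_le[of e z] by (intro mult_right_mono power_le_one) auto
      then have "e ^ 2 * wt e z ^ 5 \<le> wt e z ^ 3"
        by (simp add: power_mult_distrib numeral_eq_Suc mult_ac)
      then show ?thesis by (auto simp: indicator_def)
    qed
    then show "AE z in lborel. norm (indicator A (norm z) * (e ^ 2 * wt e z ^ 5)) \<le> norm (indicator A (norm z) * wt e z ^ 3)"
      by simp
  qed measurable
  have intm: "integrable lborel (\<lambda>z :: R3. norm z ^ 2 * m (norm z))"
    unfolding split using int int5 by (rule Bochner_Integration.integrable_diff)
  have "(\<integral>z. indicator A (norm z) * hess e i j z \<partial>lborel)
      = (\<integral>z. - kdelta i j * (indicator A (norm z) * wt e z ^ 3) + 3 * (z $ i * z $ j * m (norm z)) \<partial>lborel)"
    by (intro Bochner_Integration.integral_cong refl) (simp add: hess_def mz algebra_simps)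
  also have "\<dots> = - kdelta i j * (\<integral>z. indicator A (norm z) * wt e z ^ 3 \<partial>lborel)
      + 3 * (\<integral>z. z $ i * z $ j * m (norm z) \<partial>lborel)"
    using int integral_radial_quadratic(1)[OF m intm] by simp
  also have "\<dots> = - kdelta i j * (\<integral>z. indicator A (norm z) * wt e z ^ 3 \<partial>lborel)
      + kdelta i j * (\<integral>z. norm (z :: R3) ^ 2 * m (norm z) \<partial>lborel)"
    by (simp add: integral_radial_quadratic(2)[OF m intm])
  also have "(\<integral>z. norm (z :: R3) ^ 2 * m (norm z) \<partial>lborel)
      = (\<integral>z. indicator A (norm z) * wt e z ^ 3 \<partial>lborel) - (\<integral>z. indicator A (norm z) * (e ^ 2 * wt e z ^ 5) \<partial>lborel)"
    unfolding split using int int5 by (rule Bochner_Integration.integral_diff)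
  finally show ?thesis by (simp add: algebra_simps)
qed

section \<open>Mass of the approximate identity\<close>

lemma power_sqrt_DERIV:
  fixes r e :: real
  assumes "e > 0"
  shows "((\<lambda>r. - (1 / sqrt (r ^ 2 + e ^ 2) ^ 5)) has_field_derivative 5 * r / sqrt (r ^ 2 + e ^ 2) ^ 7) (at r)"
    and "((\<lambda>r. r ^ 5 / (e ^ 2 * sqrt (r ^ 2 + e ^ 2) ^ 5)) has_field_derivative 5 * r ^ 4 / sqrt (r ^ 2 + e ^ 2) ^ 7) (at r)"
proof -
  define s where "s = sqrt (r ^ 2 + e ^ 2)"
  have pos: "r ^ 2 + e ^ 2 > 0" using assms by (simp add: add_nonneg_pos)
  then have s: "s > 0" "s ^ 2 = r ^ 2 + e ^ 2" by (simp_all add: s_def)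
  have D: "((\<lambda>r. sqrt (r ^ 2 + e ^ 2)) has_field_derivative r / s) (at r)"
    using pos by (auto intro!: derivative_eq_intros simp: s_def) (simp add: divide_inverse mult.commute)
  have D5: "((\<lambda>r. sqrt (r ^ 2 + e ^ 2) ^ 5) has_field_derivative 5 * s ^ 4 * (r / s)) (at r)"
    using DERIV_power[OF D, of 5] by (simp add: s_def mult_ac)
  have nz: "sqrt (r ^ 2 + e ^ 2) ^ 5 \<noteq> 0" "e ^ 2 * sqrt (r ^ 2 + e ^ 2) ^ 5 \<noteq> 0"
    using s(1) assms by (simp_all flip: s_def)
  have "((\<lambda>r. - (1 / sqrt (r ^ 2 + e ^ 2) ^ 5)) has_field_derivative
      - ((0 * s ^ 5 - 1 * (5 * s ^ 4 * (r / s))) / (s ^ 5 * s ^ 5))) (at r)"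
    using DERIV_minus[OF DERIV_divide[OF DERIV_const D5 nz(1)]] by (simp only: s_def)
  also have "- ((0 * s ^ 5 - 1 * (5 * s ^ 4 * (r / s))) / (s ^ 5 * s ^ 5)) = 5 * r / s ^ 7"
    using s(1) by (simp add: divide_simps) (simp add: algebra_simps numeral_eq_Suc)
  finally show "((\<lambda>r. - (1 / sqrt (r ^ 2 + e ^ 2) ^ 5)) has_field_derivative 5 * r / sqrt (r ^ 2 + e ^ 2) ^ 7) (at r)"
    by (simp add: s_def)
  have "((\<lambda>r. r ^ 5 / (e ^ 2 * sqrt (r ^ 2 + e ^ 2) ^ 5)) has_field_derivative
      (5 * r ^ 4 * (e ^ 2 * s ^ 5) - r ^ 5 * (e ^ 2 * (5 * s ^ 4 * (r / s)))) / ((e ^ 2 * s ^ 5) * (e ^ 2 * s ^ 5))) (at r)"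
    using DERIV_divide[OF DERIV_pow[of 5] DERIV_cmult[OF D5, of "e ^ 2"] nz(2)] by (simp add: s_def)
  also have "(5 * r ^ 4 * (e ^ 2 * s ^ 5) - r ^ 5 * (e ^ 2 * (5 * s ^ 4 * (r / s)))) / ((e ^ 2 * s ^ 5) * (e ^ 2 * s ^ 5))
      = 5 * r ^ 4 * (s ^ 2 - r ^ 2) / (e ^ 2 * s ^ 7)"
    using s(1) assms by (simp add: divide_simps) (simp add: algebra_simps numeral_eq_Suc)
  also have "\<dots> = 5 * r ^ 4 / s ^ 7"
    using assms by (simp add: s(2))
  finally show "((\<lambda>r. r ^ 5 / (e ^ 2 * sqrt (r ^ 2 + e ^ 2) ^ 5)) has_field_derivative 5 * r ^ 4 / sqrt (r ^ 2 + e ^ 2) ^ 7) (at r)"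
    by (simp add: s_def)
qed

lemma tendsto_ratio_sqrt:
  fixes e :: real
  assumes "e > 0"
  shows "((\<lambda>r. r / sqrt (r ^ 2 + e ^ 2)) \<longlongrightarrow> 1) at_top"
proof -
  have sq: "filterlim (\<lambda>r::real. r ^ 2) at_top at_top"
    by (intro filterlim_pow_at_top filterlim_ident) simp
  have "((\<lambda>r. e ^ 2 / r ^ 2) \<longlongrightarrow> 0) at_top"
    by (rule tendsto_divide_0[OF tendsto_const filterlim_at_top_imp_at_infinity[OF sq]])
  then have "((\<lambda>r. 1 / sqrt (1 + e ^ 2 / r ^ 2)) \<longlongrightarrow> 1 / sqrt (1 + 0)) at_top"
    by (intro tendsto_intros) auto
  moreover have "\<forall>\<^sub>F r in at_top. 1 / sqrt (1 + e ^ 2 / r ^ 2) = r / sqrt (r ^ 2 + e ^ 2)"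
    using eventually_gt_at_top[of 0]
  proof eventually_elim
    case (elim r)
    have "sqrt (r ^ 2 + e ^ 2) = sqrt (r ^ 2 * (1 + e ^ 2 / r ^ 2))"
      using elim by (simp add: field_simps)
    also have "\<dots> = r * sqrt (1 + e ^ 2 / r ^ 2)"
      using elim by (simp only: real_sqrt_mult) simp
    finally show ?case using elim by simp
  qed
  ultimately show ?thesis using Lim_transform_eventually by fastforce
qed

text \<open>Layer-cake integration takes the place of polar coordinates. With s = sqrt (r^2 + e^2),
  w^5 is the integral of 5 r / s^7 over r \<ge> |z|; after exchanging the integrals the ball volume
  4 pi r^3 / 3 appears, and 5 r^4 / s^7 has the antiderivative r^5 / (e^2 s^5), which grows from 0
  to 1 / e^2.\<close>

lemma nn_integral_wt5:
  assumes e: "e > 0"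
  shows "(\<integral>\<^sup>+z. ennreal (wt e z ^ 5) \<partial>lborel) = ennreal (4 * pi / 3 / e ^ 2)"
proof -
  let ?s = "\<lambda>r. sqrt (r ^ 2 + e ^ 2)"
  have lim5: "((\<lambda>r. r ^ 5 / (e ^ 2 * ?s r ^ 5)) \<longlongrightarrow> 1 / e ^ 2) at_top"
    using tendsto_mult_left[OF tendsto_power[OF tendsto_ratio_sqrt[OF e], of 5], of "1 / e ^ 2"]
    by (simp add: power_divide mult.commute)
  have s_top: "filterlim ?s at_top at_top"
  proof (rule filterlim_at_top_mono[OF filterlim_ident])
    show "\<forall>\<^sub>F r in at_top. r \<le> ?s r"
      by (intro always_eventually allI real_le_rsqrt) simp
  qed
  have lim0: "((\<lambda>r. - (1 / ?s r ^ 5)) \<longlongrightarrow> 0) at_top"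
    using tendsto_minus[OF tendsto_divide_0[OF tendsto_const[of 1]
        filterlim_at_top_imp_at_infinity[OF filterlim_pow_at_top[OF _ s_top, of 5]]]] by simp
  have layer: "ennreal (wt e z ^ 5) = (\<integral>\<^sup>+r. ennreal (5 * r / ?s r ^ 7) * indicator {norm z..} r \<partial>lborel)" for z :: R3
  proof -
    have "(\<integral>\<^sup>+r. ennreal (5 * r / ?s r ^ 7) * indicator {norm z..} r \<partial>lborel) = ennreal (0 - - (1 / ?s (norm z) ^ 5))"
    proof (rule nn_integral_FTC_atLeast[OF _ _ _ lim0])
      fix r assume "norm z \<le> r"
      then have "r \<ge> 0" using norm_ge_zero order_trans by blast
      then show "0 \<le> 5 * r / ?s r ^ 7" by simp
    qed (auto intro!: power_sqrt_DERIV[OF e])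
    then show ?thesis by (simp add: wt_def power_divide)
  qed
  have "(\<integral>\<^sup>+z. ennreal (wt e z ^ 5) \<partial>lborel)
      = (\<integral>\<^sup>+z. (\<integral>\<^sup>+r. ennreal (5 * r / ?s r ^ 7) * indicator {norm (z :: R3)..} r \<partial>lborel) \<partial>lborel)"
    by (simp only: layer)
  also have "\<dots> = (\<integral>\<^sup>+r. (\<integral>\<^sup>+z. ennreal (5 * r / ?s r ^ 7) * indicator {norm (z :: R3)..} r \<partial>lborel) \<partial>lborel)"
  proof (rule pair_sigma_finite.Fubini')
    show "pair_sigma_finite (lborel :: real measure) (lborel :: R3 measure)"
      by (simp add: pair_sigma_finite_def sigma_finite_lborel)
    have "(\<lambda>(r, z :: R3). ennreal (5 * r / ?s r ^ 7) * indicator {(r, z). norm z \<le> r} (r, z)) \<in> borel_measurable (lborel \<Otimes>\<^sub>M lborel)"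
      by measurable
    also have "(\<lambda>(r, z :: R3). ennreal (5 * r / ?s r ^ 7) * indicator {(r, z). norm z \<le> r} (r, z))
       = (\<lambda>(r, z). ennreal (5 * r / ?s r ^ 7) * indicator {norm z..} r)"
      by (auto simp: fun_eq_iff indicator_def)
    finally show "(\<lambda>(r, z :: R3). ennreal (5 * r / ?s r ^ 7) * indicator {norm z..} r) \<in> borel_measurable (lborel \<Otimes>\<^sub>M lborel)" .
  qed
  also have "\<dots> = (\<integral>\<^sup>+r. ennreal (4 * pi / 3) * (ennreal (5 * r ^ 4 / ?s r ^ 7) * indicator {0..} r) \<partial>lborel)"
  proof (rule nn_integral_cong)
    fix r :: real
    have "(\<integral>\<^sup>+z. ennreal (5 * r / ?s r ^ 7) * indicator {norm (z :: R3)..} r \<partial>lborel)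
        = (\<integral>\<^sup>+z. ennreal (5 * r / ?s r ^ 7) * indicator (cball (0 :: R3) r) z \<partial>lborel)"
      by (intro nn_integral_cong) (auto simp: indicator_def)
    also have "\<dots> = ennreal (5 * r / ?s r ^ 7) * emeasure lborel (cball (0::R3) r)"
      by (rule nn_integral_cmult_indicator) simp
    also have "\<dots> = ennreal (4 * pi / 3) * (ennreal (5 * r ^ 4 / ?s r ^ 7) * indicator {0..} r)"
    proof (cases "r \<ge> 0")
      case True
      then have "emeasure lborel (cball (0::R3) r) = ennreal (4 / 3 * pi * r ^ 3)"
        by (simp add: emeasure_cball unit_ball_vol_3)
      with True show ?thesis
        by (simp add: ennreal_mult[symmetric]) (simp add: numeral_eq_Suc mult_ac)
    qed (simp add: cball_empty)
    finally show "(\<integral>\<^sup>+z. ennreal (5 * r / ?s r ^ 7) * indicator {norm (z :: R3)..} r \<partial>lborel)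
        = ennreal (4 * pi / 3) * (ennreal (5 * r ^ 4 / ?s r ^ 7) * indicator {0..} r)" .
  qed
  also have "\<dots> = ennreal (4 * pi / 3) * (\<integral>\<^sup>+r. ennreal (5 * r ^ 4 / ?s r ^ 7) * indicator {0..} r \<partial>lborel)"
    by (rule nn_integral_cmult) measurable
  also have "(\<integral>\<^sup>+r. ennreal (5 * r ^ 4 / ?s r ^ 7) * indicator {0..} r \<partial>lborel)
      = ennreal (1 / e ^ 2 - 0 ^ 5 / (e ^ 2 * ?s 0 ^ 5))"
    by (rule nn_integral_FTC_atLeast[OF _ power_sqrt_DERIV(2)[OF e] _ lim5]) auto
  also have "ennreal (4 * pi / 3) * \<dots> = ennreal (4 * pi / 3 / e ^ 2)"
    by (simp add: ennreal_mult[symmetric])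
  finally show ?thesis .
qed

lemma integral_wt5:
  assumes e: "e > 0"
  shows "integrable lborel (\<lambda>z. wt e (a - z) ^ 5)"
    and "(\<integral>z. 3 * e ^ 2 * wt e (a - z) ^ 5 \<partial>lborel) = 4 * pi"
proof -
  have I: "integrable lborel (\<lambda>z. wt e z ^ 5)"
    by (rule integrableI_nonneg) (auto simp: nn_integral_wt5[OF e])
  have E: "(\<integral>z. wt e z ^ 5 \<partial>lborel) = 4 * pi / 3 / e ^ 2"
    by (rule integral_eq_nn_integral[THEN trans]) (auto simp: nn_integral_wt5[OF e])
  have wt_a: "wt e (a - z) = wt e (- a + z)" for z
    using wt_minus[of e "a - z"] by (simp add: algebra_simps del: wt_minus)
  have "integrable (distr lborel borel ((+) (- a))) (\<lambda>z. wt e z ^ 5)"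
    unfolding lborel_distr_plus by (rule I)
  then show "integrable lborel (\<lambda>z. wt e (a - z) ^ 5)"
    unfolding wt_a by (subst (asm) integrable_distr_eq) auto
  have "(\<integral>z. wt e (a - z) ^ 5 \<partial>lborel) = (\<integral>z. wt e z ^ 5 \<partial>distr lborel borel ((+) (- a)))"
    unfolding wt_a by (subst integral_distr) auto
  then show "(\<integral>z. 3 * e ^ 2 * wt e (a - z) ^ 5 \<partial>lborel) = 4 * pi"
    using e by (simp add: lborel_distr_plus E)
qed

subsection \<open>Convergence of the regularised integrals\<close>

lemma lborel_distr_reflect: "distr lborel borel (\<lambda>y. x - y) = (lborel :: R3 measure)"
proof -
  have "(lborel :: R3 measure) = density (distr lborel borel (\<lambda>y. x + (- 1) *\<^sub>R y)) (\<lambda>_. ennreal (\<bar>- 1\<bar> ^ DIM(R3)))"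
    by (rule lborel_affine) simp
  then show ?thesis by (simp add: density_1)
qed

lemma integral_reflect_shift:
  fixes g :: "R3 \<Rightarrow> real"
  assumes "g \<in> borel_measurable borel"
  shows "(\<integral>y. g (x - y) \<partial>lborel) = (\<integral>y. g y \<partial>lborel)"
    and "integrable lborel (\<lambda>y. g (x - y)) \<longleftrightarrow> integrable lborel g"
proof -
  have "(\<integral>y. g (x - y) \<partial>lborel) = (\<integral>y. g y \<partial>distr lborel borel (\<lambda>y. x - y))"
    using assms by (subst integral_distr) auto
  then show "(\<integral>y. g (x - y) \<partial>lborel) = (\<integral>y. g y \<partial>lborel)" by (simp add: lborel_distr_reflect)
  have "integrable (distr lborel borel (\<lambda>y. x - y)) g \<longleftrightarrow> integrable lborel (\<lambda>y. g (x - y))"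
    using assms by (subst integrable_distr_eq) auto
  then show "integrable lborel (\<lambda>y. g (x - y)) \<longleftrightarrow> integrable lborel g" by (simp add: lborel_distr_reflect)
qed

text \<open>A fixed null sequence stands for e tending to 0, because dominated convergence is
  applied along sequences.\<close>

definition eps :: "nat \<Rightarrow> real" where
  "eps n = 1 / real (Suc n)"

lemma eps_pos [simp]: "eps n > 0"
  by (simp add: eps_def)

lemma eps_tendsto: "eps \<longlonglongrightarrow> 0"
  unfolding eps_def using LIMSEQ_inverse_real_of_nat by (simp add: inverse_eq_divide)

text \<open>One statement covers two situations: e > 0 with d = -1, where the set is the whole unit
  ball including its centre, and e = 0 with d > 0, the truncated kernel. The integrand is bounded by
  e^(-3) or d^(-3) respectively.\<close>

lemma integrable_wt3_annulus:
  assumes d: "e > 0 \<or> d > 0"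
  shows "integrable lborel (\<lambda>z. indicator {d<..<1} (norm z) * wt e z ^ 3)" 
proof -
  obtain K where K: "\<And>z. norm z > d \<Longrightarrow> wt e z ^ 3 \<le> K" "K \<ge> 0"
  proof (cases "e > 0")
    case True
    have "wt e z ^ 3 \<le> (1 / e) ^ 3" for z
      by (intro power_mono wt_le' True) simp
    then show ?thesis using that[of "(1 / e) ^ 3"] True by simp
  next
    case False
    with d have "d > 0" by simp
    have "wt e z ^ 3 \<le> (1 / d) ^ 3" if z: "norm z > d" for z
    proof (intro power_mono)
      have "wt e z \<le> 1 / norm z" using z \<open>d > 0\<close> by (intro wt_le) auto
      also have "\<dots> \<le> 1 / d" using z \<open>d > 0\<close> by (intro frac_le) auto
      finally show "wt e z \<le> 1 / d" .
    qed simp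
    then show ?thesis using that[of "(1 / d) ^ 3"] \<open>d > 0\<close> by simp
  qed
  show ?thesis
  proof (rule Bochner_Integration.integrable_bound)
    show "integrable lborel (\<lambda>z :: R3. K * indicator (ball 0 1) z)"
      by (intro integrable_mult_right) (simp add: integrable_indicator_iff emeasure_ball_R3)
    have "norm (indicator {d<..<1} (norm z) * wt e z ^ 3) \<le> norm (K * indicator (ball 0 1) z)" for z :: R3
      using K by (auto simp: indicator_def)
    then show "AE z in lborel. norm (indicator {d<..<1} (norm z) * wt e z ^ 3) \<le> norm (K * indicator (ball 0 1) (z :: R3))"
      by simp
  qed measurable
qed

lemma integrable_hess_annulus:
  assumes d: "e > 0 \<or> d > 0"
  shows "integrable lborel (\<lambda>z. indicator {d<..<1} (norm z) * hess e i j z)"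
proof (rule Bochner_Integration.integrable_bound)
  show "integrable lborel (\<lambda>z. 4 * (indicator {d<..<1} (norm z) * wt e z ^ 3))"
    by (intro integrable_mult_right integrable_wt3_annulus d)
  have "norm (indicator {d<..<1} (norm z) * hess e i j z) \<le> norm (4 * (indicator {d<..<1} (norm z) * wt e z ^ 3))" for z
    using abs_hess_le[of e i j z] by (auto simp: indicator_def)
  then show "AE z in lborel. norm (indicator {d<..<1} (norm z) * hess e i j z)
      \<le> norm (4 * (indicator {d<..<1} (norm z) * wt e z ^ 3))" by simp
qed measurable

text \<open>The total mass is 4 pi / 3 for each n. Outside the unit ball w^5 \<le> |z|^(-5) \<le> 32
  (1 + |z|)^(-5), so the part lost there is at most K times the square of
  \<open>eps n\<close>.\<close>

lemma near_mass_tendsto: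
  "(\<lambda>n. \<integral>z. indicator {-1<..<1} (norm z) * (eps n ^ 2 * wt (eps n) z ^ 5) \<partial>lborel) \<longlonglongrightarrow> 4 * pi / 3"
proof -
  define K where "K = (\<integral>z. 32 * (1 / (1 + norm (z :: R3)) ^ 5) \<partial>lborel)"
  let ?a = "\<lambda>n. \<integral>z. indicator {-1<..<1} (norm z) * (eps n ^ 2 * wt (eps n) z ^ 5) \<partial>lborel"
  have w: "integrable lborel (\<lambda>z. wt (eps n) z ^ 5)" "(\<integral>z. wt (eps n) z ^ 5 \<partial>lborel) = 4 * pi / 3 / eps n ^ 2" for n
    using integral_wt5[OF eps_pos[of n], of 0] by (simp_all add: less_imp_neq[OF eps_pos, symmetric] field_simps)
  have bounds: "4 * pi / 3 - eps n ^ 2 * K \<le> ?a n \<and> ?a n \<le> 4 * pi / 3" for n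
  proof -
    have int: "integrable lborel (\<lambda>z. indicator A (norm z) * (eps n ^ 2 * wt (eps n) z ^ 5))" if [measurable]: "A \<in> sets borel" for A
    proof (rule Bochner_Integration.integrable_bound)
      show "integrable lborel (\<lambda>z. eps n ^ 2 * wt (eps n) z ^ 5)"
        by (intro integrable_mult_right w)
      show "AE z in lborel. norm (indicator A (norm z) * (eps n ^ 2 * wt (eps n) z ^ 5)) \<le> norm (eps n ^ 2 * wt (eps n) z ^ 5)"
        by (intro AE_I2) (auto simp: indicator_def)
    qed measurable
    let ?b = "\<integral>z. indicator {1..} (norm z) * (eps n ^ 2 * wt (eps n) z ^ 5) \<partial>lborel"
    have "?a n + ?b = (\<integral>z. eps n ^ 2 * wt (eps n) z ^ 5 \<partial>lborel)"
    proof -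
      have "?a n + ?b = (\<integral>z. indicator {-1<..<1} (norm z) * (eps n ^ 2 * wt (eps n) z ^ 5)
         + indicator {1..} (norm z) * (eps n ^ 2 * wt (eps n) z ^ 5) \<partial>lborel)"
        by (intro Bochner_Integration.integral_add[symmetric] int) auto
      also have "\<dots> = (\<integral>z. eps n ^ 2 * wt (eps n) z ^ 5 \<partial>lborel)"
        by (intro Bochner_Integration.integral_cong refl)
          (auto simp: indicator_def intro: less_le_trans[OF _ norm_ge_zero])
      finally show ?thesis .
    qed
    also have "\<dots> = 4 * pi / 3"
      using w[of n] by (simp add: less_imp_neq[OF eps_pos, symmetric])
    finally have sum: "?a n + ?b = 4 * pi / 3" .
    have "?b \<le> (\<integral>z. eps n ^ 2 * (32 * (1 / (1 + norm (z :: R3)) ^ 5)) \<partial>lborel)"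
    proof (rule integral_mono)
      show "integrable lborel (\<lambda>z :: R3. eps n ^ 2 * (32 * (1 / (1 + norm z) ^ 5)))"
        by (intro integrable_mult_right integrable_decay) simp
      fix z :: R3
      show "indicator {1..} (norm z) * (eps n ^ 2 * wt (eps n) z ^ 5) \<le> eps n ^ 2 * (32 * (1 / (1 + norm z) ^ 5))"
      proof (cases "norm z \<ge> 1")
        case True
        then have "wt (eps n) z ^ 5 \<le> (1 / norm z) ^ 5"
          by (intro power_mono wt_le) auto
        also have "\<dots> \<le> (2 / (1 + norm z)) ^ 5"
        proof (intro power_mono)
          have "0 < norm z" using True by linarith
          then show "1 / norm z \<le> 2 / (1 + norm z)"
            using True by (simp add: divide_simps add_pos_pos)
        qed simp
        also have "\<dots> = 32 * (1 / (1 + norm z) ^ 5)" by (simp add: power_divide)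
        finally have "eps n ^ 2 * wt (eps n) z ^ 5 \<le> eps n ^ 2 * (32 * (1 / (1 + norm z) ^ 5))"
          by (rule mult_left_mono) simp
        then show ?thesis using True by simp
      qed (simp add: add_pos_nonneg)
    qed (intro int, simp)
    also have "\<dots> = eps n ^ 2 * K"
      unfolding K_def by (rule integral_mult_right_zero)
    finally have "?b \<le> eps n ^ 2 * K" .
    moreover have "?b \<ge> 0" by (intro integral_nonneg_AE) auto
    ultimately show ?thesis using sum by linarith
  qed
  have "(\<lambda>n. 4 * pi / 3 - eps n ^ 2 * K) \<longlonglongrightarrow> 4 * pi / 3 - 0 ^ 2 * K"
    by (intro tendsto_intros eps_tendsto)
  then have l: "(\<lambda>n. 4 * pi / 3 - eps n ^ 2 * K) \<longlonglongrightarrow> 4 * pi / 3" by simp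
  show ?thesis
    by (rule tendsto_sandwich[OF _ _ l tendsto_const]; rule always_eventually) (simp_all only: bounds HOL.simp_thms)
qed

section \<open>The singular integral of one component as a limit of regularised integrals\<close>

lemma wt_tendsto:
  assumes "z \<noteq> 0"
  shows "(\<lambda>n. wt (eps n) z) \<longlonglongrightarrow> wt 0 z"
  unfolding wt_def using assms by (intro tendsto_intros eps_tendsto) auto

lemma hess_tendsto:
  assumes "z \<noteq> 0"
  shows "(\<lambda>n. hess (eps n) i j z) \<longlonglongrightarrow> hess 0 i j z"
  unfolding hess_def using assms by (intro tendsto_intros wt_tendsto)

text \<open>Setting for a single component of \<open>f\<close> and a single ball. The Hoelder
  constant may depend on the point x, since the hypothesis on \<open>f\<close> is only local; the
  exponent is capped at 1. The assumptions do not constrain \<open>x0\<close>, so the facts hold for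
  every centre.\<close>

locale regularised =
  fixes \<Theta> f :: "R3 \<Rightarrow> real" and x0 :: R3 and R Mf MT \<beta> :: real
  assumes R: "R > 0" and \<beta>: "0 < \<beta>" "\<beta> \<le> 1"
    and f_cont: "continuous_on UNIV f" and f_bound: "\<And>y. \<bar>f y\<bar> \<le> Mf"
    and hoelder: "\<And>x. \<exists>L. \<forall>y. norm (x - y) \<le> 1 \<longrightarrow> \<bar>f y - f x\<bar> \<le> L * norm (x - y) powr \<beta>"
    and \<Theta>_cont: "continuous_on UNIV \<Theta>" and \<Theta>_bound: "\<And>y. \<bar>\<Theta> y\<bar> \<le> MT"
    and \<Theta>_in: "\<And>y. norm y < 2 \<Longrightarrow> \<Theta> y = 1" and \<Theta>_out: "\<And>y. norm y \<ge> 4 \<Longrightarrow> \<Theta> y = 0"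
begin

lemma f_measurable [measurable]: "f \<in> borel_measurable borel"
  by (rule borel_measurable_continuous_onI[OF f_cont])

lemma \<Theta>_measurable [measurable]: "\<Theta> \<in> borel_measurable borel"
  by (rule borel_measurable_continuous_onI[OF \<Theta>_cont])

text \<open>At e = 0 this is 4 pi times \<open>Kfar\<close>; for e > 0 it is the same correction for
  the regularised kernel.\<close>

definition far :: "real \<Rightarrow> 3 \<Rightarrow> 3 \<Rightarrow> R3 \<Rightarrow> real" where
  "far e i j z = hess e i j z * (1 - \<Theta> (z /\<^sub>R R))"

text \<open>Subtracting \<open>f x\<close> near \<open>x\<close> gives a majorant that is integrable and independent of \<open>e\<close>; as the
  Hessian of the kernel has no trace-free part on average over spheres, the integral changes only by
  an explicit multiple of \<open>f x\<close>.\<close>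

definition centred :: "real \<Rightarrow> 3 \<Rightarrow> 3 \<Rightarrow> R3 \<Rightarrow> R3 \<Rightarrow> real" where
  "centred e i j x y = hess e i j (x - y) * (f y - f x * indicator (ball x 1) y) - f y * far e i j (x0 - y)"

lemma far_measurable [measurable]: "far e i j \<in> borel_measurable borel"
  unfolding far_def[abs_def] by measurable

lemma centred_measurable [measurable]: "centred e i j x \<in> borel_measurable borel"
  unfolding centred_def[abs_def] by measurable

lemma far_eq_0: "norm z < 2 * R \<Longrightarrow> far e i j z = 0"
  using R \<Theta>_in[of "z /\<^sub>R R"] by (simp add: far_def field_simps)

lemma far_eq_hess: "norm z \<ge> 4 * R \<Longrightarrow> far e i j z = hess e i j z"
  using R \<Theta>_out[of "z /\<^sub>R R"] by (simp add: far_def field_simps)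

text \<open>The cutoff removes |z| < 2 R, and beyond that radius the Hessian is at most 4 / (2 R)^3
  whatever e is.\<close>

lemma far_bounded: "\<exists>B\<ge>0. \<forall>e i j z. \<bar>far e i j z\<bar> \<le> B"
proof (intro exI conjI allI)
  let ?B = "4 * (1 / (2 * R) ^ 3) * (1 + MT)"
  have MT: "MT \<ge> 0" using \<Theta>_bound[of 0] by linarith
  show "?B \<ge> 0" using R MT by simp
  fix e i j z
  show "\<bar>far e i j z\<bar> \<le> ?B"
  proof (cases "norm z < 2 * R")
    case True
    then show ?thesis using \<open>?B \<ge> 0\<close> by (simp add: far_eq_0)
  next
    case False
    then have z: "z \<noteq> 0" "2 * R \<le> norm z" using R by auto
    have "\<bar>hess e i j z\<bar> \<le> 4 * (1 / norm z ^ 3)"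
      using abs_hess_le[of e i j z] wt_power_le[OF z(1), of e 3] by linarith
    also have "\<dots> \<le> 4 * (1 / (2 * R) ^ 3)"
      using z R by (intro mult_left_mono divide_left_mono power_mono) auto
    finally have 1: "\<bar>hess e i j z\<bar> \<le> 4 * (1 / (2 * R) ^ 3)" .
    have "\<bar>1 - \<Theta> (z /\<^sub>R R)\<bar> \<le> 1 + MT" using \<Theta>_bound[of "z /\<^sub>R R"] by linarith
    with 1 show ?thesis
      unfolding far_def abs_mult using R by (intro mult_mono) auto
  qed
qed

text \<open>Three regions. For |x - y| < 1 the Hoelder bound reduces |x - y|^(-3) to the integrable
  |x - y|^(\<beta> - 3). For other y with |y| \<le> Y all factors are bounded. Beyond Y the cutoff
  is inactive and the kernel is a difference of two Hessians, of order |y|^(-4).\<close>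

lemma centred_dominated: "\<exists>D. integrable lborel D \<and> (\<forall>e y. \<bar>centred e i j x y\<bar> \<le> D y)"
proof -
  obtain L0 where L0: "\<And>y. norm (x - y) \<le> 1 \<Longrightarrow> \<bar>f y - f x\<bar> \<le> L0 * norm (x - y) powr \<beta>"
    using hoelder by blast
  define L where "L = max L0 0"
  have L: "\<bar>f y - f x\<bar> \<le> L * norm (x - y) powr \<beta>" if "norm (x - y) \<le> 1" for y
    using L0[OF that] by (auto simp: L_def intro: order_trans[OF _ mult_right_mono])
  have "L \<ge> 0" by (simp add: L_def)
  obtain B where B: "B \<ge> 0" "\<And>e i j z. \<bar>far e i j z\<bar> \<le> B"
    using far_bounded by blast
  have Mf: "Mf \<ge> 0" using f_bound[of 0] by linarith
  \<comment> \<open>Large enough for two purposes: |y| > Y puts x0 - y beyond 4 R, where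
    \<open>far\<close> is the plain Hessian, and meets the distance condition of the mean value
    estimate for the pair x, x0.\<close>
  define Y where "Y = 2 * (norm x + norm x0) + 1 + 4 * R"
  define C where "C = Mf * (24 * norm (x - x0) * 4 ^ 4) + Mf * (4 + B) * (1 + Y) ^ 4"
  define s where "s z = norm z powr (\<beta> - 3) * indicator (ball 0 1) z" for z :: R3
  define D where "D y = 4 * L * s (x - y) + C * (1 / (1 + norm y) ^ 4)" for y
  have s_int: "integrable lborel s"
    unfolding s_def[abs_def] using \<beta> by (intro integrable_singularity) auto
  then have "integrable lborel (\<lambda>y. s (x - y))"
    by (subst integral_reflect_shift) auto
  then have "integrable lborel D"
    unfolding D_def[abs_def] by (intro Bochner_Integration.integrable_add integrable_mult_right integrable_decay) auto
  moreover have "\<bar>centred e i j x y\<bar> \<le> D y" for e y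
  proof -
    have Ynn: "0 \<le> Y" using R by (simp add: Y_def)
    have C1: "Mf * (4 + B) \<le> C * (1 / (1 + norm y) ^ 4)" if "norm y \<le> Y"
    proof -
      have "1 \<le> (1 + Y) ^ 4 / (1 + norm y) ^ 4"
      proof -
        have "0 < 1 + norm y" by (simp add: add_pos_nonneg)
        then show ?thesis
          using that by (subst le_divide_eq_1_pos) (auto intro!: power_mono zero_less_power)
      qed
      from mult_left_mono[OF this, of "Mf * (4 + B)"]
      have "Mf * (4 + B) \<le> Mf * (4 + B) * (1 + Y) ^ 4 * (1 / (1 + norm y) ^ 4)"
        using Mf B by simp
      also have "\<dots> \<le> C * (1 / (1 + norm y) ^ 4)"
        unfolding C_def using Mf by (intro mult_right_mono) auto
      finally show ?thesis .
    qed
    have snn: "0 \<le> s z" for z by (simp add: s_def)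
    have fB: "\<bar>f y * far e i j (x0 - y)\<bar> \<le> Mf * B"
      unfolding abs_mult by (intro mult_mono f_bound B Mf) auto
    show ?thesis
    proof (cases "norm (x - y) < 1")
      case True
      then have ind: "indicator (ball x 1) y = (1 :: real)" by (simp add: dist_norm)
      have "norm y \<le> norm x + norm (x - y)"
        using norm_triangle_ineq4[of x "x - y"] by simp
      also have "\<dots> \<le> Y" using True norm_ge_zero[of x] norm_ge_zero[of x0] R unfolding Y_def by argo
      finally have yY: "norm y \<le> Y" .
      have "\<bar>hess e i j (x - y) * (f y - f x)\<bar> \<le> 4 * L * s (x - y)"
      proof (cases "y = x")
        case False
        then have z: "x - y \<noteq> 0" by simp
        have "\<bar>hess e i j (x - y)\<bar> \<le> 4 * (1 / norm (x - y) ^ 3)"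
          using abs_hess_le[of e i j "x - y"] wt_power_le[OF z, of e 3] by linarith
        then have "\<bar>hess e i j (x - y) * (f y - f x)\<bar> \<le> 4 * (1 / norm (x - y) ^ 3) * (L * norm (x - y) powr \<beta>)"
          unfolding abs_mult using True by (intro mult_mono L) auto
        also have "\<dots> = 4 * L * s (x - y)"
          using z True by (simp add: s_def powr_diff)
        finally show ?thesis .
      qed (use \<open>L \<ge> 0\<close> snn in simp)
      moreover have "Mf * B \<le> Mf * (4 + B)" using Mf by (intro mult_left_mono) auto
      ultimately show ?thesis
        using C1[OF yY] fB unfolding centred_def D_def ind by simp
    next
      case False
      then have ind: "indicator (ball x 1) y = (0 :: real)" by (simp add: dist_norm)
      have eq: "centred e i j x y = f y * (hess e i j (x - y) - far e i j (x0 - y))"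
        unfolding centred_def ind by (simp add: algebra_simps)
      have "\<bar>centred e i j x y\<bar> \<le> C * (1 / (1 + norm y) ^ 4)"
      proof (cases "norm y \<le> Y")
        case True
        from False have z: "x - y \<noteq> 0" by auto
        have "wt e (x - y) ^ 3 \<le> 1 / norm (x - y) ^ 3" by (rule wt_power_le[OF z])
        also have "\<dots> \<le> 1 / 1 ^ 3" using False by (intro divide_left_mono power_mono) auto
        finally have "\<bar>hess e i j (x - y)\<bar> \<le> 4"
          using abs_hess_le[of e i j "x - y"] by simp
        then have "\<bar>hess e i j (x - y) - far e i j (x0 - y)\<bar> \<le> 4 + B"
          using B(2)[of e i j "x0 - y"] by linarith
        then have "\<bar>centred e i j x y\<bar> \<le> Mf * (4 + B)"
          unfolding eq abs_mult by (intro mult_mono f_bound Mf) auto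
        also note C1[OF True]
        finally show ?thesis .
      next
        case far: False
        have "norm y \<le> norm x0 + norm (x0 - y)"
          using norm_triangle_ineq4[of x0 "x0 - y"] by simp
        then have "norm (x0 - y) \<ge> 4 * R" and far': "norm y \<ge> 2 * (norm x + norm x0) + 1"
          using far norm_ge_zero[of x] norm_ge_zero[of x0] R unfolding Y_def by argo+
        then have fe: "far e i j (x0 - y) = hess e i j (x0 - y)" by (intro far_eq_hess)
        have "\<bar>hess e i j (x - y) - hess e i j (x0 - y)\<bar> \<le> 24 * norm (x - x0) * 4 ^ 4 / (1 + norm y) ^ 4"
          by (rule difference_decay_far[OF hess_derivative(1) hess_derivative(2) zero_le_numeral far'])
        then have "\<bar>centred e i j x y\<bar> \<le> Mf * (24 * norm (x - x0) * 4 ^ 4 / (1 + norm y) ^ 4)"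
          unfolding eq abs_mult fe by (intro mult_mono f_bound Mf) auto
        also have "\<dots> = Mf * (24 * norm (x - x0) * 4 ^ 4) * (1 / (1 + norm y) ^ 4)" by simp
        also have "\<dots> \<le> C * (1 / (1 + norm y) ^ 4)"
          unfolding C_def using Mf B Ynn by (intro mult_right_mono) auto
        finally show ?thesis .
      qed
      then show ?thesis using \<open>L \<ge> 0\<close> snn[of "x - y"] by (simp add: D_def add_increasing)
    qed
  qed
  ultimately show ?thesis by blast
qed

lemma centred_integrable: "integrable lborel (centred e i j x)"
proof -
  obtain D where D: "integrable lborel D" "\<And>e y. \<bar>centred e i j x y\<bar> \<le> D y"
    using centred_dominated[where i=i and j=j and x=x] by metis
  show ?thesis
    by (rule Bochner_Integration.integrable_bound[OF D(1)]) (auto intro: order_trans[OF D(2) abs_ge_self])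
qed

lemma centred_tendsto:
  "(\<lambda>n. \<integral>y. centred (eps n) i j x y \<partial>lborel) \<longlonglongrightarrow> (\<integral>y. centred 0 i j x y \<partial>lborel)"
proof -
  obtain D where D: "integrable lborel D" "\<And>e y. \<bar>centred e i j x y\<bar> \<le> D y"
    using centred_dominated[where i=i and j=j and x=x] by metis
  have far0: "(\<lambda>n. far (eps n) i j z) \<longlonglongrightarrow> far 0 i j z" for z
  proof (cases "z = 0")
    case False
    then show ?thesis unfolding far_def by (intro tendsto_intros hess_tendsto)
  qed (use R in \<open>simp add: far_eq_0\<close>)
  have "(\<lambda>n. centred (eps n) i j x y) \<longlonglongrightarrow> centred 0 i j x y" for y
  proof -
    have "(\<lambda>n. hess (eps n) i j (x - y) * (f y - f x * indicator (ball x 1) y))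
        \<longlonglongrightarrow> hess 0 i j (x - y) * (f y - f x * indicator (ball x 1) y)"
    proof (cases "y = x")
      case False
      then show ?thesis by (intro tendsto_intros hess_tendsto) simp
    qed simp
    then show ?thesis
      unfolding centred_def by (rule tendsto_diff[OF _ tendsto_mult[OF tendsto_const far0]])
  qed
  then show ?thesis
    using D by (intro integral_dominated_convergence[where w=D]) auto
qed

text \<open>The unit ball about x is encoded by the norm lying in {-1<..<1}, the radial form in
  which the mean of the Hessian was computed; the endpoint -1 keeps y = x inside.\<close>

lemma split_centred:
  "(hess e i j (x - y) - far e i j (x0 - y)) * f y
    = centred e i j x y + f x * (indicator {-1<..<1} (norm (x - y)) * hess e i j (x - y))"
proof -
  have "- 1 < norm (x - y)" by (rule less_le_trans[OF _ norm_ge_zero]) simp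
  then show ?thesis
    unfolding centred_def by (auto simp: indicator_def dist_norm algebra_simps)
qed

lemma regularised_integral:
  assumes e: "e > 0"
  shows "integrable lborel (\<lambda>y. (hess e i j (x - y) - far e i j (x0 - y)) * f y)"
    and "(\<integral>y. (hess e i j (x - y) - far e i j (x0 - y)) * f y \<partial>lborel) =
      (\<integral>y. centred e i j x y \<partial>lborel) - kdelta i j * f x *
        (\<integral>z. indicator {-1<..<1} (norm z) * (e ^ 2 * wt e z ^ 5) \<partial>lborel)"
proof -
  let ?h = "\<lambda>z. indicator {-1<..<1} (norm z) * hess e i j z"
  have hi: "integrable lborel ?h"
    by (rule integrable_hess_annulus) (simp add: e)
  then have h: "integrable lborel (\<lambda>y. ?h (x - y))"
    by (subst integral_reflect_shift(2)) auto
  show "integrable lborel (\<lambda>y. (hess e i j (x - y) - far e i j (x0 - y)) * f y)"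
    unfolding split_centred by (intro Bochner_Integration.integrable_add centred_integrable integrable_mult_right h)
  have "(\<integral>y. ?h (x - y) \<partial>lborel) = (\<integral>z. ?h z \<partial>lborel)"
    by (rule integral_reflect_shift(1)) measurable
  also have "\<dots> = - kdelta i j * (\<integral>z. indicator {-1<..<1} (norm z) * (e ^ 2 * wt e z ^ 5) \<partial>lborel)"
    using e by (intro integral_hess_radial integrable_wt3_annulus) auto
  finally have "(\<integral>y. ?h (x - y) \<partial>lborel) = - kdelta i j * (\<integral>z. indicator {-1<..<1} (norm z) * (e ^ 2 * wt e z ^ 5) \<partial>lborel)" .
  then show "(\<integral>y. (hess e i j (x - y) - far e i j (x0 - y)) * f y \<partial>lborel) =
      (\<integral>y. centred e i j x y \<partial>lborel) - kdelta i j * f x *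
        (\<integral>z. indicator {-1<..<1} (norm z) * (e ^ 2 * wt e z ^ 5) \<partial>lborel)"
    unfolding split_centred
    by (subst Bochner_Integration.integral_add) (auto intro: centred_integrable h)
qed

lemma G_integrand_eq: "G_integrand \<Theta> x0 R i j f x y = (hess 0 i j (x - y) - far 0 i j (x0 - y)) * f y / (4 * pi)"
  by (simp add: G_integrand_def Kfar_def Kker_eq_hess far_def field_simps)

text \<open>Truncation at d turns the subtracted unit ball into the annulus d < |z| < 1 (empty for d
  \<ge> 1), over which the unregularised Hessian integrates to zero. The truncated integral is thus
  that of the globally integrable \<open>centred 0\<close>, and the limit d to 0 becomes dominated
  convergence.\<close>

lemma G_trunc_eq:
  assumes d: "d > 0"
  shows "set_integrable lebesgue {y. norm (x - y) > d} (G_integrand \<Theta> x0 R i j f x)"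
    and "G_trunc \<Theta> x0 R i j f x d = (\<integral>y. indicator {y. norm (x - y) > d} y * centred 0 i j x y \<partial>lborel) / (4 * pi)"
proof -
  let ?S = "{y. norm (x - y) > d}"
  have S [measurable]: "?S \<in> sets borel"
    by (intro borel_open open_Collect_less continuous_intros)
  let ?h = "\<lambda>z. indicator {d<..<1} (norm z) * hess 0 i j z"
  have eq: "indicator ?S y *\<^sub>R G_integrand \<Theta> x0 R i j f x y
      = (indicator ?S y * centred 0 i j x y + f x * ?h (x - y)) / (4 * pi)" for y
    unfolding G_integrand_eq split_centred using d
    by (auto simp: indicator_def intro: less_le_trans[OF _ norm_ge_zero])
  have c: "integrable lborel (\<lambda>y. indicator ?S y * centred 0 i j x y)"
    using integrable_mult_indicator[OF _ centred_integrable, of ?S] by simp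
  have hi: "integrable lborel ?h"
    by (rule integrable_hess_annulus) (simp add: d)
  then have h: "integrable lborel (\<lambda>y. ?h (x - y))"
    by (subst integral_reflect_shift(2)) auto
  have I: "integrable lborel (\<lambda>y. indicator ?S y *\<^sub>R G_integrand \<Theta> x0 R i j f x y)"
    unfolding eq by (intro integrable_divide Bochner_Integration.integrable_add c integrable_mult_right h)
  then show "set_integrable lebesgue ?S (G_integrand \<Theta> x0 R i j f x)"
    unfolding set_integrable_def by (subst integrable_completion) auto
  have "(\<integral>y. ?h (x - y) \<partial>lborel) = (\<integral>z. ?h z \<partial>lborel)"
    by (rule integral_reflect_shift(1)) measurable
  also have "\<dots> = 0"
    using d by (subst integral_hess_radial) (auto intro: integrable_wt3_annulus)
  finally have h0: "(\<integral>y. ?h (x - y) \<partial>lborel) = 0" .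
  have "G_trunc \<Theta> x0 R i j f x d = (\<integral>y. indicator ?S y *\<^sub>R G_integrand \<Theta> x0 R i j f x y \<partial>lborel)"
    unfolding G_trunc_def set_lebesgue_integral_def using I
    by (intro integral_completion) auto
  also have "\<dots> = ((\<integral>y. indicator ?S y * centred 0 i j x y \<partial>lborel) + f x * (\<integral>y. ?h (x - y) \<partial>lborel)) / (4 * pi)"
    unfolding eq using c h by simp
  finally show "G_trunc \<Theta> x0 R i j f x d = (\<integral>y. indicator ?S y * centred 0 i j x y \<partial>lborel) / (4 * pi)"
    by (simp add: h0)
qed

lemma G_trunc_tendsto:
  "(G_trunc \<Theta> x0 R i j f x \<longlongrightarrow> (\<integral>y. centred 0 i j x y \<partial>lborel) / (4 * pi)) (at_right 0)"
proof (rule tendsto_at_right_sequentially[of 0 1])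
  fix S :: "nat \<Rightarrow> real"
  assume S: "\<And>n. 0 < S n" "S \<longlonglongrightarrow> 0"
  have [measurable]: "{y. norm (x - y) > d} \<in> sets borel" for d
    by (intro borel_open open_Collect_less continuous_intros)
  have "(\<lambda>n. \<integral>y. indicator {y. norm (x - y) > S n} y * centred 0 i j x y \<partial>lborel) \<longlonglongrightarrow> (\<integral>y. centred 0 i j x y \<partial>lborel)"
  proof (rule integral_dominated_convergence)
    show "integrable lborel (\<lambda>y. \<bar>centred 0 i j x y\<bar>)"
      by (intro integrable_abs centred_integrable)
    show "AE y in lborel. norm (indicator {y. norm (x - y) > S n} y * centred 0 i j x y) \<le> \<bar>centred 0 i j x y\<bar>" for n
      by (intro AE_I2) (auto simp: indicator_def)
    show "AE y in lborel. (\<lambda>n. indicator {y. norm (x - y) > S n} y * centred 0 i j x y) \<longlonglongrightarrow> centred 0 i j x y"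
      using AE_lborel_singleton[of x]
    proof eventually_elim
      case (elim y)
      then have "norm (x - y) > 0" by simp
      from order_tendstoD(2)[OF S(2) this]
      have "\<forall>\<^sub>F n in sequentially. indicator {y. norm (x - y) > S n} y * centred 0 i j x y = centred 0 i j x y"
        by eventually_elim simp
      then show ?case by (rule tendsto_eventually)
    qed
  qed measurable
  from tendsto_divide[OF this tendsto_const, of "4 * pi"]
  show "(\<lambda>n. G_trunc \<Theta> x0 R i j f x (S n)) \<longlonglongrightarrow> (\<integral>y. centred 0 i j x y \<partial>lborel) / (4 * pi)"
    by (simp add: G_trunc_eq(2)[OF S(1)])
qed simp

lemma G_well_defined: "G_well_defined \<Theta> x0 R i j f x"
  unfolding G_well_defined_def using G_trunc_eq(1) G_trunc_tendsto by blast

lemma G_eq: "G \<Theta> x0 R i j f x = - (1 / 3) * kdelta i j * f x + (\<integral>y. centred 0 i j x y \<partial>lborel) / (4 * pi)"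
  unfolding G_def by (simp add: tendsto_Lim[OF _ G_trunc_tendsto])

text \<open>The centred integrals converge to the principal value, and the mass 4 pi / 3 near the
  pole, divided by 4 pi, is the coefficient 1/3 in the definition of \<open>G\<close>.\<close>

lemma regularised_tendsto_G:
  "(\<lambda>n. \<integral>y. (hess (eps n) i j (x - y) - far (eps n) i j (x0 - y)) * f y \<partial>lborel) \<longlonglongrightarrow> 4 * pi * G \<Theta> x0 R i j f x"
proof -
  have "(\<lambda>n. (\<integral>y. centred (eps n) i j x y \<partial>lborel) - kdelta i j * f x *
        (\<integral>z. indicator {-1<..<1} (norm z) * (eps n ^ 2 * wt (eps n) z ^ 5) \<partial>lborel))
     \<longlonglongrightarrow> (\<integral>y. centred 0 i j x y \<partial>lborel) - kdelta i j * f x * (4 * pi / 3)"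
    by (intro tendsto_diff tendsto_mult tendsto_const centred_tendsto near_mass_tendsto)
  moreover have "4 * pi * G \<Theta> x0 R i j f x = (\<integral>y. centred 0 i j x y \<partial>lborel) - kdelta i j * f x * (4 * pi / 3)"
    unfolding G_eq using pi_gt_zero by (simp add: distrib_left right_diff_distrib)
  ultimately show ?thesis
    by (simp add: regularised_integral(2))
qed

text \<open>The correction \<open>far\<close> at x0 - y is the same for both base points and
  cancels, which leaves exactly the kernel that is tested against the equation.\<close>

lemma difference_tendsto_G:
  shows "integrable lborel (\<lambda>y. f y * (hess (eps n) i j (a - y) - hess (eps n) i j (b - y)))"
    and "(\<lambda>n. \<integral>y. f y * (hess (eps n) i j (a - y) - hess (eps n) i j (b - y)) \<partial>lborel)
      \<longlonglongrightarrow> 4 * pi * (G \<Theta> x0 R i j f a - G \<Theta> x0 R i j f b)"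
proof -
  let ?g = "\<lambda>n x y. (hess (eps n) i j (x - y) - far (eps n) i j (x0 - y)) * f y"
  have eq: "f y * (hess (eps n) i j (a - y) - hess (eps n) i j (b - y)) = ?g n a y - ?g n b y" for n y
    by (simp add: algebra_simps)
  have I: "integrable lborel (?g n x)" for n x
    by (rule regularised_integral(1)) simp
  show "integrable lborel (\<lambda>y. f y * (hess (eps n) i j (a - y) - hess (eps n) i j (b - y)))"
    unfolding eq by (intro Bochner_Integration.integrable_diff I)
  have "(\<integral>y. ?g n a y - ?g n b y \<partial>lborel) = (\<integral>y. ?g n a y \<partial>lborel) - (\<integral>y. ?g n b y \<partial>lborel)" for n
    by (intro Bochner_Integration.integral_diff I)
  then show "(\<lambda>n. \<integral>y. f y * (hess (eps n) i j (a - y) - hess (eps n) i j (b - y)) \<partial>lborel)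
      \<longlonglongrightarrow> 4 * pi * (G \<Theta> x0 R i j f a - G \<Theta> x0 R i j f b)"
    unfolding eq using tendsto_diff[OF regularised_tendsto_G[of i j a] regularised_tendsto_G[of i j b]]
    by (simp add: right_diff_distrib)
qed

end

subsection \<open>Growth of BMO functions and Lebesgue points\<close>

lemma L1_loc_measurable:
  assumes "L1_loc p"
  shows "p \<in> borel_measurable lebesgue"
proof (rule borel_measurable_LIMSEQ_real)
  show "(\<lambda>n. indicator (cball 0 (real n)) x *\<^sub>R p x) \<longlonglongrightarrow> p x" for x
  proof (rule tendsto_eventually)
    obtain N :: nat where "norm x \<le> real N" using real_arch_simple by blast
    show "\<forall>\<^sub>F n in sequentially. indicator (cball 0 (real n)) x *\<^sub>R p x = p x"
      using eventually_ge_at_top[of N]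
    proof eventually_elim
      case (elim n)
      then have "norm x \<le> real n" using \<open>norm x \<le> real N\<close> by simp
      then show ?case by simp
    qed
  qed
  show "(\<lambda>x. indicator (cball 0 (real n)) x *\<^sub>R p x) \<in> borel_measurable lebesgue" for n
    using assms by (intro borel_measurable_integrable) (simp add: L1_loc_def set_integrable_def)
qed

lemma L1_loc_ball: "L1_loc p \<Longrightarrow> set_integrable lebesgue (ball a r) p"
  unfolding L1_loc_def by (rule set_integrable_subset[of _ "cball a r"]) auto

lemma measure_ball_R3: "r \<ge> 0 \<Longrightarrow> measure lebesgue (ball (c :: R3) r) = 4 / 3 * pi * r ^ 3"
  by (simp add: content_ball unit_ball_vol_3)

text \<open>The means over consecutive dyadic balls differ by a bounded amount, so they grow at most
  linearly in k: the logarithmic growth of BMO functions.\<close>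

lemma BMO_dyadic_growth:
  assumes "BMO p"
  shows "\<exists>C\<ge>0. \<forall>k. (LINT x:ball 0 (2 ^ k)|lebesgue. \<bar>p x\<bar>) \<le> C * real (Suc k) * 8 ^ k"
proof -
  obtain M where M: "\<And>x0 r. r > 0 \<Longrightarrow> avg (ball x0 r) (\<lambda>x. \<bar>p x - avg (ball x0 r) p\<bar>) \<le> M"
    and L: "L1_loc p"
    using assms by (auto simp: BMO_def)
  define B where "B k = ball (0 :: R3) (2 ^ k)" for k :: nat
  define V where "V = 4 / 3 * pi"
  define a where "a k = avg (B k) p" for k
  have V: "V > 0" by (simp add: V_def)
  have mB: "measure lebesgue (B k) = V * 8 ^ k" for k
  proof -
    have "(2 ^ k :: real) ^ 3 = (2 ^ 3) ^ k" by (simp only: power_mult[symmetric] mult.commute)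
    then show ?thesis unfolding B_def V_def by (subst measure_ball_R3) auto
  qed
  have pB: "set_integrable lebesgue (B k) p" for k
    unfolding B_def by (rule L1_loc_ball[OF L])
  have cB: "set_integrable lebesgue (B k) (\<lambda>x. c)" for k and c :: real
  proof -
    have "emeasure lebesgue (B k) < \<infinity>" by (simp add: B_def emeasure_ball_R3)
    then have "integrable lebesgue (\<lambda>x. indicator (B k) x *\<^sub>R c)"
      by (intro integrable_scaleR_left) (simp add: integrable_indicator_iff B_def)
    then show ?thesis by (simp add: set_integrable_def)
  qed
  have intB: "(LINT x:B k|lebesgue. c) = c * (V * 8 ^ k)" for k and c :: real
  proof -
    have "(LINT x:B k|lebesgue. c) = (LINT x|lebesgue. indicator (B k) x * c)"
      by (simp add: set_lebesgue_integral_def)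
    also have "\<dots> = measure lebesgue (B k) * c" by (simp add: B_def)
    finally show ?thesis by (simp add: mB)
  qed
  have dB: "set_integrable lebesgue (B k) (\<lambda>x. \<bar>p x - c\<bar>)" for k c
    by (intro set_integrable_abs set_integral_diff(1) pB cB)
  have osc: "(LINT x:B k|lebesgue. \<bar>p x - a k\<bar>) \<le> M * (V * 8 ^ k)" for k
    using M[of "2 ^ k" 0] V unfolding avg_def[of "ball 0 (2 ^ k)" "\<lambda>x. \<bar>p x - avg (ball 0 (2 ^ k)) p\<bar>"]
    by (simp add: B_def[symmetric] a_def[symmetric] mB divide_le_eq)
  have M0: "M \<ge> 0"
  proof -
    have "0 \<le> (LINT x:B 0|lebesgue. \<bar>p x - a 0\<bar>)"
      unfolding set_lebesgue_integral_def by (intro integral_nonneg_AE) auto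
    also note osc[of 0]
    finally show ?thesis using V by (simp add: zero_le_mult_iff)
  qed
  \<comment> \<open>The oscillation about the mean of the larger ball is integrated over the smaller
    one; the volume ratio 8 enlarges the BMO constant to 8 M.\<close>
  have step: "\<bar>a k - a (Suc k)\<bar> \<le> 8 * M" for k
  proof -
    have "(LINT x:B k|lebesgue. p x - a (Suc k)) = a k * (V * 8 ^ k) - a (Suc k) * (V * 8 ^ k)"
      using V by (subst set_integral_diff(2)[OF pB cB]) (simp add: intB a_def avg_def mB)
    then have "\<bar>a k - a (Suc k)\<bar> * (V * 8 ^ k) = \<bar>LINT x:B k|lebesgue. p x - a (Suc k)\<bar>"
      using V by (simp add: abs_mult flip: left_diff_distrib)
    also have "\<dots> \<le> (LINT x:B k|lebesgue. \<bar>p x - a (Suc k)\<bar>)"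
      unfolding set_lebesgue_integral_def using integral_norm_bound[of lebesgue "\<lambda>x. indicator (B k) x *\<^sub>R (p x - a (Suc k))"]
      by (simp add: abs_mult)
    also have "\<dots> \<le> (LINT x:B (Suc k)|lebesgue. \<bar>p x - a (Suc k)\<bar>)"
      unfolding set_lebesgue_integral_def
    proof (rule integral_mono)
      show "integrable lebesgue (\<lambda>x. indicator (B k) x *\<^sub>R \<bar>p x - a (Suc k)\<bar>)"
        "integrable lebesgue (\<lambda>x. indicator (B (Suc k)) x *\<^sub>R \<bar>p x - a (Suc k)\<bar>)"
        using dB by (auto simp: set_integrable_def)
      have "B k \<subseteq> B (Suc k)" unfolding B_def by (rule subset_ball) simp
      then show "indicator (B k) x *\<^sub>R \<bar>p x - a (Suc k)\<bar> \<le> indicator (B (Suc k)) x *\<^sub>R \<bar>p x - a (Suc k)\<bar>" for x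
        by (auto simp: indicator_def)
    qed
    also have "\<dots> \<le> M * (V * 8 ^ Suc k)" by (rule osc)
    also have "\<dots> = 8 * M * (V * 8 ^ k)" by simp
    finally show ?thesis using V by simp
  qed
  have ak: "\<bar>a k\<bar> \<le> \<bar>a 0\<bar> + 8 * M * real k" for k
  proof (induction k)
    case (Suc k)
    then show ?case using step[of k] by (simp add: algebra_simps)
  qed simp
  \<comment> \<open>9 M = M + 8 M: the oscillation about the mean, plus the drift of the mean per
    dyadic step.\<close>
  define C where "C = V * (9 * M + \<bar>a 0\<bar>)"
  have "(LINT x:B k|lebesgue. \<bar>p x\<bar>) \<le> C * real (Suc k) * 8 ^ k" for k
  proof -
    have "(LINT x:B k|lebesgue. \<bar>p x\<bar>) \<le> (LINT x:B k|lebesgue. \<bar>p x - a k\<bar> + \<bar>a k\<bar>)"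
      unfolding set_lebesgue_integral_def
    proof (rule integral_mono)
      show "integrable lebesgue (\<lambda>x. indicator (B k) x *\<^sub>R \<bar>p x\<bar>)"
        using set_integrable_abs[OF pB] by (simp add: set_integrable_def)
      show "integrable lebesgue (\<lambda>x. indicator (B k) x *\<^sub>R (\<bar>p x - a k\<bar> + \<bar>a k\<bar>))"
        using set_integral_add(1)[OF dB cB] by (simp add: set_integrable_def)
    qed (auto simp: indicator_def)
    also have "\<dots> = (LINT x:B k|lebesgue. \<bar>p x - a k\<bar>) + \<bar>a k\<bar> * (V * 8 ^ k)"
      by (subst set_integral_add(2)[OF dB cB]) (simp add: intB)
    also have "\<dots> \<le> M * (V * 8 ^ k) + (\<bar>a 0\<bar> + 8 * M * real k) * (V * 8 ^ k)"
      using V by (intro add_mono osc mult_right_mono ak) simp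
    also have "\<dots> = (M + \<bar>a 0\<bar> + 8 * M * real k) * (V * 8 ^ k)" by (simp add: algebra_simps)
    also have "\<dots> \<le> ((9 * M + \<bar>a 0\<bar>) * real (Suc k)) * (V * 8 ^ k)"
      using V M0 by (intro mult_right_mono) (auto simp: algebra_simps)
    also have "\<dots> = C * real (Suc k) * 8 ^ k" by (simp add: C_def)
    finally show ?thesis .
  qed
  moreover have "C \<ge> 0" using V M0 by (simp add: C_def)
  ultimately show ?thesis unfolding B_def by blast
qed

text \<open>The dyadic masses (k + 1) 8^k meet the weight 16^(-k), and the series of (k + 1) / 2^k
  converges. A Borel representative is inserted because the dyadic estimate is formulated for Borel
  functions.\<close>

lemma BMO_weighted_integrable:
  assumes "BMO p"
  shows "integrable lebesgue (\<lambda>y. p y / (1 + norm y) ^ 4)"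
proof -
  have L: "L1_loc p" using assms by (simp add: BMO_def)
  have pm: "p \<in> borel_measurable lebesgue" by (rule L1_loc_measurable[OF L])
  then obtain q where q [measurable]: "q \<in> borel_measurable lborel" and pq: "AE x in lborel. p x = q x"
    using completion_ex_borel_measurable_real by blast
  obtain C where C0: "C \<ge> 0" and C: "\<And>k. (LINT x:ball 0 (2 ^ k)|lebesgue. \<bar>p x\<bar>) \<le> C * real (Suc k) * 8 ^ k"
    using BMO_dyadic_growth[OF assms] by blast
  have "(\<integral>\<^sup>+y. ennreal \<bar>q y\<bar> * ennreal ((1 / (1 + norm (0 - y))) ^ 4) \<partial>lborel)
      \<le> ennreal (2 ^ 4 * (\<Sum>k. (C * real (Suc k) * 8 ^ k) / 2 ^ (4 * k)))"
  proof (rule nn_integral_dyadic)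
    show "summable (\<lambda>k. (C * real (Suc k) * 8 ^ k) / 2 ^ (4 * k))"
    proof -
      have "(\<lambda>k. (C * real (Suc k) * 8 ^ k) / 2 ^ (4 * k)) = (\<lambda>k. C * (real (Suc k) * (1 / 2) ^ k))"
      proof
        fix k :: nat
        have "(16 :: real) ^ k = 8 ^ k * 2 ^ k" by (simp flip: power_mult_distrib)
        then show "(C * real (Suc k) * 8 ^ k) / 2 ^ (4 * k) = C * (real (Suc k) * (1 / 2) ^ k)"
          by (simp add: power_mult power_divide)
      qed
      moreover have "summable (\<lambda>k. C * (real (Suc k) * (1 / 2) ^ k))"
        using geometric_deriv_sums[of "1 / 2 :: real"] by (intro summable_mult sums_summable) simp
      ultimately show ?thesis by simp
    qed
    fix k :: nat
    have "(\<integral>\<^sup>+y. ennreal \<bar>q y\<bar> * indicator (ball 0 (2 ^ k * 1)) y \<partial>lborel)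
        = (\<integral>\<^sup>+y. ennreal (indicator (ball 0 (2 ^ k)) y *\<^sub>R \<bar>p y\<bar>) \<partial>lebesgue)"
      unfolding nn_integral_completion using pq
      by (intro nn_integral_cong_AE) (auto elim!: eventually_mono simp: indicator_def)
    also have "\<dots> = ennreal (LINT x:ball 0 (2 ^ k)|lebesgue. \<bar>p x\<bar>)"
      unfolding set_lebesgue_integral_def
      using set_integrable_abs[OF L1_loc_ball[OF L]] 
      by (intro nn_integral_eq_integral) (auto simp: set_integrable_def)
    also have "\<dots> \<le> ennreal (C * real (Suc k) * 8 ^ k)"
      by (intro ennreal_leI C)
    finally show "(\<integral>\<^sup>+y. ennreal \<bar>q y\<bar> * indicator (ball 0 (2 ^ k * 1)) y \<partial>lborel) \<le> ennreal (C * real (Suc k) * 8 ^ k)" .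
    show "0 \<le> C * real (Suc k) * 8 ^ k" using C0 by simp
  qed simp_all
  then have fin: "(\<integral>\<^sup>+y. ennreal \<bar>q y\<bar> * ennreal ((1 / (1 + norm (0 - y))) ^ 4) \<partial>lborel) < \<infinity>"
    by (rule order_le_less_trans) simp
  show ?thesis
  proof (rule integrableI_bounded)
    have [measurable]: "(\<lambda>y :: R3. norm y) \<in> borel_measurable lebesgue"
      by (rule measurable_completion) simp
    show "(\<lambda>y. p y / (1 + norm y) ^ 4) \<in> borel_measurable lebesgue"
      using pm by measurable
    have "(\<integral>\<^sup>+y. ennreal (norm (p y / (1 + norm y) ^ 4)) \<partial>lebesgue)
      = (\<integral>\<^sup>+y. ennreal \<bar>q y\<bar> * ennreal ((1 / (1 + norm (0 - y))) ^ 4) \<partial>lborel)"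
      unfolding nn_integral_completion using pq
      by (intro nn_integral_cong_AE)
        (auto elim!: eventually_mono simp: power_divide simp flip: ennreal_mult)
    with fin show "(\<integral>\<^sup>+y. ennreal (norm (p y / (1 + norm y) ^ 4)) \<partial>lebesgue) < \<infinity>" by simp
  qed
qed

section \<open>Lebesgue points almost everywhere\<close>

definition flip :: "(3 \<Rightarrow> bool) \<Rightarrow> R3 \<Rightarrow> R3" where
  "flip s x = (\<chi> k. if s k then x $ k else - (x $ k))"

lemma flip_flip [simp]: "flip s (flip s x) = x"
  by (simp add: flip_def vec_eq_iff)

lemma orthogonal_flip: "orthogonal_transformation (flip s)"
  unfolding orthogonal_transformation_def
proof
  show "linear (flip s)"
    by (rule linearI) (simp_all add: flip_def vec_eq_iff)
  show "\<forall>v w. flip s v \<bullet> flip s w = v \<bullet> w"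
    by (auto simp: flip_def inner_vec_def intro!: sum.cong)
qed

lemma flip_measurable [measurable]: "flip s \<in> borel_measurable borel"
  using orthogonal_flip[of s] by (intro borel_measurable_continuous_onI)
    (simp add: orthogonal_transformation_def linear_continuous_on linear_conv_bounded_linear)

lemma nn_integral_flip:
  assumes "g \<in> borel_measurable borel"
  shows "(\<integral>\<^sup>+y. g (flip s y) \<partial>lborel) = (\<integral>\<^sup>+y. g y \<partial>lborel)"
proof -
  have "(\<integral>\<^sup>+y. g (flip s y) \<partial>lborel) = (\<integral>\<^sup>+y. g y \<partial>distr lborel borel (flip s))"
    using assms by (subst nn_integral_distr) auto
  then show ?thesis by (simp add: lborel_distr_orthogonal[OF orthogonal_flip])
qed

text \<open>The nonnegative integral needs no integrability side condition, and r^3 stands for the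
  volume of the ball up to a constant; this is the form that the dyadic estimate consumes.\<close>

definition lebesgue_point :: "(R3 \<Rightarrow> real) \<Rightarrow> R3 \<Rightarrow> bool" where
  "lebesgue_point q a \<longleftrightarrow> (\<forall>\<kappa>>0. \<exists>d>0. \<forall>r. 0 < r \<and> r < d \<longrightarrow>
    (\<integral>\<^sup>+y. ennreal \<bar>q y - q a\<bar> * indicator (ball a r) y \<partial>lborel) \<le> ennreal (\<kappa> * r ^ 3))"

text \<open>Bridge between the gauge integral of the reflected function, in which the
  differentiation theorem speaks, and the nonnegative integral of the original function over the
  reflected cube.\<close>

lemma nn_integral_cube:
  assumes q [measurable]: "q \<in> borel_measurable borel"
    and int: "\<And>S. compact S \<Longrightarrow> set_integrable lborel S q"
  shows "(\<lambda>y. \<bar>q (flip s y) - c\<bar>) integrable_on cbox u v"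
    and "(\<integral>\<^sup>+y. ennreal \<bar>q y - c\<bar> * indicator (cbox u v) (flip s y) \<partial>lborel)
      = ennreal (integral (cbox u v) (\<lambda>y. \<bar>q (flip s y) - c\<bar>))"
proof -
  let ?S = "flip s ` cbox u v"
  have "compact ?S"
    using orthogonal_flip[of s]
    by (intro compact_continuous_image linear_continuous_on)
      (auto simp: orthogonal_transformation_def linear_conv_bounded_linear)
  have vim: "flip s y \<in> cbox u v \<longleftrightarrow> y \<in> ?S" for y
    by (metis flip_flip image_iff)
  have ind: "indicator (cbox u v) (flip s y) = (indicator ?S y :: 'a :: zero_neq_one)" for y
    by (simp add: indicator_def vim)
  have "emeasure lborel ?S < \<infinity>" by (rule emeasure_compact_finite[OF \<open>compact ?S\<close>])
  then have "set_integrable lborel ?S (\<lambda>y. c)"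
    unfolding set_integrable_def using \<open>compact ?S\<close>
    by (intro integrable_scaleR_left) (auto simp: integrable_indicator_iff compact_imp_closed)
  then have "set_integrable lborel ?S (\<lambda>y. \<bar>q y - c\<bar>)"
    using int[OF \<open>compact ?S\<close>] by (intro set_integrable_abs set_integral_diff(1))
  then have 1: "integrable lborel (\<lambda>y. indicator (cbox u v) (flip s y) *\<^sub>R \<bar>q y - c\<bar>)"
    by (simp add: set_integrable_def ind)
  then have "integrable (distr lborel borel (flip s)) (\<lambda>y. indicator (cbox u v) (flip s y) *\<^sub>R \<bar>q y - c\<bar>)"
    by (simp add: lborel_distr_orthogonal[OF orthogonal_flip])
  then have 2: "integrable lborel (\<lambda>y. indicator (cbox u v) y *\<^sub>R \<bar>q (flip s y) - c\<bar>)"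
    by (subst (asm) integrable_distr_eq) auto
  then have S: "set_integrable lborel (cbox u v) (\<lambda>y. \<bar>q (flip s y) - c\<bar>)"
    by (simp add: set_integrable_def)
  show "(\<lambda>y. \<bar>q (flip s y) - c\<bar>) integrable_on cbox u v"
    by (rule set_borel_integral_eq_integral(1)[OF S])
  have "(\<integral>\<^sup>+y. ennreal \<bar>q y - c\<bar> * indicator (cbox u v) (flip s y) \<partial>lborel)
      = (\<integral>\<^sup>+y. ennreal \<bar>q (flip s y) - c\<bar> * indicator (cbox u v) (flip s (flip s y)) \<partial>lborel)"
    by (rule nn_integral_flip[symmetric]) measurable
  also have "\<dots> = (\<integral>\<^sup>+y. ennreal (indicator (cbox u v) y *\<^sub>R \<bar>q (flip s y) - c\<bar>) \<partial>lborel)"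
    by (intro nn_integral_cong) (simp add: indicator_def)
  also have "\<dots> = ennreal (LINT y:cbox u v|lborel. \<bar>q (flip s y) - c\<bar>)"
    unfolding set_lebesgue_integral_def by (intro nn_integral_eq_integral 2) auto
  also have "\<dots> = ennreal (integral (cbox u v) (\<lambda>y. \<bar>q (flip s y) - c\<bar>))"
    by (simp add: set_borel_integral_eq_integral(2)[OF S])
  finally show "(\<integral>\<^sup>+y. ennreal \<bar>q y - c\<bar> * indicator (cbox u v) (flip s y) \<partial>lborel)
      = ennreal (integral (cbox u v) (\<lambda>y. \<bar>q (flip s y) - c\<bar>))" .
qed

lemma sum_Basis_nth: "(\<Sum>b\<in>Basis. (b :: R3) $ i) = 1"
  using inner_sum_left_Basis[of "axis i 1 :: R3" "\<lambda>_. 1"] by (simp add: inner_axis)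

text \<open>The differentiation theorem of the library averages over cubes with one corner at the point;
  reflecting the coordinates gives all orthants, and comparing with rational constants turns
  convergence of averages into the Lebesgue point property.\<close>

lemma AE_lebesgue_point:
  assumes q [measurable]: "q \<in> borel_measurable borel"
    and int: "\<And>S. compact S \<Longrightarrow> set_integrable lborel S q"
  shows "AE a in lborel. lebesgue_point q a"
proof -
  define P where "P c s x \<longleftrightarrow> (\<forall>e>0. \<exists>d>0. \<forall>h. 0 < h \<and> h < d \<longrightarrow>
    norm (integral (cbox x (x + h *\<^sub>R One)) (\<lambda>y. \<bar>q (flip s y) - real_of_rat c\<bar>) /\<^sub>R h ^ DIM(R3)
      - \<bar>q (flip s x) - real_of_rat c\<bar>) < e)" for c s x
  have "\<exists>N. negligible N \<and> (\<forall>x. x \<notin> N \<longrightarrow> P c s x)" for c s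
  proof -
    have "\<And>u v. (\<lambda>y. \<bar>q (flip s y) - real_of_rat c\<bar>) integrable_on cbox u v"
      by (rule nn_integral_cube(1)[OF q int])
    from integrable_ccontinuous_explicit[OF this] obtain N where "negligible N"
      "\<And>x e. x \<notin> N \<Longrightarrow> 0 < e \<Longrightarrow> \<exists>d>0. \<forall>h. 0 < h \<and> h < d \<longrightarrow>
        norm (integral (cbox x (x + h *\<^sub>R One)) (\<lambda>y. \<bar>q (flip s y) - real_of_rat c\<bar>) /\<^sub>R h ^ DIM(R3)
        - \<bar>q (flip s x) - real_of_rat c\<bar>) < e" by metis
    then show ?thesis unfolding P_def by metis
  qed
  then obtain N where N: "\<And>c s. negligible (N c s)" "\<And>c s x. x \<notin> N c s \<Longrightarrow> P c s x"
    by metis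
  \<comment> \<open>The sets \<open>N c s\<close> live in reflected coordinates;
    \<open>flip s\<close> is its own inverse, so its image consists of the bad points themselves.
    The union is countable because the constants c are rational.\<close>
  define Z where "Z = (\<Union>(c, s)\<in>UNIV. flip s ` N c s)"
  have "negligible Z"
    unfolding Z_def
  proof (rule negligible_countable_Union)
    show "countable ((\<lambda>(c, s). flip s ` N c s) ` UNIV)"
      by (rule countable_image) simp
    fix T assume "T \<in> (\<lambda>(c, s). flip s ` N c s) ` UNIV"
    then obtain c s where T: "T = flip s ` N c s" by auto
    have "linear (flip s)" using orthogonal_flip by (auto simp: orthogonal_transformation_def)
    then show "negligible T"
      unfolding T
      by (intro negligible_differentiable_image_negligible N linear_imp_differentiable_on) auto
  qed
  then have "AE a in lborel. a \<notin> Z"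
    using AE_not_in[of Z lebesgue] by (simp add: negligible_iff_null_sets AE_completion_iff)
  then show ?thesis
  proof eventually_elim
    case (elim a)
    show "lebesgue_point q a"
      unfolding lebesgue_point_def
    proof (intro allI impI)
      fix \<kappa> :: real assume "\<kappa> > 0"
      define m where "m = real (card (UNIV :: (3 \<Rightarrow> bool) set))"
      have "m \<ge> 0" by (simp add: m_def)
      \<comment> \<open>The budget: each of the m orthant cubes contributes 2 \<delta> r^3, and
        replacing q(a) by the rational constant costs \<delta> times the ball volume, at most 6
        \<delta> r^3.\<close>
      define \<delta> where "\<delta> = \<kappa> / (2 * m + 6)"
      have \<delta>: "\<delta> > 0" "(2 * m + 6) * \<delta> = \<kappa>" using \<open>\<kappa> > 0\<close> \<open>m \<ge> 0\<close> by (auto simp: \<delta>_def)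
      obtain c0 where c0: "c0 \<in> \<rat>" "q a - \<delta> < c0" "c0 < q a + \<delta>"
        using Rats_dense_in_real[of "q a - \<delta>" "q a + \<delta>"] \<delta> by auto
      then obtain c where c: "c0 = real_of_rat c" by (auto elim: Rats_cases)
      have close: "\<bar>q a - real_of_rat c\<bar> \<le> \<delta>" using c0 c by linarith
      have "\<exists>d>0. \<forall>h. 0 < h \<and> h < d \<longrightarrow>
          integral (cbox (flip s a) (flip s a + h *\<^sub>R One)) (\<lambda>y. \<bar>q (flip s y) - real_of_rat c\<bar>) \<le> 2 * \<delta> * h ^ 3" for s
      proof -
        have "flip s a \<notin> N c s"
        proof
          assume "flip s a \<in> N c s"
          then have "flip s (flip s a) \<in> flip s ` N c s" by blast
          then show False using elim by (auto simp: Z_def)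
        qed
        from N(2)[OF this, unfolded P_def, rule_format, OF \<delta>(1)] obtain d where d: "d > 0"
          "\<forall>h. 0 < h \<and> h < d \<longrightarrow>
            norm (integral (cbox (flip s a) (flip s a + h *\<^sub>R One)) (\<lambda>y. \<bar>q (flip s y) - real_of_rat c\<bar>) /\<^sub>R h ^ DIM(R3)
            - \<bar>q (flip s (flip s a)) - real_of_rat c\<bar>) < \<delta>" by (elim exE conjE)
        have "integral (cbox (flip s a) (flip s a + h *\<^sub>R One)) (\<lambda>y. \<bar>q (flip s y) - real_of_rat c\<bar>) \<le> 2 * \<delta> * h ^ 3"
          if "0 < h" "h < d" for h
        proof -
          \<comment> \<open>The cube average is within \<delta> of |q(a) - c|, which is itself at
            most \<delta>; hence the factor 2.\<close>
          have aux: "J \<le> 2 * \<delta> * h ^ 3" if "norm (J /\<^sub>R h ^ DIM(R3) - b) < \<delta>" "b \<le> \<delta>" for J b :: real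
          proof -
            have "\<bar>J / h ^ 3 - b\<bar> < \<delta>" using that(1) by (simp add: divide_inverse mult.commute)
            then have "J / h ^ 3 \<le> 2 * \<delta>" using that(2) by linarith
            then show ?thesis using \<open>0 < h\<close> by (simp add: divide_le_eq)
          qed
          show ?thesis
            by (rule aux[OF d(2)[rule_format, OF conjI[OF that]]]) (use close in \<open>simp only: flip_flip\<close>)
        qed
        with d(1) show ?thesis by blast
      qed
      then obtain d where d: "\<And>s. d s > 0" "\<And>s h. 0 < h \<Longrightarrow> h < d s \<Longrightarrow>
          integral (cbox (flip s a) (flip s a + h *\<^sub>R One)) (\<lambda>y. \<bar>q (flip s y) - real_of_rat c\<bar>) \<le> 2 * \<delta> * h ^ 3"
        by metis
      define d0 where "d0 = Min (range d)"
      have d0: "d0 > 0" "\<And>s. d0 \<le> d s" using d(1) by (auto simp: d0_def)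
      show "\<exists>d>0. \<forall>r. 0 < r \<and> r < d \<longrightarrow>
          (\<integral>\<^sup>+y. ennreal \<bar>q y - q a\<bar> * indicator (ball a r) y \<partial>lborel) \<le> ennreal (\<kappa> * r ^ 3)"
      proof (intro exI[of _ d0] conjI allI impI)
        fix r assume r: "0 < r \<and> r < d0"
        let ?C = "\<lambda>s. cbox (flip s a) (flip s a + r *\<^sub>R One)"
        have pt: "ennreal \<bar>q y - q a\<bar> * indicator (ball a r) y
            \<le> (\<Sum>s\<in>UNIV. ennreal \<bar>q y - real_of_rat c\<bar> * indicator (?C s) (flip s y)) + ennreal \<delta> * indicator (ball a r) y" for y
        proof (cases "y \<in> ball a r")
          case True
          \<comment> \<open>\<open>s\<close> records the orthant at \<open>a\<close> that contains
            y; reflecting accordingly moves y into the cube whose lower corner is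
            \<open>flip s a\<close>.\<close>
          define s where "s k \<longleftrightarrow> y $ k \<ge> a $ k" for k
          have "\<bar>y $ k - a $ k\<bar> \<le> r" for k
            using component_le_norm_cart[of "y - a" k] True by (simp add: dist_norm norm_minus_commute)
          then have "flip s y \<in> ?C s"
            by (auto simp: mem_box_cart flip_def s_def abs_le_iff not_le sum_Basis_nth algebra_simps)
          then have "ennreal \<bar>q y - real_of_rat c\<bar> = ennreal \<bar>q y - real_of_rat c\<bar> * indicator (?C s) (flip s y)"
            by simp
          also have "\<dots> \<le> (\<Sum>s\<in>UNIV. ennreal \<bar>q y - real_of_rat c\<bar> * indicator (?C s) (flip s y))"
            by (rule member_le_sum) auto
          finally have 1: "ennreal \<bar>q y - real_of_rat c\<bar> \<le> (\<Sum>s\<in>UNIV. ennreal \<bar>q y - real_of_rat c\<bar> * indicator (?C s) (flip s y))" .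
          have "ennreal \<bar>q y - q a\<bar> \<le> ennreal (\<bar>q y - real_of_rat c\<bar> + \<delta>)"
            using close by (intro ennreal_leI) linarith
          also have "\<dots> = ennreal \<bar>q y - real_of_rat c\<bar> + ennreal \<delta>"
            using \<delta> by (intro ennreal_plus) auto
          finally show ?thesis using 1 True
            by (simp add: add_mono order_trans[OF _ add_right_mono])
        qed simp
        have [measurable]: "(\<lambda>y. ennreal \<bar>q y - real_of_rat c\<bar> * indicator (?C s) (flip s y)) \<in> borel_measurable lborel" for s
          by measurable
        have "(\<integral>\<^sup>+y. ennreal \<bar>q y - q a\<bar> * indicator (ball a r) y \<partial>lborel)
          \<le> (\<integral>\<^sup>+y. (\<Sum>s\<in>UNIV. ennreal \<bar>q y - real_of_rat c\<bar> * indicator (?C s) (flip s y)) + ennreal \<delta> * indicator (ball a r) y \<partial>lborel)"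
          by (intro nn_integral_mono pt)
        also have "\<dots> = (\<integral>\<^sup>+y. (\<Sum>s\<in>UNIV. ennreal \<bar>q y - real_of_rat c\<bar> * indicator (?C s) (flip s y)) \<partial>lborel)
            + (\<integral>\<^sup>+y. ennreal \<delta> * indicator (ball a r) y \<partial>lborel)"
          by (rule nn_integral_add) measurable
        also have "(\<integral>\<^sup>+y. (\<Sum>s\<in>UNIV. ennreal \<bar>q y - real_of_rat c\<bar> * indicator (?C s) (flip s y)) \<partial>lborel)
            = (\<Sum>s\<in>UNIV. \<integral>\<^sup>+y. ennreal \<bar>q y - real_of_rat c\<bar> * indicator (?C s) (flip s y) \<partial>lborel)"
          by (rule nn_integral_sum) measurable
        also have "\<dots> \<le> (\<Sum>s\<in>(UNIV :: (3 \<Rightarrow> bool) set). ennreal (2 * \<delta> * r ^ 3))"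
        proof (rule sum_mono)
          fix s :: "3 \<Rightarrow> bool"
          have "r < d s" using r d0(2)[of s] by linarith
          then show "(\<integral>\<^sup>+y. ennreal \<bar>q y - real_of_rat c\<bar> * indicator (?C s) (flip s y) \<partial>lborel) \<le> ennreal (2 * \<delta> * r ^ 3)"
            using r by (subst nn_integral_cube(2)[OF q]) (auto intro!: int ennreal_leI d(2))
        qed
        also have "\<dots> = ennreal (m * (2 * \<delta> * r ^ 3))"
          using \<delta> r by (simp add: m_def ennreal_mult' flip: ennreal_of_nat_eq_real_of_nat)
        also have "(\<integral>\<^sup>+y. ennreal \<delta> * indicator (ball a r) y \<partial>lborel) = ennreal (\<delta> * (4 / 3 * pi * r ^ 3))"
          using \<delta> r by (simp add: nn_integral_cmult_indicator emeasure_ball_R3 flip: ennreal_mult)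
        also have "\<dots> \<le> ennreal (6 * \<delta> * r ^ 3)"
        proof (rule ennreal_leI)
          have "4 / 3 * pi \<le> 6" using pi_less_4 by simp
          from mult_right_mono[OF this, of "\<delta> * r ^ 3"] show "\<delta> * (4 / 3 * pi * r ^ 3) \<le> 6 * \<delta> * r ^ 3"
            using \<delta> r by (simp add: mult_ac)
        qed
        also have "ennreal (m * (2 * \<delta> * r ^ 3)) + ennreal (6 * \<delta> * r ^ 3) = ennreal (((2 * m + 6) * \<delta>) * r ^ 3)"
          using \<delta>(1) r \<open>m \<ge> 0\<close> by (simp add: algebra_simps flip: ennreal_plus)
        finally show "(\<integral>\<^sup>+y. ennreal \<bar>q y - q a\<bar> * indicator (ball a r) y \<partial>lborel) \<le> ennreal (\<kappa> * r ^ 3)"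
          by (simp add: \<delta>(2) add_left_mono)
      qed (rule d0)
    qed
  qed
qed

subsection \<open>The approximate identity\<close>

text \<open>From (e + t)^2 \<le> 4 (t^2 + e^2). The quotient form matches the weight of the dyadic
  estimate.\<close>

lemma wt_le_quotient:
  assumes "e > 0"
  shows "wt e z \<le> 2 / (e + norm z)"
proof -
  have "(e + t) ^ 2 \<le> 4 * (t ^ 2 + e ^ 2)" for t
    using sum_squares_bound[of e t] zero_le_power2[of e] zero_le_power2[of t]
    unfolding power2_sum distrib_left by linarith
  then have "(e + norm z) ^ 2 \<le> 4 * (norm z ^ 2 + e ^ 2)" .
  then have "sqrt ((e + norm z) ^ 2) \<le> sqrt (4 * (norm z ^ 2 + e ^ 2))"
    by (rule real_sqrt_le_mono)
  then have "e + norm z \<le> 2 * sqrt (norm z ^ 2 + e ^ 2)"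
    using assms by (simp only: real_sqrt_mult) (simp add: add_pos_nonneg less_imp_le)
  moreover have "sqrt (norm z ^ 2 + e ^ 2) > 0" using assms by (simp add: add_nonneg_pos)
  moreover have "e + norm z > 0" using assms by (simp add: add_pos_nonneg)
  ultimately show ?thesis by (simp add: wt_def divide_simps mult.commute)
qed

text \<open>\<open>K\<close> is chosen so that 1 + |y| \<le> K (e + |a - y|). Four of the five
  factors \<open>wt\<close> then supply the weight (1 + |y|)^(-4), and the fifth is bounded by 1 /
  e.\<close>

lemma integrable_weighted_wt5:
  assumes q [measurable]: "q \<in> borel_measurable borel" and e: "e > 0"
    and int: "integrable lborel (\<lambda>y. q y / (1 + norm y) ^ 4)"
  shows "integrable lborel (\<lambda>y. q y * wt e (a - y) ^ 5)"
proof -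
  define K where "K = (1 + norm a) / e + 1"
  have K: "K > 0" using e by (simp add: K_def add_nonneg_pos)
  have bound: "wt e (a - y) ^ 5 \<le> (1 / e) * (2 * K) ^ 4 * (1 / (1 + norm y) ^ 4)" for y
  proof -
    have t: "1 + norm y > 0" by (simp add: add_pos_nonneg)
    have s: "e + norm (a - y) > 0" using e by (simp add: add_pos_nonneg)
    have "norm y \<le> norm a + norm (a - y)" using norm_triangle_ineq4[of a "a - y"] by simp
    moreover have "norm (a - y) \<le> K * norm (a - y)"
      using e by (simp add: K_def distrib_right)
    moreover have "K * e = 1 + norm a + e" using e by (simp add: K_def field_simps)
    ultimately have "1 + norm y \<le> K * (e + norm (a - y))"
      using e by (simp add: distrib_left)
    then have "1 / (e + norm (a - y)) \<le> K / (1 + norm y)"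
      using t s by (simp add: divide_simps mult.commute)
    then have "wt e (a - y) \<le> 2 * K / (1 + norm y)"
      using wt_le_quotient[OF e, of "a - y"] by simp
    then have "wt e (a - y) ^ 4 \<le> (2 * K / (1 + norm y)) ^ 4"
      by (rule power_mono) simp
    then have "wt e (a - y) * wt e (a - y) ^ 4 \<le> (1 / e) * (2 * K / (1 + norm y)) ^ 4"
      using e by (intro mult_mono wt_le') auto
    then show ?thesis by (simp add: power_divide flip: power_Suc)
  qed
  show ?thesis
  proof (rule Bochner_Integration.integrable_bound)
    show "integrable lborel (\<lambda>y. ((1 / e) * (2 * K) ^ 4) * (q y / (1 + norm y) ^ 4))"
      by (intro integrable_mult_right int)
    have "norm (q y * wt e (a - y) ^ 5) \<le> norm (((1 / e) * (2 * K) ^ 4) * (q y / (1 + norm y) ^ 4))" for y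
      using mult_left_mono[OF bound[of y], of "\<bar>q y\<bar>"] e K
      by (simp add: abs_mult mult_ac add_pos_nonneg)
    then show "AE y in lborel. norm (q y * wt e (a - y) ^ 5) \<le> norm (((1 / e) * (2 * K) ^ 4) * (q y / (1 + norm y) ^ 4))"
      by simp
  qed measurable
qed

text \<open>Below some scale d the Lebesgue point property gives \<kappa> r^3. For r \<ge> d every y
  in the ball satisfies 1 + |y| \<le> T with T proportional to r, so weighted integrability bounds
  the mass by a multiple of r^4. Such a term is harmless later, where it carries an extra factor
  e.\<close>

lemma lebesgue_point_growth:
  assumes q [measurable]: "q \<in> borel_measurable borel"
    and int: "integrable lborel (\<lambda>y. q y / (1 + norm y) ^ 4)"
    and pt: "lebesgue_point q a" and \<kappa>: "\<kappa> > 0"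
  shows "\<exists>C\<ge>0. \<forall>r>0. (\<integral>\<^sup>+y. ennreal \<bar>q y - q a\<bar> * indicator (ball a r) y \<partial>lborel) \<le> ennreal (\<kappa> * r ^ 3 + C * r ^ 4)"
proof -
  obtain d where d: "d > 0" "\<forall>r. 0 < r \<and> r < d \<longrightarrow>
      (\<integral>\<^sup>+y. ennreal \<bar>q y - q a\<bar> * indicator (ball a r) y \<partial>lborel) \<le> ennreal (\<kappa> * r ^ 3)"
    using pt[unfolded lebesgue_point_def, rule_format, OF \<kappa>] by (elim exE conjE)
  have I: "integrable lborel (\<lambda>y. \<bar>q y - q a\<bar> * (1 / (1 + norm y) ^ 4))"
  proof -
    have "integrable lborel (\<lambda>y. \<bar>q y / (1 + norm y) ^ 4 - q a * (1 / (1 + norm y) ^ 4)\<bar>)"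
      by (intro integrable_abs Bochner_Integration.integrable_diff int integrable_mult_right integrable_decay) simp
    moreover have "\<bar>q y / (1 + norm y) ^ 4 - q a * (1 / (1 + norm y) ^ 4)\<bar> = \<bar>q y - q a\<bar> * (1 / (1 + norm y) ^ 4)" for y
      by (simp add: abs_mult add_pos_nonneg flip: diff_divide_distrib)
    ultimately show ?thesis by simp
  qed
  define W where "W = (\<integral>y. \<bar>q y - q a\<bar> * (1 / (1 + norm y) ^ 4) \<partial>lborel)"
  have W: "W \<ge> 0" unfolding W_def by (intro integral_nonneg_AE) simp
  define C where "C = (1 + (1 + norm a) / d) ^ 4 * W"
  have "(\<integral>\<^sup>+y. ennreal \<bar>q y - q a\<bar> * indicator (ball a r) y \<partial>lborel) \<le> ennreal (\<kappa> * r ^ 3 + C * r ^ 4)" if r: "r > 0" for r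
  proof (cases "r < d")
    case True
    have "(\<integral>\<^sup>+y. ennreal \<bar>q y - q a\<bar> * indicator (ball a r) y \<partial>lborel) \<le> ennreal (\<kappa> * r ^ 3)"
      by (rule d(2)[rule_format, OF conjI[OF r True]])
    also have "\<dots> \<le> ennreal (\<kappa> * r ^ 3 + C * r ^ 4)"
      using r W d(1) by (intro ennreal_leI) (simp add: C_def)
    finally show ?thesis .
  next
    case False
    define T where "T = (1 + (1 + norm a) / d) * r"
    have T0: "T > 0" using r d(1) by (simp add: T_def add_pos_nonneg)
    have T: "1 + norm a + r \<le> T"
    proof -
      have "1 + norm a \<le> (1 + norm a) / d * r"
        using False d(1) by (simp add: divide_simps mult_left_mono)
      then show ?thesis by (simp add: T_def distrib_right)
    qed
    have "(\<integral>\<^sup>+y. ennreal \<bar>q y - q a\<bar> * indicator (ball a r) y \<partial>lborel)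
      \<le> (\<integral>\<^sup>+y. ennreal (T ^ 4) * ennreal (\<bar>q y - q a\<bar> * (1 / (1 + norm y) ^ 4)) \<partial>lborel)"
    proof (rule nn_integral_mono)
      fix y
      show "ennreal \<bar>q y - q a\<bar> * indicator (ball a r) y \<le> ennreal (T ^ 4) * ennreal (\<bar>q y - q a\<bar> * (1 / (1 + norm y) ^ 4))"
      proof (cases "y \<in> ball a r")
        case True
        have "norm y \<le> norm a + norm (a - y)" using norm_triangle_ineq4[of a "a - y"] by simp
        then have "1 + norm y \<le> T" using True T by (simp add: dist_norm)
        then have "1 \<le> T ^ 4 * (1 / (1 + norm y) ^ 4)"
          using power_mono[of "1 + norm y" T 4] zero_less_power[of "1 + norm y" 4]
          by (simp add: le_divide_eq add_pos_nonneg)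
        from mult_left_mono[OF this, of "\<bar>q y - q a\<bar>"] show ?thesis
          using True T0 by (simp add: ennreal_leI mult_ac flip: ennreal_mult)
      qed simp
    qed
    also have "\<dots> = ennreal (T ^ 4) * ennreal W"
      unfolding W_def by (subst nn_integral_cmult, measurable, subst nn_integral_eq_integral[OF I]) simp_all
    also have "\<dots> = ennreal (C * r ^ 4)"
      using T0 W by (simp add: C_def T_def power_mult_distrib mult_ac flip: ennreal_mult)
    also have "\<dots> \<le> ennreal (\<kappa> * r ^ 3 + C * r ^ 4)"
      using r \<kappa> by (intro ennreal_leI) simp
    finally show ?thesis .
  qed
  moreover have "C \<ge> 0" using W by (simp add: C_def)
  ultimately show ?thesis by blast
qed

text \<open>Normalisation by the exact mass reduces the claim to the integral of q(y) - q(a). The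
  kernel is at most 96 e^(-3) times the fifth power of e / (e + |a - y|); the exponent 5 makes both
  the r^3 and the r^4 part of the growth bound summable over dyadic balls.\<close>

lemma approximate_identity:
  assumes q [measurable]: "q \<in> borel_measurable borel"
    and int: "integrable lborel (\<lambda>y. q y / (1 + norm y) ^ 4)"
    and pt: "lebesgue_point q a"
  shows "(\<lambda>n. \<integral>y. q y * (3 * eps n ^ 2 * wt (eps n) (a - y) ^ 5) \<partial>lborel) \<longlonglongrightarrow> 4 * pi * q a"
proof -
  let ?X = "\<lambda>n. \<integral>y. q y * (3 * eps n ^ 2 * wt (eps n) (a - y) ^ 5) \<partial>lborel"
  let ?k = "\<lambda>n y. 3 * eps n ^ 2 * wt (eps n) (a - y) ^ 5"
  have Iq: "integrable lborel (\<lambda>y. q y * ?k n y)" for n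
    using integrable_mult_right[OF integrable_weighted_wt5[OF q eps_pos int], of "3 * eps n ^ 2" n a]
    by (simp add: mult_ac)
  have Ik: "integrable lborel (?k n)" for n
    by (intro integrable_mult_right integral_wt5) simp
  have diff: "?X n - 4 * pi * q a = (\<integral>y. (q y - q a) * ?k n y \<partial>lborel)" for n
  proof -
    have "(\<integral>y. (q y - q a) * ?k n y \<partial>lborel) = (\<integral>y. q y * ?k n y - q a * ?k n y \<partial>lborel)"
      by (simp add: left_diff_distrib)
    also have "\<dots> = ?X n - (\<integral>y. q a * ?k n y \<partial>lborel)"
      by (intro Bochner_Integration.integral_diff Iq integrable_mult_right Ik)
    also have "(\<integral>y. q a * ?k n y \<partial>lborel) = q a * (4 * pi)"
      by (subst integral_mult_right_zero) (simp only: integral_wt5(2)[OF eps_pos])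
    finally show ?thesis by simp
  qed
  have est: "\<exists>C. \<forall>n. \<bar>?X n - 4 * pi * q a\<bar> \<le> 4096 * \<kappa> + C * eps n" if \<kappa>: "\<kappa> > 0" for \<kappa>
  proof -
    obtain C where C0: "C \<ge> 0" and C: "\<And>r. r > 0 \<Longrightarrow>
        (\<integral>\<^sup>+y. ennreal \<bar>q y - q a\<bar> * indicator (ball a r) y \<partial>lborel) \<le> ennreal (\<kappa> * r ^ 3 + C * r ^ 4)"
      using lebesgue_point_growth[OF q int pt \<kappa>] by blast
    have "\<bar>?X n - 4 * pi * q a\<bar> \<le> 4096 * \<kappa> + 6144 * C * eps n" for n
    proof -
      let ?e = "eps n"
      let ?B = "\<lambda>k. \<kappa> * (2 ^ k * ?e) ^ 3 + C * (2 ^ k * ?e) ^ 4"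
      have B: "?B k / 2 ^ (5 * k) = \<kappa> * ?e ^ 3 * (1 / 4) ^ k + C * ?e ^ 4 * (1 / 2) ^ k" for k
      proof -
        have a: "(2::real) ^ (5 * k) = (2 ^ k) ^ 3 * 4 ^ k" 
        proof -
          have "(4::real) ^ k = (2 ^ k) ^ 2" by (simp add: power2_eq_square flip: power_mult_distrib)
          then show ?thesis by (simp add: mult.commute flip: power_mult power_add)
        qed
        have b: "(2::real) ^ (5 * k) = (2 ^ k) ^ 4 * 2 ^ k"
          by (simp add: mult.commute flip: power_mult power_add)
        have "\<kappa> * (2 ^ k * ?e) ^ 3 / 2 ^ (5 * k) = \<kappa> * ?e ^ 3 * (1 / 4) ^ k"
          unfolding a by (simp add: power_mult_distrib power_divide)
        moreover have "C * (2 ^ k * ?e) ^ 4 / 2 ^ (5 * k) = C * ?e ^ 4 * (1 / 2) ^ k"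
          unfolding b by (simp add: power_mult_distrib power_divide)
        ultimately show ?thesis by (simp add: add_divide_distrib)
      qed
      have sums: "(\<lambda>k. ?B k / 2 ^ (5 * k)) sums (\<kappa> * ?e ^ 3 * (4 / 3) + C * ?e ^ 4 * 2)"
        unfolding B using geometric_sums[of "1 / 4 :: real"] geometric_sums[of "1 / 2 :: real"]
        by (intro sums_add sums_mult) simp_all
      have "(\<integral>\<^sup>+y. ennreal \<bar>q y - q a\<bar> * ennreal ((?e / (?e + norm (a - y))) ^ 5) \<partial>lborel)
         \<le> ennreal (2 ^ 5 * (\<Sum>k. ?B k / 2 ^ (5 * k)))"
      proof (rule nn_integral_dyadic)
        show "(\<integral>\<^sup>+y. ennreal \<bar>q y - q a\<bar> * indicator (ball a (2 ^ k * ?e)) y \<partial>lborel) \<le> ennreal (?B k)" for k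
          by (rule C) simp
        show "0 \<le> ?B k" for k using C0 \<kappa> by (simp add: less_imp_le)
        show "summable (\<lambda>k. ?B k / 2 ^ (5 * k))" by (rule sums_summable[OF sums])
      qed auto
      also have "(\<Sum>k. ?B k / 2 ^ (5 * k)) = \<kappa> * ?e ^ 3 * (4 / 3) + C * ?e ^ 4 * 2"
        by (rule sums_unique[OF sums, symmetric])
      finally have dy: "(\<integral>\<^sup>+y. ennreal \<bar>q y - q a\<bar> * ennreal ((?e / (?e + norm (a - y))) ^ 5) \<partial>lborel)
         \<le> ennreal (2 ^ 5 * (\<kappa> * ?e ^ 3 * (4 / 3) + C * ?e ^ 4 * 2))" .
      have kb: "?k n y \<le> 96 / ?e ^ 3 * (?e / (?e + norm (a - y))) ^ 5" for y
      proof -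
        have "wt ?e (a - y) ^ 5 \<le> (2 / (?e + norm (a - y))) ^ 5"
          by (intro power_mono wt_le_quotient) auto
        then have "?k n y \<le> 3 * ?e ^ 2 * (2 / (?e + norm (a - y))) ^ 5"
          by (intro mult_left_mono) auto
        also have "\<dots> = 96 / ?e ^ 3 * (?e / (?e + norm (a - y))) ^ 5"
        proof -
          have "?e ^ 2 = ?e ^ 5 / ?e ^ 3"
            using power_diff[of ?e 3 5] less_imp_neq[OF eps_pos[of n]] by simp
          then show ?thesis by (simp only:) (simp add: power_divide)
        qed
        finally show ?thesis .
      qed
      have "ennreal \<bar>?X n - 4 * pi * q a\<bar> \<le> (\<integral>\<^sup>+y. ennreal (norm ((q y - q a) * ?k n y)) \<partial>lborel)"
        unfolding diff real_norm_def[symmetric] by (rule integral_norm_bound_ennreal)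
          (use Bochner_Integration.integrable_diff[OF Iq[of n] integrable_mult_right[OF Ik[of n], of "q a"]]
            in \<open>simp add: left_diff_distrib\<close>)
      also have "\<dots> \<le> (\<integral>\<^sup>+y. ennreal (96 / ?e ^ 3) * (ennreal \<bar>q y - q a\<bar> * ennreal ((?e / (?e + norm (a - y))) ^ 5)) \<partial>lborel)"
      proof (rule nn_integral_mono)
        fix y
        have "norm ((q y - q a) * ?k n y) = \<bar>q y - q a\<bar> * ?k n y"
          by (simp add: abs_mult)
        also have "\<dots> \<le> \<bar>q y - q a\<bar> * (96 / ?e ^ 3 * (?e / (?e + norm (a - y))) ^ 5)"
          by (rule mult_left_mono[OF kb]) simp
        also have "\<dots> = 96 / ?e ^ 3 * (\<bar>q y - q a\<bar> * (?e / (?e + norm (a - y))) ^ 5)" by (simp add: mult_ac)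
        finally show "ennreal (norm ((q y - q a) * ?k n y))
           \<le> ennreal (96 / ?e ^ 3) * (ennreal \<bar>q y - q a\<bar> * ennreal ((?e / (?e + norm (a - y))) ^ 5))"
          by (simp add: ennreal_leI less_imp_le add_pos_nonneg flip: ennreal_mult)
      qed
      also have "\<dots> = ennreal (96 / ?e ^ 3) * (\<integral>\<^sup>+y. ennreal \<bar>q y - q a\<bar> * ennreal ((?e / (?e + norm (a - y))) ^ 5) \<partial>lborel)"
        by (rule nn_integral_cmult) measurable
      also have "\<dots> \<le> ennreal (96 / ?e ^ 3) * ennreal (2 ^ 5 * (\<kappa> * ?e ^ 3 * (4 / 3) + C * ?e ^ 4 * 2))"
        by (rule mult_left_mono[OF dy]) simp
      also have "\<dots> = ennreal (96 / ?e ^ 3 * (2 ^ 5 * (\<kappa> * ?e ^ 3 * (4 / 3) + C * ?e ^ 4 * 2)))"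
        using \<kappa> C0 by (intro ennreal_mult[symmetric]) (auto simp: less_imp_le)
      \<comment> \<open>4096 = 96 * 32 * 4/3 and 6144 = 96 * 32 * 2, with 32 = 2^5 from the dyadic
        estimate and 4/3, 2 the sums of the geometric series of ratio 1/4 and 1/2.\<close>
      also have "96 / ?e ^ 3 * (2 ^ 5 * (\<kappa> * ?e ^ 3 * (4 / 3) + C * ?e ^ 4 * 2)) = 4096 * \<kappa> + 6144 * C * ?e"
        using less_imp_neq[OF eps_pos[of n]] by (simp add: field_simps numeral_eq_Suc)
      finally show ?thesis
        using \<kappa> C0 by (subst (asm) ennreal_le_iff) (auto simp: less_imp_le)
    qed
    then show ?thesis by blast
  qed
  show ?thesis
  proof (rule LIMSEQ_I)
    fix r :: real assume r: "r > 0"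
    then obtain C where C: "\<And>n. \<bar>?X n - 4 * pi * q a\<bar> \<le> 4096 * (r / 8192) + C * eps n"
      using est[of "r / 8192"] by auto
    have "(\<lambda>n. C * eps n) \<longlonglongrightarrow> C * 0" by (intro tendsto_intros eps_tendsto)
    then have "\<forall>\<^sub>F n in sequentially. C * eps n < r / 2"
      using r by (intro order_tendstoD(2)) auto
    then obtain N where N: "\<And>n. n \<ge> N \<Longrightarrow> C * eps n < r / 2"
      by (auto simp: eventually_sequentially)
    show "\<exists>N. \<forall>n\<ge>N. norm (?X n - 4 * pi * q a) < r"
    proof (intro exI allI impI)
      fix n assume "n \<ge> N"
      then show "norm (?X n - 4 * pi * q a) < r"
        using C[of n] N[of n] r by simp
    qed
  qed
qed

section \<open>Integrals of derivatives of test functions\<close>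

lemma test_function_integrable:
  assumes "test_function g"
  shows "integrable lborel g"
proof -
  have "set_integrable lborel (supp g) g"
    using assms unfolding set_integrable_def
    by (intro borel_integrable_compact smooth_continuous_on) (auto simp: test_function_iff)
  moreover have "(\<lambda>x. indicator (supp g) x *\<^sub>R g x) = g"
    using zero_outside_supp[of _ g] by (auto simp: fun_eq_iff indicator_def)
  ultimately show ?thesis by (simp add: set_integrable_def)
qed

text \<open>Difference quotients have integral zero by translation invariance, and dominated
  convergence passes this on to the derivative. It makes the Laplacian of a test function a
  mean-zero weight, blind to additive constants.\<close>

lemma integral_partial_deriv:
  assumes g: "test_function g"
  shows "(\<integral>y. partial_deriv i g y \<partial>lborel) = 0"
proof -
  define v where "v = (axis i 1 :: R3)"
  have gs: "smooth g" using g by (simp add: test_function_iff)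
  have D: "((\<lambda>s. g (y + s *\<^sub>R v)) has_real_derivative partial_deriv i g (y + s *\<^sub>R v)) (at s)" for y s
  proof -
    have 1: "((\<lambda>s. y + s *\<^sub>R v) has_derivative (\<lambda>h. h *\<^sub>R v)) (at s)"
      by (auto intro!: derivative_eq_intros)
    have 2: "(g has_derivative frechet_derivative g (at (y + s *\<^sub>R v))) (at (y + s *\<^sub>R v))"
      using smooth_differentiable[OF gs] by (simp add: frechet_derivative_works)
    have "(\<lambda>h. frechet_derivative g (at (y + s *\<^sub>R v)) (h *\<^sub>R v)) = (*) (partial_deriv i g (y + s *\<^sub>R v))"
      using has_derivative_linear[OF 2] by (auto simp: fun_eq_iff linear_cmul partial_deriv_def v_def)
    then show ?thesis
      using has_derivative_compose[OF 1 2] by (simp add: has_field_derivative_def)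
  qed
  obtain M where M: "\<And>y. \<bar>partial_deriv i g y\<bar> \<le> M"
    using test_function_bounded[OF test_function_partial_deriv[OF g]] by blast
  have M0: "M \<ge> 0" using M[of 0] by linarith
  obtain \<rho> where \<rho>: "supp g \<subseteq> ball 0 \<rho>"
    using g bounded_subset_ballD compact_imp_bounded test_function_iff by metis
  have [measurable]: "g \<in> borel_measurable borel" by (rule smooth_measurable[OF gs])
  define d where "d n y = (g (y + eps n *\<^sub>R v) - g y) / eps n" for n y
  have shift: "integrable lborel (\<lambda>y. g (y + c))" "(\<integral>y. g (y + c) \<partial>lborel) = (\<integral>y. g y \<partial>lborel)" for c
  proof -
    have "integrable (distr lborel borel ((+) c)) g"
      unfolding lborel_distr_plus by (rule test_function_integrable[OF g])
    then show "integrable lborel (\<lambda>y. g (y + c))"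
      by (subst (asm) integrable_distr_eq) (auto simp: add.commute)
    have "(\<integral>y. g (y + c) \<partial>lborel) = (\<integral>y. g y \<partial>distr lborel borel ((+) c))"
      by (subst integral_distr) (auto simp: add.commute)
    then show "(\<integral>y. g (y + c) \<partial>lborel) = (\<integral>y. g y \<partial>lborel)" by (simp add: lborel_distr_plus)
  qed
  have zero: "(\<integral>y. d n y \<partial>lborel) = 0" for n
    unfolding d_def using shift[of "eps n *\<^sub>R v"] test_function_integrable[OF g] by simp
  have "(\<lambda>n. \<integral>y. d n y \<partial>lborel) \<longlonglongrightarrow> (\<integral>y. partial_deriv i g y \<partial>lborel)"
  proof (rule integral_dominated_convergence)
    \<comment> \<open>All increments have length at most 1, so one enlargement of the radius by 1
      catches the difference quotients for every n; the mean value theorem bounds them by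
      \<open>M\<close>.\<close>
    show "integrable lborel (\<lambda>y. M * indicator (ball 0 (\<bar>\<rho>\<bar> + 1)) (y :: R3))"
      by (intro integrable_mult_right) (simp add: integrable_indicator_iff emeasure_ball_R3)
    show "AE y in lborel. (\<lambda>n. d n y) \<longlonglongrightarrow> partial_deriv i g y"
    proof (rule AE_I2)
      fix y
      have "((\<lambda>h. (g (y + (0 + h) *\<^sub>R v) - g (y + 0 *\<^sub>R v)) / h) \<longlongrightarrow> partial_deriv i g (y + 0 *\<^sub>R v)) (at 0)"
        using D[of y 0] unfolding DERIV_def .
      moreover have "filterlim eps (at 0) sequentially"
        using eps_tendsto by (simp add: filterlim_at less_imp_neq[OF eps_pos, symmetric])
      ultimately show "(\<lambda>n. d n y) \<longlonglongrightarrow> partial_deriv i g y"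
        unfolding d_def by (auto dest: filterlim_compose)
    qed
    show "AE y in lborel. norm (d n y) \<le> M * indicator (ball 0 (\<bar>\<rho>\<bar> + 1)) y" for n
    proof (rule AE_I2)
      fix y :: R3
      show "norm (d n y) \<le> M * indicator (ball 0 (\<bar>\<rho>\<bar> + 1)) y"
      proof (cases "y \<in> ball 0 (\<bar>\<rho>\<bar> + 1)")
        case True
        obtain s where "g (y + eps n *\<^sub>R v) - g (y + 0 *\<^sub>R v) = (eps n - 0) * partial_deriv i g (y + s *\<^sub>R v)"
          using MVT2[OF eps_pos D] by blast
        then have "d n y = partial_deriv i g (y + s *\<^sub>R v)"
          by (simp add: d_def less_imp_neq[OF eps_pos, symmetric])
        then show ?thesis using M True by simp
      next
        case False
        have "norm (eps n *\<^sub>R v) \<le> 1" by (simp add: v_def eps_def)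
        moreover have "norm y \<le> norm (y + eps n *\<^sub>R v) + norm (eps n *\<^sub>R v)"
          using norm_triangle_ineq4[of "y + eps n *\<^sub>R v" "eps n *\<^sub>R v"] by simp
        ultimately have "norm (y + eps n *\<^sub>R v) \<ge> \<rho>" "norm y \<ge> \<rho>"
          using False by (auto simp: not_less)
        then have "y + eps n *\<^sub>R v \<notin> supp g" "y \<notin> supp g" using \<rho> by auto
        then show ?thesis by (simp add: d_def zero_outside_supp M0)
      qed
    qed
    show "partial_deriv i g \<in> borel_measurable lborel"
      using smooth_measurable[OF smooth_partial_deriv[OF gs]] by simp
    show "d n \<in> borel_measurable lborel" for n
      unfolding d_def by measurable
  qed
  then show ?thesis by (simp only: zero LIMSEQ_const_iff)
qed

subsection \<open>Comparison of the pressure with the singular integral\<close>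

lemma C_alpha_loc_continuous:
  assumes "\<alpha> > 0" "C_alpha_loc \<alpha> f"
  shows "continuous_on UNIV f"
proof (intro continuous_at_imp_continuous_on ballI)
  fix x
  obtain C where C: "\<forall>u\<in>cball x 1. \<forall>v\<in>cball x 1. \<bar>f u - f v\<bar> \<le> C * norm (u - v) powr \<alpha>"
    using assms(2)[unfolded C_alpha_loc_def, rule_format, OF compact_cball[of x 1]] by blast
  have "((\<lambda>y. C * norm (y - x) powr \<alpha>) \<longlongrightarrow> C * norm (x - x) powr \<alpha>) (at x)"
    using assms(1) by (intro tendsto_intros) auto
  then have lim: "((\<lambda>y. C * norm (y - x) powr \<alpha>) \<longlongrightarrow> 0) (at x)" using assms(1) by simp
  have "((\<lambda>y. f y - f x) \<longlongrightarrow> 0) (at x)"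
  proof (rule Lim_null_comparison[OF _ lim])
    have "\<forall>\<^sub>F y in at x. y \<in> ball x 1"
      by (rule eventually_at_in_open') auto
    then show "\<forall>\<^sub>F y in at x. norm (f y - f x) \<le> C * norm (y - x) powr \<alpha>"
      by eventually_elim (use C in auto)
  qed
  then show "isCont f x" by (simp add: isCont_def LIM_zero_iff)
qed

text \<open>The set where a continuous function exceeds its almost-everywhere bound is open and
  negligible, hence empty.\<close>

lemma L_inf_bounded:
  assumes "L_inf f" "continuous_on UNIV f"
  shows "\<exists>M. \<forall>x. \<bar>f x\<bar> \<le> M"
proof -
  obtain C where C: "AE x in lebesgue. \<bar>f x\<bar> \<le> C" using assms by (auto simp: L_inf_def)
  have op: "open {x. C < \<bar>f x\<bar>}"
    using assms(2) by (intro open_Collect_less continuous_intros)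
  have "negligible {x. C < \<bar>f x\<bar>}"
    using C by (simp add: negligible_iff_null_sets completion.AE_iff_null_sets not_le)
  then have "{x. C < \<bar>f x\<bar>} = {}" using op open_not_negligible by blast
  then have "\<forall>x. \<bar>f x\<bar> \<le> C" by (auto simp: not_less)
  then show ?thesis by blast
qed

lemma regularised_instance:
  fixes f :: "3 \<Rightarrow> 3 \<Rightarrow> R3 \<Rightarrow> real"
  assumes \<Theta>: "test_function \<Theta>" "\<forall>x\<in>ball 0 2. \<Theta> x = 1" "supp \<Theta> \<subseteq> ball 0 4"
    and \<alpha>: "\<alpha> > 0" and f: "\<And>i j. L_inf (f i j)" "\<And>i j. C_alpha_loc \<alpha> (f i j)"
  obtains Mf MT \<beta> where "\<And>i j R. R > 0 \<Longrightarrow> regularised \<Theta> (f i j) R Mf MT \<beta>"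
proof -
  have cont: "continuous_on UNIV (f i j)" for i j
    by (rule C_alpha_loc_continuous[OF \<alpha> f(2)])
  obtain MT where MT: "\<And>y. \<bar>\<Theta> y\<bar> \<le> MT"
    using test_function_bounded[OF \<Theta>(1)] by blast
  obtain Mf where Mf: "\<And>i j y. \<bar>f i j y\<bar> \<le> Mf"
    using uniform_bound_finite[of "\<lambda>(i, j). f i j" "\<lambda>_. 1"] L_inf_bounded[OF f(1) cont] by auto
  \<comment> \<open>Lowering the exponent is permitted because only distances up to 1 are
    compared.\<close>
  define \<beta> where "\<beta> = min \<alpha> 1"
  have \<beta>: "0 < \<beta>" "\<beta> \<le> 1" "\<beta> \<le> \<alpha>" using \<alpha> by (auto simp: \<beta>_def)
  have hoelder: "\<exists>L. \<forall>y. norm (x - y) \<le> 1 \<longrightarrow> \<bar>f i j y - f i j x\<bar> \<le> L * norm (x - y) powr \<beta>" for i j x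
  proof -
    obtain C where C: "\<forall>u\<in>cball x 1. \<forall>v\<in>cball x 1. \<bar>f i j u - f i j v\<bar> \<le> C * norm (u - v) powr \<alpha>"
      using f(2)[of i j, unfolded C_alpha_loc_def, rule_format, OF compact_cball[of x 1]] by blast
    have "\<bar>f i j y - f i j x\<bar> \<le> \<bar>C\<bar> * norm (x - y) powr \<beta>" if y: "norm (x - y) \<le> 1" for y
    proof -
      have "\<bar>f i j y - f i j x\<bar> \<le> C * norm (y - x) powr \<alpha>"
        using C y by (simp add: dist_norm)
      also have "\<dots> \<le> \<bar>C\<bar> * norm (x - y) powr \<beta>"
        unfolding norm_minus_commute[of y x] using \<beta> y by (intro mult_mono powr_mono') auto
      finally show ?thesis .
    qed
    then show ?thesis by blast
  qed
  have out: "\<Theta> y = 0" if "norm y \<ge> 4" for y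
  proof -
    have "y \<notin> supp \<Theta>" using \<Theta>(3) that by auto
    then show ?thesis by (rule zero_outside_supp)
  qed
  have "regularised \<Theta> (f i j) R Mf MT \<beta>" if "R > 0" for i j R
  proof
    show "continuous_on UNIV \<Theta>" using \<Theta>(1) by (simp add: test_function_iff smooth_continuous_on)
  qed (use that \<beta> cont Mf hoelder MT \<Theta>(2) out in auto)
  then show ?thesis using that by blast
qed

context regularised
begin

lemma f_weighted_integrable: "integrable lborel (\<lambda>y. f y / (1 + norm y) ^ 4)"
proof (rule Bochner_Integration.integrable_bound)
  show "integrable lborel (\<lambda>y :: R3. Mf * (1 / (1 + norm y) ^ 4))"
    by (intro integrable_mult_right integrable_decay) simp
  have "norm (f y / (1 + norm y) ^ 4) \<le> norm (Mf * (1 / (1 + norm y) ^ 4))" for y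
    using f_bound[of y] by (simp add: abs_divide divide_right_mono)
  then show "AE y in lborel. norm (f y / (1 + norm y) ^ 4) \<le> norm (Mf * (1 / (1 + norm y) ^ 4))" by simp
qed measurable

end

text \<open>The two \<open>centred\<close> integrands share their singular part and differ only in
  \<open>far\<close>, which does not involve x. So the difference of the \<open>G\<close> is
  constant in x, and \<open>c_integrand\<close> is integrable as a difference of integrable
  functions.\<close>

lemma G_change_radius:
  assumes 1: "regularised \<Theta> f (real k) Mf MT \<beta>" and 2: "regularised \<Theta> f (real (k + 1)) Mf MT \<beta>"
  shows "integrable lebesgue (c_integrand \<Theta> k i j f)"
    and "G \<Theta> 0 (real k) i j f x - G \<Theta> 0 (real (k + 1)) i j f x = - (LINT y|lebesgue. c_integrand \<Theta> k i j f y)"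
proof -
  interpret A: regularised \<Theta> f 0 "real k" Mf MT \<beta> by (rule 1)
  interpret B: regularised \<Theta> f 0 "real (k + 1)" Mf MT \<beta> by (rule 2)
  have c: "c_integrand \<Theta> k i j f y = f y * (A.far 0 i j (- y) - B.far 0 i j (- y)) / (4 * pi)" for y
    unfolding c_integrand_def Kfar_def Kker_eq_hess A.far_def B.far_def by (simp add: field_simps)
  have d: "B.centred 0 i j x y - A.centred 0 i j x y = 4 * pi * c_integrand \<Theta> k i j f y" for y
    unfolding c A.centred_def B.centred_def by (simp add: field_simps)
  have I: "integrable lborel (\<lambda>y. B.centred 0 i j x y - A.centred 0 i j x y)"
    by (intro Bochner_Integration.integrable_diff A.centred_integrable B.centred_integrable)
  from integrable_divide[OF I[unfolded d], of "4 * pi"]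
  have Ic: "integrable lborel (c_integrand \<Theta> k i j f)" by simp
  then show "integrable lebesgue (c_integrand \<Theta> k i j f)"
    by (subst integrable_completion) auto
  have "(\<integral>y. B.centred 0 i j x y \<partial>lborel) - (\<integral>y. A.centred 0 i j x y \<partial>lborel)
      = (\<integral>y. B.centred 0 i j x y - A.centred 0 i j x y \<partial>lborel)"
    by (intro Bochner_Integration.integral_diff[symmetric] A.centred_integrable B.centred_integrable)
  also have "\<dots> = 4 * pi * (\<integral>y. c_integrand \<Theta> k i j f y \<partial>lborel)"
    unfolding d by simp
  also have "(\<integral>y. c_integrand \<Theta> k i j f y \<partial>lborel) = (LINT y|lebesgue. c_integrand \<Theta> k i j f y)"
    using Ic by (intro integral_completion[symmetric]) auto
  finally show "G \<Theta> 0 (real k) i j f x - G \<Theta> 0 (real (k + 1)) i j f x = - (LINT y|lebesgue. c_integrand \<Theta> k i j f y)"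
    unfolding A.G_eq B.G_eq by (simp add: field_simps)
qed

text \<open>The sum of the \<open>c_const\<close> telescopes, so each overlapping clause prescribes
  the value of the same globally defined function, and the balls exhaust the space.\<close>

lemma pbar_spec_iff:
  assumes step: "\<And>k x. k \<ge> 2 \<Longrightarrow> G_sum \<Theta> 0 (real k) f x - G_sum \<Theta> 0 (real (k + 1)) f x = c_const \<Theta> f k"
  shows "pbar_spec \<Theta> f pbar \<longleftrightarrow> pbar = G_sum \<Theta> 0 2 f"
proof -
  have tele: "G_sum \<Theta> 0 (real (n + 1)) f x + (\<Sum>k=2..n. c_const \<Theta> f k) = G_sum \<Theta> 0 2 f x" if "n \<ge> 2" for n x
    using that
  proof (induction n rule: dec_induct)
    case base
    then show ?case using step[of 2 x] by simp
  next
    case (step n)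
    then show ?case using assms[of "Suc n" x] by simp
  qed
  have large: "\<exists>n\<ge>2. x \<in> ball 0 (real n)" for x :: R3
  proof -
    obtain n :: nat where "norm x < real n" using reals_Archimedean2 by blast
    then show ?thesis by (intro exI[of _ "max n 2"]) auto
  qed
  show ?thesis
  proof
    assume spec: "pbar_spec \<Theta> f pbar"
    show "pbar = G_sum \<Theta> 0 2 f"
    proof
      fix x :: R3
      obtain n where n: "n \<ge> 2" "x \<in> ball 0 (real n)" using large[of x] by (elim exE conjE)
      then have "pbar x = G_sum \<Theta> 0 (real (n + 1)) f x + (\<Sum>k=2..n. c_const \<Theta> f k)"
        using spec by (simp only: pbar_spec_def)
      then show "pbar x = G_sum \<Theta> 0 2 f x" by (simp only: tele[OF n(1)])
    qed
  next
    assume "pbar = G_sum \<Theta> 0 2 f"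
    then show "pbar_spec \<Theta> f pbar"
      unfolding pbar_spec_def by (auto simp only: tele)
  qed
qed

text \<open>The tested identity passes to the limit at any two Lebesgue points; keeping one of them
  fixed turns it into equality up to a constant at almost every point.\<close>

lemma pressure_eq_G_sum_plus_const:
  assumes \<Theta>: "test_function \<Theta>" "\<forall>x\<in>ball 0 2. \<Theta> x = 1" "supp \<Theta> \<subseteq> ball 0 4"
    and reg: "\<And>i j. regularised \<Theta> (f i j) R Mf MT \<beta>"
    and p: "BMO p" and sol: "solves_poisson f p"
  shows "\<exists>c. AE x in lebesgue. p x = G_sum \<Theta> x0 R f x + c"
proof -
  have L: "L1_loc p" using p by (simp add: BMO_def)
  have pm: "p \<in> borel_measurable lebesgue" by (rule L1_loc_measurable[OF L])
  \<comment> \<open>p is only Lebesgue measurable and determined almost everywhere; pointwise values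
    are taken from a Borel representative.\<close>
  then obtain q where q [measurable]: "q \<in> borel_measurable lborel" and pq: "AE x in lborel. p x = q x"
    using completion_ex_borel_measurable_real by blast
  have qb: "q \<in> borel_measurable borel" using q by simp
  have pq': "AE x in lebesgue. p x = q x" by (rule AE_completion[OF pq])
  have pw: "integrable lebesgue (\<lambda>y. p y / (1 + norm y) ^ 4)" by (rule BMO_weighted_integrable[OF p])
  have nm: "(\<lambda>y :: R3. h y) \<in> borel_measurable lebesgue" if "h \<in> borel_measurable borel" for h :: "R3 \<Rightarrow> real"
    using that by (intro measurable_completion) simp
  have "integrable lebesgue (\<lambda>y. q y / (1 + norm y) ^ 4)"
  proof (subst integrable_cong_AE)
    show "(\<lambda>y. q y / (1 + norm y) ^ 4) \<in> borel_measurable lebesgue" by (rule nm) measurable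
    show "(\<lambda>y. p y / (1 + norm y) ^ 4) \<in> borel_measurable lebesgue" using pw by blast
    show "AE y in lebesgue. q y / (1 + norm y) ^ 4 = p y / (1 + norm y) ^ 4"
      using pq' by eventually_elim simp
  qed (rule pw)
  then have qw: "integrable lborel (\<lambda>y. q y / (1 + norm y) ^ 4)"
    by (subst (asm) integrable_completion) measurable
  have qint: "set_integrable lborel S q" if "compact S" for S
  proof -
    have [measurable]: "S \<in> sets borel" using that by (simp add: compact_imp_closed borel_closed)
    have "integrable lebesgue (\<lambda>y. indicator S y *\<^sub>R q y)"
    proof (subst integrable_cong_AE)
      show pS: "integrable lebesgue (\<lambda>y. indicator S y *\<^sub>R p y)"
        using L that by (simp add: L1_loc_def set_integrable_def)
      show "(\<lambda>y. indicator S y *\<^sub>R p y) \<in> borel_measurable lebesgue"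
        using pS by blast
      show "(\<lambda>y. indicator S y *\<^sub>R q y) \<in> borel_measurable lebesgue" by (rule nm) measurable
      show "AE y in lebesgue. indicator S y *\<^sub>R q y = indicator S y *\<^sub>R p y"
        using pq' by eventually_elim simp
    qed
    then show ?thesis
      unfolding set_integrable_def by (subst (asm) integrable_completion) measurable
  qed
  have fb: "f i j \<in> borel_measurable borel" for i j
    by (rule regularised.f_measurable[OF reg])
  have fw: "integrable lebesgue (\<lambda>y. f i j y / (1 + norm y) ^ 4)" for i j
    using regularised.f_weighted_integrable[OF reg, of i j] by (subst integrable_completion) auto
  have key: "q a - q b = G_sum \<Theta> x0 R f a - G_sum \<Theta> x0 R f b"
    if a: "lebesgue_point q a" and b: "lebesgue_point q b" for a b
  proof -
    let ?k = "\<lambda>n x y. 3 * eps n ^ 2 * wt (eps n) (x - y) ^ 5"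
    let ?h = "\<lambda>n i j y. f i j y * (hess (eps n) i j (a - y) - hess (eps n) i j (b - y))"
    have Ik: "integrable lborel (\<lambda>y. q y * ?k n x y)" for n x
      using integrable_mult_right[OF integrable_weighted_wt5[OF qb eps_pos qw], of "3 * eps n ^ 2" n x]
      by (simp add: mult_ac)
    have eq: "(\<integral>y. q y * ?k n a y \<partial>lborel) - (\<integral>y. q y * ?k n b y \<partial>lborel)
        = (\<Sum>i\<in>UNIV. \<Sum>j\<in>UNIV. \<integral>y. ?h n i j y \<partial>lborel)" for n
    proof -
      have Ih: "integrable lborel (?h n i j)" for i j
        by (rule regularised.difference_tendsto_G(1)[OF reg])
      have "(\<integral>y. q y * ?k n a y \<partial>lborel) - (\<integral>y. q y * ?k n b y \<partial>lborel)
          = (\<integral>y. q y * ?k n a y - q y * ?k n b y \<partial>lborel)"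
        by (rule Bochner_Integration.integral_diff[OF Ik Ik, symmetric])
      also have "\<dots> = (\<integral>y. q y * (?k n a y - ?k n b y) \<partial>lborel)"
        by (simp only: right_diff_distrib)
      also have "\<dots> = (LINT y|lebesgue. q y * (?k n a y - ?k n b y))"
        by (rule integral_completion[symmetric]) measurable
      also have "\<dots> = (LINT y|lebesgue. p y * (?k n a y - ?k n b y))"
      proof (rule integral_cong_AE)
        have k: "(\<lambda>y. ?k n a y - ?k n b y) \<in> borel_measurable lebesgue"
          by (rule nm) measurable
        show "(\<lambda>y. q y * (?k n a y - ?k n b y)) \<in> borel_measurable lebesgue"
          by (rule nm) measurable
        show "(\<lambda>y. p y * (?k n a y - ?k n b y)) \<in> borel_measurable lebesgue"
          by (rule borel_measurable_times[OF pm k])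
        show "AE y in lebesgue. q y * (?k n a y - ?k n b y) = p y * (?k n a y - ?k n b y)"
          using pq' by eventually_elim simp
      qed
      also have "\<dots> = (LINT y|lebesgue. (\<Sum>i\<in>UNIV. \<Sum>j\<in>UNIV. ?h n i j y))"
        by (rule poisson_kernel[OF \<Theta> sol eps_pos pw pm fw nm[OF fb]])
      also have "\<dots> = (\<integral>y. (\<Sum>i\<in>UNIV. \<Sum>j\<in>UNIV. ?h n i j y) \<partial>lborel)"
        by (rule integral_completion) (intro borel_measurable_sum borel_measurable_integrable Ih)
      also have "\<dots> = (\<Sum>i\<in>UNIV. \<Sum>j\<in>UNIV. \<integral>y. ?h n i j y \<partial>lborel)"
        by (simp only: Bochner_Integration.integral_sum Bochner_Integration.integrable_sum Ih)
      finally show ?thesis .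
    qed
    have lim_p: "(\<lambda>n. (\<integral>y. q y * ?k n a y \<partial>lborel) - (\<integral>y. q y * ?k n b y \<partial>lborel)) \<longlonglongrightarrow> 4 * pi * q a - 4 * pi * q b"
      by (intro tendsto_diff approximate_identity[OF qb qw] a b)
    have lim_f: "(\<lambda>n. \<Sum>i\<in>UNIV. \<Sum>j\<in>UNIV. \<integral>y. ?h n i j y \<partial>lborel) \<longlonglongrightarrow>
        (\<Sum>i\<in>UNIV. \<Sum>j\<in>UNIV. 4 * pi * (G \<Theta> x0 R i j (f i j) a - G \<Theta> x0 R i j (f i j) b))"
      by (intro tendsto_sum regularised.difference_tendsto_G(2)[OF reg])
    have val: "(\<Sum>i\<in>UNIV. \<Sum>j\<in>UNIV. 4 * pi * (G \<Theta> x0 R i j (f i j) a - G \<Theta> x0 R i j (f i j) b))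
        = 4 * pi * (G_sum \<Theta> x0 R f a - G_sum \<Theta> x0 R f b)"
      by (simp only: G_sum_def sum_subtractf[symmetric] sum_distrib_left)
    have "4 * pi * q a - 4 * pi * q b = 4 * pi * (G_sum \<Theta> x0 R f a - G_sum \<Theta> x0 R f b)"
      using LIMSEQ_unique[OF lim_p[unfolded eq] lim_f] by (simp only: val)
    then have "4 * pi * (q a - q b) = 4 * pi * (G_sum \<Theta> x0 R f a - G_sum \<Theta> x0 R f b)"
      by (simp only: right_diff_distrib)
    then show ?thesis by simp
  qed
  have ae: "AE x in lborel. lebesgue_point q x"
    by (rule AE_lebesgue_point[OF qb qint])
  \<comment> \<open>The reference point exists because a property valid almost everywhere cannot
    fail everywhere on a space of nonzero measure.\<close>
  have "\<exists>b. lebesgue_point q b"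
  proof (rule ccontr)
    assume "\<nexists>b. lebesgue_point q b"
    with ae have "AE x in (lborel :: R3 measure). False" by simp
    then show False by (simp add: eventually_False ae_filter_eq_bot_iff emeasure_lborel_UNIV)
  qed
  then obtain b where b: "lebesgue_point q b" by blast
  have "AE x in lborel. p x = G_sum \<Theta> x0 R f x + (q b - G_sum \<Theta> x0 R f b)"
    using ae pq
  proof eventually_elim
    case (elim x)
    then show ?case using key[OF elim(1) b] by simp
  qed
  then show ?thesis using AE_completion by blast
qed

section \<open>Invariance under additive constants and null sets\<close>

lemma L1_loc_mult_integrable:
  assumes L: "L1_loc p" and h: "h \<in> borel_measurable lebesgue" "\<And>x. \<bar>h x\<bar> \<le> M" "\<And>x. x \<notin> ball x0 r \<Longrightarrow> h x = 0"
  shows "integrable lebesgue (\<lambda>x. p x * h x)"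
proof (rule Bochner_Integration.integrable_bound)
  show "integrable lebesgue (\<lambda>x. M * (indicator (ball x0 r) x *\<^sub>R p x))"
    using L1_loc_ball[OF L] by (intro integrable_mult_right) (simp add: set_integrable_def)
  show "(\<lambda>x. p x * h x) \<in> borel_measurable lebesgue"
    by (intro borel_measurable_times L1_loc_measurable[OF L] h)
  have "norm (p x * h x) \<le> norm (M * (indicator (ball x0 r) x *\<^sub>R p x))" for x
  proof (cases "x \<in> ball x0 r")
    case True
    have "\<bar>p x\<bar> * \<bar>h x\<bar> \<le> \<bar>p x\<bar> * \<bar>M\<bar>"
      using h(2)[of x] by (intro mult_left_mono) auto
    with True show ?thesis by (simp add: abs_mult mult.commute)
  qed (use h(3)[of x] in simp)
  then show "AE x in lebesgue. norm (p x * h x) \<le> norm (M * (indicator (ball x0 r) x *\<^sub>R p x))" by simp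
qed

lemma L1_loc_const: "L1_loc (\<lambda>x. c)"
  unfolding L1_loc_def set_integrable_def
proof (intro allI impI)
  fix S :: "R3 set" assume S: "compact S"
  then show "integrable lebesgue (\<lambda>x. indicator S x *\<^sub>R c)"
    using emeasure_compact_finite[OF S]
    by (intro integrable_scaleR_left) (simp add: integrable_indicator_iff compact_imp_closed)
qed

lemma L1_loc_shift:
  assumes L: "L1_loc p" and ae: "AE x in lebesgue. p x = g x + c"
  shows "L1_loc g"
proof -
  have pm: "p \<in> borel_measurable lebesgue" by (rule L1_loc_measurable[OF L])
  have gm: "g \<in> borel_measurable lebesgue"
  proof (rule borel_measurable_AE)
    show "(\<lambda>x. p x - c) \<in> borel_measurable lebesgue" using pm by simp
    show "AE x in lebesgue. p x - c = g x" using ae by eventually_elim simp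
  qed
  show ?thesis
    unfolding L1_loc_def set_integrable_def
  proof (intro allI impI)
    fix S :: "R3 set" assume S: "compact S"
    have "integrable lebesgue (\<lambda>x. indicator S x *\<^sub>R p x - indicator S x *\<^sub>R c)"
      using L L1_loc_const[of c] S unfolding L1_loc_def set_integrable_def
      by (intro Bochner_Integration.integrable_diff) auto
    then show "integrable lebesgue (\<lambda>x. indicator S x *\<^sub>R g x)"
    proof (rule integrable_cong_AE_imp)
      show "(\<lambda>x. indicator S x *\<^sub>R g x) \<in> borel_measurable lebesgue"
        using S gm by (intro borel_measurable_scaleR borel_measurable_indicator) (auto simp: compact_imp_closed)
      show "AE x in lebesgue. indicator S x *\<^sub>R p x - indicator S x *\<^sub>R c = indicator S x *\<^sub>R g x"
        using ae by eventually_elim (simp add: algebra_simps)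
    qed
  qed
qed

text \<open>The mean-zero weight annihilates the constant. This one lemma serves both the pairing
  with \<psi> and, with the Laplacian of a test function as weight, the equation itself.\<close>

lemma integral_shift:
  assumes L: "L1_loc p" and ae: "AE x in lebesgue. p x = g x + c"
    and h: "h \<in> borel_measurable lebesgue" "\<And>x. \<bar>h x\<bar> \<le> M" "\<And>x. x \<notin> ball x0 r \<Longrightarrow> h x = 0"
    and zero: "(LINT x|lebesgue. h x) = 0"
  shows "(LINT x|lebesgue. p x * h x) = (LINT x|lebesgue. g x * h x)"
proof -
  have Lg: "L1_loc g" by (rule L1_loc_shift[OF L ae])
  have "(LINT x|lebesgue. p x * h x) = (LINT x|lebesgue. g x * h x + c * h x)"
  proof (rule integral_cong_AE)
    show "AE x in lebesgue. p x * h x = g x * h x + c * h x"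
      using ae by eventually_elim (simp add: algebra_simps)
  qed (intro borel_measurable_times borel_measurable_add borel_measurable_const
      L1_loc_measurable[OF L] L1_loc_measurable[OF Lg] h)+
  also have "\<dots> = (LINT x|lebesgue. g x * h x) + (LINT x|lebesgue. c * h x)"
    by (intro Bochner_Integration.integral_add L1_loc_mult_integrable[OF _ h] Lg L1_loc_const)
  also have "(LINT x|lebesgue. c * h x) = 0" by (simp add: zero)
  finally show ?thesis by simp
qed

lemma laplacian_test_function:
  assumes g: "test_function \<phi>"
  shows "laplacian \<phi> \<in> borel_measurable lebesgue" "\<exists>M. \<forall>x. \<bar>laplacian \<phi> x\<bar> \<le> M"
    "\<exists>r. \<forall>x. x \<notin> ball 0 r \<longrightarrow> laplacian \<phi> x = 0" "(LINT x|lebesgue. laplacian \<phi> x) = 0"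
proof -
  have t: "test_function (partial_deriv i (partial_deriv i \<phi>))" for i
    by (intro test_function_partial_deriv g)
  have m: "partial_deriv i (partial_deriv i \<phi>) \<in> borel_measurable borel" for i
    using t by (simp add: test_function_iff smooth_measurable)
  have lm: "laplacian \<phi> \<in> borel_measurable lborel"
    unfolding laplacian_def[abs_def] using m by (intro borel_measurable_sum) simp
  then show "laplacian \<phi> \<in> borel_measurable lebesgue" by (rule measurable_completion)
  obtain M where M: "\<And>i x. \<bar>partial_deriv i (partial_deriv i \<phi>) x\<bar> \<le> M"
    using uniform_bound_finite[of "\<lambda>i. partial_deriv i (partial_deriv i \<phi>)" "\<lambda>_. 1"] test_function_bounded[OF t] by auto
  have "\<bar>laplacian \<phi> x\<bar> \<le> (\<Sum>i\<in>(UNIV :: 3 set). M)" for x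
    unfolding laplacian_def by (rule order_trans[OF sum_abs sum_mono[OF M]])
  then show "\<exists>M. \<forall>x. \<bar>laplacian \<phi> x\<bar> \<le> M" by blast
  obtain r where r: "supp \<phi> \<subseteq> ball 0 r"
    using g bounded_subset_ballD compact_imp_bounded test_function_iff by metis
  have "laplacian \<phi> x = 0" if "x \<notin> ball 0 r" for x
  proof -
    have "x \<notin> supp (partial_deriv i \<phi>)" for i
      using that r supp_partial_deriv[of i \<phi>] by blast
    then show ?thesis by (simp add: laplacian_def partial_deriv_outside_supp)
  qed
  then show "\<exists>r. \<forall>x. x \<notin> ball 0 r \<longrightarrow> laplacian \<phi> x = 0" by blast
  have "(LINT x|lebesgue. laplacian \<phi> x) = (\<integral>x. laplacian \<phi> x \<partial>lborel)"
    by (rule integral_completion[OF lm])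
  also have "\<dots> = (\<Sum>i\<in>UNIV. \<integral>x. partial_deriv i (partial_deriv i \<phi>) x \<partial>lborel)"
    unfolding laplacian_def by (intro Bochner_Integration.integral_sum test_function_integrable t)
  also have "\<dots> = 0"
    by (simp add: integral_partial_deriv test_function_partial_deriv g)
  finally show "(LINT x|lebesgue. laplacian \<phi> x) = 0" .
qed

lemma solves_poisson_shift:
  assumes sol: "solves_poisson f p" and ae: "AE x in lebesgue. p x = g x + c"
  shows "solves_poisson f g"
proof -
  have L: "L1_loc p" using sol by (simp add: solves_poisson_def)
  have "(LINT x|lebesgue. p x * laplacian \<phi> x) = (LINT x|lebesgue. g x * laplacian \<phi> x)" if \<phi>: "test_function \<phi>" for \<phi>
  proof -
    obtain M r where "\<And>x. \<bar>laplacian \<phi> x\<bar> \<le> M" "\<And>x. x \<notin> ball 0 r \<Longrightarrow> laplacian \<phi> x = 0"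
      using laplacian_test_function(2,3)[OF \<phi>] by blast
    then show ?thesis
      by (rule integral_shift[OF L ae laplacian_test_function(1)[OF \<phi>] _ _ laplacian_test_function(4)[OF \<phi>]])
  qed
  with sol L1_loc_shift[OF L ae] show ?thesis by (simp add: solves_poisson_def)
qed

text \<open>The mean moves by the same constant as the function, so the oscillation over each ball
  is unchanged and membership in BMO carries over from p to g.\<close>

lemma BMO_eq_shift:
  assumes p: "BMO p" and ae: "AE x in lebesgue. p x = g x + c"
  shows "BMO_eq p g"
proof -
  have L: "L1_loc p" using p by (simp add: BMO_def)
  have Lg: "L1_loc g" by (rule L1_loc_shift[OF L ae])
  note meas = L1_loc_measurable[OF L] L1_loc_measurable[OF Lg]
  have "avg (ball x0 r) (\<lambda>x. \<bar>g x - avg (ball x0 r) g\<bar>) = avg (ball x0 r) (\<lambda>x. \<bar>p x - avg (ball x0 r) p\<bar>)"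
    if r: "r > 0" for x0 r
  proof -
    let ?B = "ball x0 r"
    have B: "measure lebesgue ?B > 0" using r by (simp only: measure_ball_R3) simp
    have cong: "(LINT x:?B|lebesgue. u x) = (LINT x:?B|lebesgue. v x)"
      if "u \<in> borel_measurable lebesgue" "v \<in> borel_measurable lebesgue" "AE x in lebesgue. u x = v x" for u v :: "R3 \<Rightarrow> real"
      unfolding set_lebesgue_integral_def
    proof (rule integral_cong_AE)
      show "AE x in lebesgue. indicator ?B x *\<^sub>R u x = indicator ?B x *\<^sub>R v x"
        using that(3) by eventually_elim simp
    qed ((rule borel_measurable_scaleR[OF borel_measurable_indicator], simp, rule that)+)
    have "(LINT x:?B|lebesgue. p x) = (LINT x:?B|lebesgue. g x + c)"
      by (intro cong ae meas borel_measurable_add borel_measurable_const)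
    also have "\<dots> = (LINT x:?B|lebesgue. g x) + (LINT x:?B|lebesgue. c)"
      by (rule set_integral_add(2)[OF L1_loc_ball[OF Lg] L1_loc_ball[OF L1_loc_const]])
    also have "(LINT x:?B|lebesgue. c) = measure lebesgue ?B * c"
      by (simp add: set_lebesgue_integral_def)
    finally have "avg ?B p = avg ?B g + c"
      using B by (simp add: avg_def add_divide_distrib)
    then have "AE x in lebesgue. \<bar>g x - avg ?B g\<bar> = \<bar>p x - avg ?B p\<bar>"
      using ae by (elim eventually_mono) simp
    then have "(LINT x:?B|lebesgue. \<bar>g x - avg ?B g\<bar>) = (LINT x:?B|lebesgue. \<bar>p x - avg ?B p\<bar>)"
      by (intro cong borel_measurable_abs borel_measurable_diff borel_measurable_const meas)
    then show ?thesis by (simp only: avg_def[of ?B "\<lambda>x. \<bar>g x - avg ?B g\<bar>"] avg_def[of ?B "\<lambda>x. \<bar>p x - avg ?B p\<bar>"])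
  qed
  then have "BMO g" using p Lg by (auto simp: BMO_def)
  with p ae show ?thesis by (auto simp: BMO_eq_def)
qed

theorem theorem2p1:
  fixes \<Theta> :: "real ^ 3 \<Rightarrow> real"
    and f :: "3 \<Rightarrow> 3 \<Rightarrow> real ^ 3 \<Rightarrow> real"
    and p :: "real ^ 3 \<Rightarrow> real"
    and \<alpha> :: real
  assumes "test_function \<Theta>"
    and "\<forall>x\<in>ball 0 2. \<Theta> x = 1"
    and "supp \<Theta> \<subseteq> ball 0 4"
    and "\<alpha> > 0"
    and "\<forall>i j. L_inf (f i j)"
    and "\<forall>i j. C_alpha_loc \<alpha> (f i j)"
    and "BMO p"
    and "solves_poisson f p"
  shows "(\<forall>x0 R i j x. R > 0 \<longrightarrow> G_well_defined \<Theta> x0 R i j (f i j) x) \<and>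
    (\<forall>k\<ge>2. (\<forall>i j. integrable lebesgue (c_integrand \<Theta> k i j (f i j))) \<and>
      (\<forall>x. G_sum \<Theta> 0 (real k) f x - G_sum \<Theta> 0 (real (k + 1)) f x = c_const \<Theta> f k)) \<and>
    (\<exists>!pbar. pbar_spec \<Theta> f pbar) \<and>
    (\<forall>pbar. pbar_spec \<Theta> f pbar \<longrightarrow>
      solves_poisson f pbar \<and>
      (\<forall>x0 R \<psi>. R > 0 \<and> \<psi> \<in> borel_measurable lebesgue \<and> bounded (range \<psi>) \<and>
          (\<forall>x. x \<notin> ball x0 R \<longrightarrow> \<psi> x = 0) \<and> (LINT x|lebesgue. \<psi> x) = 0 \<longrightarrow>
        integrable lebesgue (\<lambda>x. p x * \<psi> x) \<and>
        integrable lebesgue (\<lambda>x. G_sum \<Theta> x0 R f x * \<psi> x) \<and>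
        integrable lebesgue (\<lambda>x. pbar x * \<psi> x) \<and>
        (LINT x|lebesgue. p x * \<psi> x) = (LINT x|lebesgue. G_sum \<Theta> x0 R f x * \<psi> x) \<and>
        (LINT x|lebesgue. G_sum \<Theta> x0 R f x * \<psi> x) = (LINT x|lebesgue. pbar x * \<psi> x)) \<and>
      BMO_eq p pbar)"
proof -
  note \<Theta> = assms(1-3)
  have L: "L1_loc p" using assms(7) by (simp add: BMO_def)
  obtain Mf MT \<beta> where reg: "\<And>i j R. R > 0 \<Longrightarrow> regularised \<Theta> (f i j) R Mf MT \<beta>"
    using regularised_instance[OF \<Theta> assms(4), of f] assms(5,6) by metis
  have G: "G_well_defined \<Theta> x0 R i j (f i j) x" if "R > 0" for x0 R i j x
    by (rule regularised.G_well_defined[OF reg[OF that]])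
  have c: "integrable lebesgue (c_integrand \<Theta> k i j (f i j))"
    "G \<Theta> 0 (real k) i j (f i j) x - G \<Theta> 0 (real (k + 1)) i j (f i j) x = - (LINT y|lebesgue. c_integrand \<Theta> k i j (f i j) y)"
    if "k \<ge> 2" for k i j x
    using that by (intro G_change_radius[OF reg reg]; simp)+
  have step: "G_sum \<Theta> 0 (real k) f x - G_sum \<Theta> 0 (real (k + 1)) f x = c_const \<Theta> f k" if "k \<ge> 2" for k x
    unfolding G_sum_def c_const_def sum_subtractf[symmetric] sum_negf[symmetric] by (intro sum.cong refl c(2) that)
  have ae: "\<exists>c. AE x in lebesgue. p x = G_sum \<Theta> x0 R f x + c" if "R > 0" for x0 R
    by (rule pressure_eq_G_sum_plus_const[OF \<Theta> reg[OF that] assms(7,8)])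
  \<comment> \<open>Centre 0 and radius 2 are singled out because the clauses for p-bar describe
    precisely this \<open>G_sum\<close>.\<close>
  obtain c where pbar: "AE x in lebesgue. p x = G_sum \<Theta> 0 2 f x + c"
    using ae[of 2 0] by auto
  have pairing: "integrable lebesgue (\<lambda>x. p x * \<psi> x) \<and>
        integrable lebesgue (\<lambda>x. G_sum \<Theta> x0 R f x * \<psi> x) \<and>
        integrable lebesgue (\<lambda>x. G_sum \<Theta> 0 2 f x * \<psi> x) \<and>
        (LINT x|lebesgue. p x * \<psi> x) = (LINT x|lebesgue. G_sum \<Theta> x0 R f x * \<psi> x) \<and>
        (LINT x|lebesgue. G_sum \<Theta> x0 R f x * \<psi> x) = (LINT x|lebesgue. G_sum \<Theta> 0 2 f x * \<psi> x)"
    if R: "R > 0" and \<psi>: "\<psi> \<in> borel_measurable lebesgue" "bounded (range \<psi>)"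
      "\<And>x. x \<notin> ball x0 R \<Longrightarrow> \<psi> x = 0" "(LINT x|lebesgue. \<psi> x) = 0" for x0 R \<psi>
  proof -
    obtain M where M: "\<And>x. \<bar>\<psi> x\<bar> \<le> M" using \<psi>(2) by (auto simp: bounded_iff)
    obtain c' where c': "AE x in lebesgue. p x = G_sum \<Theta> x0 R f x + c'"
      using ae[OF R] by blast
    \<comment> \<open>p, the \<open>G_sum\<close> of the given ball and p-bar agree almost
      everywhere up to constants; both equalities of pairings follow by comparing each of the other
      two with p.\<close>
    note int = L1_loc_mult_integrable[OF _ \<psi>(1) M \<psi>(3)]
    note eq = integral_shift[OF L _ \<psi>(1) M \<psi>(3,4)]
    show ?thesis
      using int[OF L] int[OF L1_loc_shift[OF L c']] int[OF L1_loc_shift[OF L pbar]] eq[OF c'] eq[OF pbar]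
      by simp
  qed
  have spec: "pbar_spec \<Theta> f g \<longleftrightarrow> g = G_sum \<Theta> 0 2 f" for g
    by (rule pbar_spec_iff) (rule step)
  show ?thesis
    unfolding spec
  proof (rule conjI[OF _ conjI[OF _ conjI[OF _ allI]]])
    show "\<forall>x0 R i j x. R > 0 \<longrightarrow> G_well_defined \<Theta> x0 R i j (f i j) x"
      using G by blast
    show "\<forall>k\<ge>2. (\<forall>i j. integrable lebesgue (c_integrand \<Theta> k i j (f i j))) \<and>
      (\<forall>x. G_sum \<Theta> 0 (real k) f x - G_sum \<Theta> 0 (real (k + 1)) f x = c_const \<Theta> f k)"
      using c(1) step by blast
    show "\<exists>!pbar. pbar = G_sum \<Theta> 0 2 f" by blast
    fix g
    show "g = G_sum \<Theta> 0 2 f \<longrightarrow> solves_poisson f g \<and>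
      (\<forall>x0 R \<psi>. R > 0 \<and> \<psi> \<in> borel_measurable lebesgue \<and> bounded (range \<psi>) \<and>
          (\<forall>x. x \<notin> ball x0 R \<longrightarrow> \<psi> x = 0) \<and> (LINT x|lebesgue. \<psi> x) = 0 \<longrightarrow>
        integrable lebesgue (\<lambda>x. p x * \<psi> x) \<and>
        integrable lebesgue (\<lambda>x. G_sum \<Theta> x0 R f x * \<psi> x) \<and>
        integrable lebesgue (\<lambda>x. g x * \<psi> x) \<and>
        (LINT x|lebesgue. p x * \<psi> x) = (LINT x|lebesgue. G_sum \<Theta> x0 R f x * \<psi> x) \<and>
        (LINT x|lebesgue. G_sum \<Theta> x0 R f x * \<psi> x) = (LINT x|lebesgue. g x * \<psi> x)) \<and>
      BMO_eq p g"
      by (intro impI, hypsubst, intro conjI[OF solves_poisson_shift[OF assms(8) pbar] conjI[OF _ BMO_eq_shift[OF assms(7) pbar]]]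
          allI impI, elim conjE, rule pairing) simp_all
  qed
qed

end
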